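(* Let $n>1$ and let all manifolds below have dimension $4n$. (i) Let $(M,g)$ be a hHqK manifold with closed Lee form $\varphi$ and reduced scalar curvature $\nu$, such that $g(\varphi,\varphi)+\nu\neq 0$ everywhere. Then with respect to the same hypercomplex structure $$g_0=\frac{1}{\nu^2}\bigl(g(\varphi,\varphi)+\nu\bigr)\bigl((\mathbf 1+\mathbf L)\,\varphi\otimes\varphi+\nu g\bigr)$$ is a pseudo-hyper-Kähler metric with hyper-Kähler potential $\mu=\frac{2}{\nu^2}\bigl(g(\varphi,\varphi)+\nu\bigr)$. The signature of $g_0$ is Riemannian when $\nu(g(\varphi,\varphi)+\nu)>0$ (and therefore always when $\nu>0$), and is $(4,4(n-1))$ with positive sign on $\mathrm{span}_{\mathbb H}\{\varphi\}$ when $\nu(g(\varphi,\varphi)+\nu)<0$. (ii) Let $(M,g_0)$ be a pseudo-hyper-Kähler manifold with hyper-Kähler potential $\mu$. Then for each real $p\neq 0$ $$g_p=-\frac{p}{(p\,g_0(d\mu,d\mu)+1)^2}(\mathbf 1+\mathbf L)\,d\mu\otimes d\mu+\frac{1}{p\,g_0(d\mu,d\mu)+1}\,g_0$$ (defined on the submanifold $p\,g_0(d\mu,d\mu)+1\neq 0$) forms together with the given hypercomplex structure a pseudo-hHqK structure with Lee form $\varphi_p=-d\ln|p\,g_0(d\mu,d\mu)+1|$ and reduced scalar curvature $4p$. The metric $g_p$ is positive definite when $p\,g_0(d\mu,d\mu)+1>0$ and $g_0$ is positive definite, and also when $p\,g_0(d\mu,d\mu)+1<0$ and $g_0$ has signature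 $(4,4(n-1))$ with positive sign on $\mathrm{span}_{\mathbb H}\{d\mu\}$. (iii) If $g_0$ (with potential $\mu$) is constructed from $g$ as in (i) and the $g_p$ are constructed from $g_0$ and $\mu$ as in (ii), then $g=g_{\frac14\nu}$. Similarly, if one starts with a pseudo-hyper-Kähler metric $g_0$ with hyper-Kähler potential and constructs $g_p$ as in (ii), then the pseudo-hyper-Kähler metric constructed from $g_p$ by the formula in (i) is the initial metric $g_0$.
   Context: An almost hypercomplex structure is a triple $(I,J,K)$ of almost complex structures with $I^2=J^2=K^2=-\mathbf 1=IJK$; it is hypercomplex if $I,J,K$ are integrable. Each of $I,J,K$ acts on $1$-forms by $I\psi=-\psi\circ I$. For a (pseudo-)Riemannian metric $g$ for which $I$ is orthogonal, $\Omega_I(X,Y)=g(IX,Y)$. A quaternionic Kähler manifold of dimension $4n$, $n>1$, is a Riemannian manifold $(M,g)$ with a parallel (for the Levi-Civita connection $\nabla$) rank-$3$ subbundle $S^2H\subset\mathrm{End}(TM)$ locally trivialized by triples $(I,J,K)$ of orthogonal almost complex structures with $I^2=J^2=K^2=-\mathbf 1=IJK$. It is Einstein; its reduced scalar curvature is $\nu=\frac{s}{4n(n+2)}$, where $s$ is the scalar curvature, and $s\neq0$ is always assumed. A hyper-Hermitian quaternionic Kähler (hHqK) manifold is a quaternionic Kähler manifold (with $s\ne0$) together with a global trivialization of $S^2H$ by a hypercomplex structure $(I,J,K)$. "Pseudo-hHqK" is the same notion with $g$ allowed to be a pseudo-Riemannian metric. The Lee form of $(g,I)$ is $\varphi(X)=\frac12\,\mathrm{trace}\{Z\mapsto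 I(\nabla_ZI)X\}$. For a hypercomplex structure orthogonal with respect to $g$ the Lee forms of $I,J,K$ coincide, and this common form is the Lee form of the (pseudo-)hHqK manifold. $\mathbf L=I\otimes I+J\otimes J+K\otimes K$ acts on bilinear forms by $(\mathbf LB)(X,Y)=B(IX,IY)+B(JX,JY)+B(KX,KY)$; $\mathbf 1$ is the identity. For a $1$-form $\psi$, $\mathrm{span}_{\mathbb H}\{\psi\}=\mathrm{span}\{\psi,I\psi,J\psi,K\psi\}$ (identified with the corresponding subspace of tangent vectors via the metric). For a metric $g$ and $1$-forms $\alpha,\beta$, $g(\alpha,\beta)$ is the induced scalar product on $1$-forms. Signature $(4,4(n-1))$ means $4$ positive and $4(n-1)$ negative directions. A pseudo-hyper-Kähler manifold $(M,g_0,I,J,K)$ is a pseudo-Riemannian manifold with an almost hypercomplex structure $(I,J,K)$, orthogonal with respect to $g_0$, such that $I,J,K$ are parallel for the Levi-Civita connection of $g_0$. A function $\mu$ on it is a hyper-Kähler potential if $\frac12\,d(I\,d\mu)=\Omega^0_I$, $\frac12\,d(J\,d\mu)=\Omega^0_J$, $\frac12\,d(K\,d\mu)=\Omega^0_K$, where $\Omega^0_I(X,Y)=g_0(IX,Y)$ and similarly for $J,K$ (equivalently, $\nabla d\mu=g_0$ for the Levi-Civita connection of $g_0$). *)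

theory Defs
  imports "HOL-Analysis.Analysis"
begin

section \<open>Smooth manifolds\<close>

primrec Ck_on :: "nat \<Rightarrow> ('e::euclidean_space \<Rightarrow> 'b::real_normed_vector) \<Rightarrow> 'e set \<Rightarrow> bool" where
  "Ck_on 0 f S \<longleftrightarrow> continuous_on S f"
| "Ck_on (Suc k) f S \<longleftrightarrow>
     (\<forall>x\<in>S. f differentiable (at x)) \<and> (\<forall>v. Ck_on k (\<lambda>x. frechet_derivative f (at x) v) S)"

text \<open>Only used for open \<open>S\<close>.\<close>
definition smooth_on :: "('e::euclidean_space) set \<Rightarrow> ('e \<Rightarrow> 'b::real_normed_vector) \<Rightarrow> bool" where
  "smooth_on S f \<longleftrightarrow> (\<forall>k. Ck_on k f S)"

text \<open>An atlas is a family of charts indexed by a type \<open>'i\<close>, with values in a Euclidean space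
  \<open>'e\<close>, so that the dimension of the manifold is \<open>DIM('e)\<close>. Index families (rather than
  sets) of charts let an open submanifold keep the index type: a field on the manifold is then also
  a field on the submanifold. Manifolds are neither assumed connected nor nonempty.\<close>
record ('a, 'i, 'e) manifold =
  points :: "'a topology"
  chart_dom :: "'i \<Rightarrow> 'a set"
  coord :: "'i \<Rightarrow> 'a \<Rightarrow> 'e"

definition chart_inv :: "('a, 'i, 'e) manifold \<Rightarrow> 'i \<Rightarrow> 'e \<Rightarrow> 'a" where
  "chart_inv M i = inv_into (chart_dom M i) (coord M i)"

definition smooth_manifold :: "('a, 'i, 'e::euclidean_space) manifold \<Rightarrow> bool" where
  "smooth_manifold M \<longleftrightarrow>
     Hausdorff_space (points M) \<and> second_countable (points M) \<and>
     (\<Union>i. chart_dom M i) = topspace (points M) \<and>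
     (\<forall>i. openin (points M) (chart_dom M i) \<and> open (coord M i ` chart_dom M i) \<and>
        homeomorphic_map (subtopology (points M) (chart_dom M i))
          (top_of_set (coord M i ` chart_dom M i)) (coord M i)) \<and>
     (\<forall>i j. smooth_on (coord M i ` (chart_dom M i \<inter> chart_dom M j)) (coord M j \<circ> chart_inv M i))"

definition submanifold :: "('a, 'i, 'e) manifold \<Rightarrow> 'a set \<Rightarrow> ('a, 'i, 'e) manifold" where
  "submanifold M U =
     \<lparr>points = subtopology (points M) U, chart_dom = (\<lambda>i. chart_dom M i \<inter> U), coord = coord M\<rparr>"

text \<open>Derivative of \<open>f\<close> at the point \<open>x\<close> in the direction \<open>v\<close>, both taken in the chart \<open>i\<close>.\<close>
definition pd :: "('a, 'i, 'e::euclidean_space) manifold \<Rightarrow> 'i \<Rightarrow> ('a \<Rightarrow> 'b::real_normed_vector)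
    \<Rightarrow> 'a \<Rightarrow> 'e \<Rightarrow> 'b" where
  "pd M i f x v = frechet_derivative (f \<circ> chart_inv M i) (at (coord M i x)) v"

text \<open>Jacobian of the change from chart \<open>i\<close> to chart \<open>j\<close>.\<close>
definition jac :: "('a, 'i, 'e::euclidean_space) manifold \<Rightarrow> 'i \<Rightarrow> 'i \<Rightarrow> 'a \<Rightarrow> 'e \<Rightarrow> 'e" where
  "jac M i j x v = pd M i (coord M j) x v"

definition smooth_in_chart ::
    "('a, 'i, 'e::euclidean_space) manifold \<Rightarrow> 'i \<Rightarrow> ('a \<Rightarrow> 'b::real_normed_vector) \<Rightarrow> bool" where
  "smooth_in_chart M i f \<longleftrightarrow> smooth_on (coord M i ` chart_dom M i) (f \<circ> chart_inv M i)"

definition smooth_function :: "('a, 'i, 'e::euclidean_space) manifold \<Rightarrow> ('a \<Rightarrow> real) \<Rightarrow> bool" where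
  "smooth_function M f \<longleftrightarrow> (\<forall>i. smooth_in_chart M i f)"

section \<open>Tensor fields\<close>

text \<open>A tensor field is given by its representatives in the charts: \<open>T i x\<close> is the tensor at the
  point \<open>x\<close>, expressed in the chart \<open>i\<close>, and is meaningful only for \<open>x \<in> chart_dom M i\<close>.
  Representatives in different charts are related by the tensor transformation law.\<close>
type_synonym ('a, 'i, 'e) form1 = "'i \<Rightarrow> 'a \<Rightarrow> 'e \<Rightarrow> real"
type_synonym ('a, 'i, 'e) form2 = "'i \<Rightarrow> 'a \<Rightarrow> 'e \<Rightarrow> 'e \<Rightarrow> real"
type_synonym ('a, 'i, 'e) endo = "'i \<Rightarrow> 'a \<Rightarrow> 'e \<Rightarrow> 'e"

definition bilinear_field ::
    "('a, 'i, 'e::euclidean_space) manifold \<Rightarrow> ('a, 'i, 'e) form2 \<Rightarrow> bool" where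
  "bilinear_field M B \<longleftrightarrow>
     (\<forall>i. \<forall>x\<in>chart_dom M i. bilinear (B i x)) \<and>
     (\<forall>i v w. smooth_in_chart M i (\<lambda>x. B i x v w)) \<and>
     (\<forall>i j. \<forall>x\<in>chart_dom M i \<inter> chart_dom M j. \<forall>v w.
        B j x (jac M i j x v) (jac M i j x w) = B i x v w)"

definition endo_field ::
    "('a, 'i, 'e::euclidean_space) manifold \<Rightarrow> ('a, 'i, 'e) endo \<Rightarrow> bool" where
  "endo_field M A \<longleftrightarrow>
     (\<forall>i. \<forall>x\<in>chart_dom M i. linear (A i x)) \<and>
     (\<forall>i v. smooth_in_chart M i (\<lambda>x. A i x v)) \<and>
     (\<forall>i j. \<forall>x\<in>chart_dom M i \<inter> chart_dom M j. \<forall>v.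
        A j x (jac M i j x v) = jac M i j x (A i x v))"

definition diff :: "('a, 'i, 'e::euclidean_space) manifold \<Rightarrow> ('a \<Rightarrow> real) \<Rightarrow> ('a, 'i, 'e) form1" where
  "diff M f i x v = pd M i f x v"

text \<open>Convention: \<open>d\<psi>(X,Y) = X \<psi>(Y) - Y \<psi>(X) - \<psi>([X,Y])\<close>, without a factor one half. Here and below
  the arguments \<open>v\<close>, \<open>w\<close> are extended to constant (commuting) coordinate vector fields.\<close>
definition ext_diff ::
    "('a, 'i, 'e::euclidean_space) manifold \<Rightarrow> ('a, 'i, 'e) form1 \<Rightarrow> ('a, 'i, 'e) form2" where
  "ext_diff M \<psi> i x v w = pd M i (\<lambda>y. \<psi> i y w) x v - pd M i (\<lambda>y. \<psi> i y v) x w"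

definition closed_form :: "('a, 'i, 'e::euclidean_space) manifold \<Rightarrow> ('a, 'i, 'e) form1 \<Rightarrow> bool" where
  "closed_form M \<psi> \<longleftrightarrow> (\<forall>i. \<forall>x\<in>chart_dom M i. \<forall>v w. ext_diff M \<psi> i x v w = 0)"

definition tensor_prod ::
    "('a, 'i, 'e) form1 \<Rightarrow> ('a, 'i, 'e) form1 \<Rightarrow> ('a, 'i, 'e) form2" (infixr "\<otimes>\<^sub>f" 70) where
  "(\<alpha> \<otimes>\<^sub>f \<beta>) i x v w = \<alpha> i x v * \<beta> i x w"

section \<open>Pseudo-Riemannian geometry\<close>

definition pos_def_on :: "'e::euclidean_space set \<Rightarrow> ('e \<Rightarrow> 'e \<Rightarrow> real) \<Rightarrow> bool" where
  "pos_def_on V B \<longleftrightarrow> (\<forall>v\<in>V. v \<noteq> 0 \<longrightarrow> 0 < B v v)"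

abbreviation pos_def :: "('e::euclidean_space \<Rightarrow> 'e \<Rightarrow> real) \<Rightarrow> bool" where
  "pos_def B \<equiv> pos_def_on UNIV B"

definition has_signature :: "('e::euclidean_space \<Rightarrow> 'e \<Rightarrow> real) \<Rightarrow> nat \<Rightarrow> nat \<Rightarrow> bool" where
  "has_signature B r s \<longleftrightarrow>
     (\<exists>P N. subspace P \<and> subspace N \<and> dim P = r \<and> dim N = s \<and> r + s = DIM('e) \<and>
        pos_def_on P B \<and> pos_def_on N (\<lambda>v w. - B v w) \<and> (\<forall>v\<in>P. \<forall>w\<in>N. B v w = 0))"

definition pseudo_riemannian ::
    "('a, 'i, 'e::euclidean_space) manifold \<Rightarrow> ('a, 'i, 'e) form2 \<Rightarrow> bool" where
  "pseudo_riemannian M g \<longleftrightarrow>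
     smooth_manifold M \<and> bilinear_field M g \<and>
     (\<forall>i. \<forall>x\<in>chart_dom M i.
        (\<forall>v w. g i x v w = g i x w v) \<and> (\<forall>v. (\<forall>w. g i x v w = 0) \<longrightarrow> v = 0))"

definition riemannian ::
    "('a, 'i, 'e::euclidean_space) manifold \<Rightarrow> ('a, 'i, 'e) form2 \<Rightarrow> bool" where
  "riemannian M g \<longleftrightarrow> pseudo_riemannian M g \<and> (\<forall>i. \<forall>x\<in>chart_dom M i. pos_def (g i x))"

text \<open>The vector dual to the covector \<open>\<alpha>\<close> with respect to the nondegenerate form \<open>B\<close>.\<close>
definition sharp :: "('e \<Rightarrow> 'e \<Rightarrow> real) \<Rightarrow> ('e \<Rightarrow> real) \<Rightarrow> 'e" where
  "sharp B \<alpha> = (THE v. \<forall>w. B v w = \<alpha> w)"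

definition lin_trace :: "('e::euclidean_space \<Rightarrow> 'e) \<Rightarrow> real" where
  "lin_trace f = (\<Sum>b\<in>Basis. f b \<bullet> b)"

text \<open>The scalar product of two 1-forms, as a function on the manifold. Its value does not depend
  on the chart in which it is computed.\<close>
definition form_prod :: "('a, 'i, 'e) manifold \<Rightarrow> ('a, 'i, 'e) form2 \<Rightarrow>
    ('a, 'i, 'e) form1 \<Rightarrow> ('a, 'i, 'e) form1 \<Rightarrow> 'a \<Rightarrow> real" where
  "form_prod M g \<alpha> \<beta> x =
     (let i = (SOME i. x \<in> chart_dom M i)
      in g i x (sharp (g i x) (\<alpha> i x)) (sharp (g i x) (\<beta> i x)))"

text \<open>Coefficients of the torsion-free metric connection: \<open>\<nabla>\<^sub>v w = levi_civita M g i x v w\<close> for constant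
  coordinate vector fields \<open>v\<close>, \<open>w\<close>.\<close>
definition levi_civita ::
    "('a, 'i, 'e::euclidean_space) manifold \<Rightarrow> ('a, 'i, 'e) form2 \<Rightarrow> 'i \<Rightarrow> 'a \<Rightarrow> 'e \<Rightarrow> 'e \<Rightarrow> 'e" where
  "levi_civita M g i x = (THE \<Gamma>. bilinear \<Gamma> \<and> (\<forall>v w. \<Gamma> v w = \<Gamma> w v) \<and>
     (\<forall>u v w. pd M i (\<lambda>y. g i y v w) x u = g i x (\<Gamma> u v) w + g i x v (\<Gamma> u w)))"

definition nabla :: "('a, 'i, 'e::euclidean_space) manifold \<Rightarrow> ('a, 'i, 'e) form2 \<Rightarrow> 'i \<Rightarrow>
    'e \<Rightarrow> ('a \<Rightarrow> 'e) \<Rightarrow> 'a \<Rightarrow> 'e" where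
  "nabla M g i v Y x = pd M i Y x v + levi_civita M g i x v (Y x)"

text \<open>\<open>nabla_endo M g A i x v w\<close> is \<open>(\<nabla>\<^sub>v A) w\<close>.\<close>
definition nabla_endo :: "('a, 'i, 'e::euclidean_space) manifold \<Rightarrow> ('a, 'i, 'e) form2 \<Rightarrow>
    ('a, 'i, 'e) endo \<Rightarrow> 'i \<Rightarrow> 'a \<Rightarrow> 'e \<Rightarrow> 'e \<Rightarrow> 'e" where
  "nabla_endo M g A i x v w =
     nabla M g i v (\<lambda>y. A i y w) x - A i x (nabla M g i v (\<lambda>_. w) x)"

definition curvature :: "('a, 'i, 'e::euclidean_space) manifold \<Rightarrow> ('a, 'i, 'e) form2 \<Rightarrow> 'i \<Rightarrow> 'a \<Rightarrow>
    'e \<Rightarrow> 'e \<Rightarrow> 'e \<Rightarrow> 'e" where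
  "curvature M g i x u v w =
     nabla M g i u (nabla M g i v (\<lambda>_. w)) x - nabla M g i v (nabla M g i u (\<lambda>_. w)) x"

definition ricci ::
    "('a, 'i, 'e::euclidean_space) manifold \<Rightarrow> ('a, 'i, 'e) form2 \<Rightarrow> ('a, 'i, 'e) form2" where
  "ricci M g i x v w = lin_trace (\<lambda>u. curvature M g i x u v w)"

definition scalar_curvature ::
    "('a, 'i, 'e::euclidean_space) manifold \<Rightarrow> ('a, 'i, 'e) form2 \<Rightarrow> 'i \<Rightarrow> 'a \<Rightarrow> real" where
  "scalar_curvature M g i x = lin_trace (\<lambda>v. sharp (g i x) (ricci M g i x v))"

section \<open>Almost complex and hypercomplex structures\<close>

definition almost_complex ::
    "('a, 'i, 'e::euclidean_space) manifold \<Rightarrow> ('a, 'i, 'e) endo \<Rightarrow> bool" where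
  "almost_complex M A \<longleftrightarrow>
     endo_field M A \<and> (\<forall>i. \<forall>x\<in>chart_dom M i. \<forall>v. A i x (A i x v) = - v)"

definition orthogonal_endo ::
    "('a, 'i, 'e) manifold \<Rightarrow> ('a, 'i, 'e) form2 \<Rightarrow> ('a, 'i, 'e) endo \<Rightarrow> bool" where
  "orthogonal_endo M g A \<longleftrightarrow>
     (\<forall>i. \<forall>x\<in>chart_dom M i. \<forall>v w. g i x (A i x v) (A i x w) = g i x v w)"

definition lie_bracket :: "('a, 'i, 'e::euclidean_space) manifold \<Rightarrow> 'i \<Rightarrow>
    ('a \<Rightarrow> 'e) \<Rightarrow> ('a \<Rightarrow> 'e) \<Rightarrow> 'a \<Rightarrow> 'e" where
  "lie_bracket M i X Y x = pd M i Y x (X x) - pd M i X x (Y x)"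

text \<open>\<open>[AX,AY] - A[AX,Y] - A[X,AY] - [X,Y]\<close> for the constant coordinate fields \<open>X = v\<close>, \<open>Y = w\<close>.\<close>
definition nijenhuis :: "('a, 'i, 'e::euclidean_space) manifold \<Rightarrow> ('a, 'i, 'e) endo \<Rightarrow>
    'i \<Rightarrow> 'a \<Rightarrow> 'e \<Rightarrow> 'e \<Rightarrow> 'e" where
  "nijenhuis M A i x v w =
     lie_bracket M i (\<lambda>y. A i y v) (\<lambda>y. A i y w) x
     - A i x (lie_bracket M i (\<lambda>y. A i y v) (\<lambda>_. w) x)
     - A i x (lie_bracket M i (\<lambda>_. v) (\<lambda>y. A i y w) x)
     - lie_bracket M i (\<lambda>_. v) (\<lambda>_. w) x"

text \<open>Integrability of an almost complex structure is taken in the sense of vanishing of the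
  Nijenhuis tensor.\<close>
definition integrable_acs ::
    "('a, 'i, 'e::euclidean_space) manifold \<Rightarrow> ('a, 'i, 'e) endo \<Rightarrow> bool" where
  "integrable_acs M A \<longleftrightarrow> (\<forall>i. \<forall>x\<in>chart_dom M i. \<forall>v w. nijenhuis M A i x v w = 0)"

definition almost_hypercomplex :: "('a, 'i, 'e::euclidean_space) manifold \<Rightarrow>
    ('a, 'i, 'e) endo \<Rightarrow> ('a, 'i, 'e) endo \<Rightarrow> ('a, 'i, 'e) endo \<Rightarrow> bool" where
  "almost_hypercomplex M I J K \<longleftrightarrow>
     almost_complex M I \<and> almost_complex M J \<and> almost_complex M K \<and>
     (\<forall>i. \<forall>x\<in>chart_dom M i. \<forall>v. I i x (J i x (K i x v)) = - v)"

definition hypercomplex :: "('a, 'i, 'e::euclidean_space) manifold \<Rightarrow>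
    ('a, 'i, 'e) endo \<Rightarrow> ('a, 'i, 'e) endo \<Rightarrow> ('a, 'i, 'e) endo \<Rightarrow> bool" where
  "hypercomplex M I J K \<longleftrightarrow> almost_hypercomplex M I J K \<and>
     integrable_acs M I \<and> integrable_acs M J \<and> integrable_acs M K"

definition act_form :: "('a, 'i, 'e) endo \<Rightarrow> ('a, 'i, 'e) form1 \<Rightarrow> ('a, 'i, 'e) form1" where
  "act_form A \<psi> i x v = - \<psi> i x (A i x v)"

definition fund_form :: "('a, 'i, 'e) form2 \<Rightarrow> ('a, 'i, 'e) endo \<Rightarrow> ('a, 'i, 'e) form2" where
  "fund_form g A i x v w = g i x (A i x v) w"

definition L_op :: "('a, 'i, 'e) endo \<Rightarrow> ('a, 'i, 'e) endo \<Rightarrow> ('a, 'i, 'e) endo \<Rightarrow>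
    ('a, 'i, 'e) form2 \<Rightarrow> ('a, 'i, 'e) form2" where
  "L_op I J K B i x v w =
     B i x (I i x v) (I i x w) + B i x (J i x v) (J i x w) + B i x (K i x v) (K i x w)"

definition one_plus_L :: "('a, 'i, 'e) endo \<Rightarrow> ('a, 'i, 'e) endo \<Rightarrow> ('a, 'i, 'e) endo \<Rightarrow>
    ('a, 'i, 'e) form2 \<Rightarrow> ('a, 'i, 'e) form2" where
  "one_plus_L I J K B i x v w = B i x v w + L_op I J K B i x v w"

text \<open>The span of \<open>\<psi>, I\<psi>, J\<psi>, K\<psi>\<close>, as a space of tangent vectors via the metric \<open>g\<close>.\<close>
definition span_H :: "('a, 'i, 'e::euclidean_space) form2 \<Rightarrow>
    ('a, 'i, 'e) endo \<Rightarrow> ('a, 'i, 'e) endo \<Rightarrow> ('a, 'i, 'e) endo \<Rightarrow>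
    ('a, 'i, 'e) form1 \<Rightarrow> 'i \<Rightarrow> 'a \<Rightarrow> 'e set" where
  "span_H g I J K \<psi> i x =
     span ((\<lambda>\<theta>. sharp (g i x) (\<theta> i x)) ` {\<psi>, act_form I \<psi>, act_form J \<psi>, act_form K \<psi>})"

section \<open>Quaternionic Kaehler and hyper-Kaehler manifolds\<close>

definition endo_span :: "('a, 'i, 'e::real_vector) endo \<Rightarrow> ('a, 'i, 'e) endo \<Rightarrow> ('a, 'i, 'e) endo \<Rightarrow>
    'i \<Rightarrow> 'a \<Rightarrow> ('e \<Rightarrow> 'e) set" where
  "endo_span I J K i x =
     {(\<lambda>v. a *\<^sub>R I i x v + b *\<^sub>R J i x v + c *\<^sub>R K i x v) | a b c. True}"

text \<open>The covariant derivatives of all local sections of \<open>Q\<close> take values in \<open>Q\<close>.\<close>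
definition parallel_subbundle :: "('a, 'i, 'e::euclidean_space) manifold \<Rightarrow> ('a, 'i, 'e) form2 \<Rightarrow>
    ('i \<Rightarrow> 'a \<Rightarrow> ('e \<Rightarrow> 'e) set) \<Rightarrow> bool" where
  "parallel_subbundle M g Q \<longleftrightarrow>
     (\<forall>U A. openin (points M) U \<longrightarrow> endo_field (submanifold M U) A \<longrightarrow>
        (\<forall>i. \<forall>x\<in>chart_dom M i \<inter> U. A i x \<in> Q i x) \<longrightarrow>
        (\<forall>i. \<forall>x\<in>chart_dom M i \<inter> U. \<forall>v. nabla_endo (submanifold M U) g A i x v \<in> Q i x))"

text \<open>\<open>Q\<close> plays the role of the bundle \<open>S\<^sup>2H\<close>.\<close>
definition pseudo_quaternionic_kaehler :: "('a, 'i, 'e::euclidean_space) manifold \<Rightarrow>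
    ('a, 'i, 'e) form2 \<Rightarrow> ('i \<Rightarrow> 'a \<Rightarrow> ('e \<Rightarrow> 'e) set) \<Rightarrow> bool" where
  "pseudo_quaternionic_kaehler M g Q \<longleftrightarrow>
     (\<exists>n>1. DIM('e) = 4 * n) \<and> pseudo_riemannian M g \<and>
     (\<forall>x\<in>topspace (points M). \<exists>U I J K. openin (points M) U \<and> x \<in> U \<and>
        almost_hypercomplex (submanifold M U) I J K \<and>
        orthogonal_endo (submanifold M U) g I \<and> orthogonal_endo (submanifold M U) g J \<and>
        orthogonal_endo (submanifold M U) g K \<and>
        (\<forall>i. \<forall>y\<in>chart_dom M i \<inter> U. Q i y = endo_span I J K i y)) \<and>
     parallel_subbundle M g Q \<and>
     (\<forall>i. \<forall>x\<in>chart_dom M i. scalar_curvature M g i x \<noteq> 0)"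

definition pseudo_hHqK :: "('a, 'i, 'e::euclidean_space) manifold \<Rightarrow> ('a, 'i, 'e) form2 \<Rightarrow>
    ('a, 'i, 'e) endo \<Rightarrow> ('a, 'i, 'e) endo \<Rightarrow> ('a, 'i, 'e) endo \<Rightarrow> bool" where
  "pseudo_hHqK M g I J K \<longleftrightarrow>
     pseudo_quaternionic_kaehler M g (endo_span I J K) \<and> hypercomplex M I J K"

definition hHqK :: "('a, 'i, 'e::euclidean_space) manifold \<Rightarrow> ('a, 'i, 'e) form2 \<Rightarrow>
    ('a, 'i, 'e) endo \<Rightarrow> ('a, 'i, 'e) endo \<Rightarrow> ('a, 'i, 'e) endo \<Rightarrow> bool" where
  "hHqK M g I J K \<longleftrightarrow> riemannian M g \<and> pseudo_hHqK M g I J K"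

definition reduced_scalar_curvature ::
    "('a, 'i, 'e::euclidean_space) manifold \<Rightarrow> ('a, 'i, 'e) form2 \<Rightarrow> 'i \<Rightarrow> 'a \<Rightarrow> real" where
  "reduced_scalar_curvature M g i x =
     (let n = real DIM('e) / 4 in scalar_curvature M g i x / (4 * n * (n + 2)))"

definition has_reduced_scalar_curvature ::
    "('a, 'i, 'e::euclidean_space) manifold \<Rightarrow> ('a, 'i, 'e) form2 \<Rightarrow> real \<Rightarrow> bool" where
  "has_reduced_scalar_curvature M g \<nu> \<longleftrightarrow>
     (\<forall>i. \<forall>x\<in>chart_dom M i. reduced_scalar_curvature M g i x = \<nu>)"

definition lee_form :: "('a, 'i, 'e::euclidean_space) manifold \<Rightarrow> ('a, 'i, 'e) form2 \<Rightarrow>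
    ('a, 'i, 'e) endo \<Rightarrow> ('a, 'i, 'e) form1" where
  "lee_form M g A i x v = 1/2 * lin_trace (\<lambda>z. A i x (nabla_endo M g A i x z v))"

definition pseudo_hyperkaehler :: "('a, 'i, 'e::euclidean_space) manifold \<Rightarrow> ('a, 'i, 'e) form2 \<Rightarrow>
    ('a, 'i, 'e) endo \<Rightarrow> ('a, 'i, 'e) endo \<Rightarrow> ('a, 'i, 'e) endo \<Rightarrow> bool" where
  "pseudo_hyperkaehler M g I J K \<longleftrightarrow>
     pseudo_riemannian M g \<and> almost_hypercomplex M I J K \<and>
     (\<forall>A\<in>{I, J, K}. orthogonal_endo M g A \<and>
        (\<forall>i. \<forall>x\<in>chart_dom M i. \<forall>v w. nabla_endo M g A i x v w = 0))"

definition hyperkaehler_potential :: "('a, 'i, 'e::euclidean_space) manifold \<Rightarrow>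
    ('a, 'i, 'e) form2 \<Rightarrow> ('a, 'i, 'e) endo \<Rightarrow> ('a, 'i, 'e) endo \<Rightarrow> ('a, 'i, 'e) endo \<Rightarrow>
    ('a \<Rightarrow> real) \<Rightarrow> bool" where
  "hyperkaehler_potential M g I J K \<mu> \<longleftrightarrow>
     smooth_function M \<mu> \<and>
     (\<forall>A\<in>{I, J, K}. \<forall>i. \<forall>x\<in>chart_dom M i. \<forall>v w.
        1/2 * ext_diff M (act_form A (diff M \<mu>)) i x v w = fund_form g A i x v w)"

section \<open>The correspondence\<close>

text \<open>The Lee forms of \<open>I\<close>, \<open>J\<close>, \<open>K\<close> coincide for a hypercomplex structure orthogonal for the metric; \<open>I\<close> is used as
  representative.\<close>
definition hk_metric :: "('a, 'i, 'e::euclidean_space) manifold \<Rightarrow> ('a, 'i, 'e) form2 \<Rightarrow>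
    ('a, 'i, 'e) endo \<Rightarrow> ('a, 'i, 'e) endo \<Rightarrow> ('a, 'i, 'e) endo \<Rightarrow> real \<Rightarrow> ('a, 'i, 'e) form2" where
  "hk_metric M g I J K \<nu> i x v w =
     (let \<phi> = lee_form M g I in
      1 / \<nu>\<^sup>2 * (form_prod M g \<phi> \<phi> x + \<nu>) *
        (one_plus_L I J K (\<phi> \<otimes>\<^sub>f \<phi>) i x v w + \<nu> * g i x v w))"

definition hk_potential :: "('a, 'i, 'e::euclidean_space) manifold \<Rightarrow> ('a, 'i, 'e) form2 \<Rightarrow>
    ('a, 'i, 'e) endo \<Rightarrow> real \<Rightarrow> 'a \<Rightarrow> real" where
  "hk_potential M g I \<nu> x =
     (let \<phi> = lee_form M g I in 2 / \<nu>\<^sup>2 * (form_prod M g \<phi> \<phi> x + \<nu>))"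

definition conf_factor :: "('a, 'i, 'e::euclidean_space) manifold \<Rightarrow> ('a, 'i, 'e) form2 \<Rightarrow>
    ('a \<Rightarrow> real) \<Rightarrow> real \<Rightarrow> 'a \<Rightarrow> real" where
  "conf_factor M g0 \<mu> p x = p * form_prod M g0 (diff M \<mu>) (diff M \<mu>) x + 1"

definition qk_metric :: "('a, 'i, 'e::euclidean_space) manifold \<Rightarrow> ('a, 'i, 'e) form2 \<Rightarrow>
    ('a, 'i, 'e) endo \<Rightarrow> ('a, 'i, 'e) endo \<Rightarrow> ('a, 'i, 'e) endo \<Rightarrow> ('a \<Rightarrow> real) \<Rightarrow> real \<Rightarrow>
    ('a, 'i, 'e) form2" where
  "qk_metric M g0 I J K \<mu> p i x v w =
     - (p / (conf_factor M g0 \<mu> p x)\<^sup>2) * one_plus_L I J K (diff M \<mu> \<otimes>\<^sub>f diff M \<mu>) i x v w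
     + 1 / conf_factor M g0 \<mu> p x * g0 i x v w"

definition qk_domain :: "('a, 'i, 'e::euclidean_space) manifold \<Rightarrow> ('a, 'i, 'e) form2 \<Rightarrow>
    ('a \<Rightarrow> real) \<Rightarrow> real \<Rightarrow> ('a, 'i, 'e) manifold" where
  "qk_domain M g0 \<mu> p =
     submanifold M {x \<in> topspace (points M). conf_factor M g0 \<mu> p x \<noteq> 0}"

end

theory Submission
  imports Defs
begin

text \<open>
  The correspondence rests on one connection. A hypercomplex structure \<open>(I, J, K)\<close> has a torsion-free connection for
  which \<open>I, J, K\<close> are parallel, the Obata connection. If \<open>(I, J, K)\<close> trivializes the parallel bundle of a quaternionic
  Kaehler metric \<open>g\<close> with Lee form \<open>\<phi>\<close>, integrability forces \<open>\<nabla>I = \<gamma> \<otimes> J - \<beta> \<otimes> K\<close> and its cyclic variants with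
  \<open>\<alpha> = I\<phi>\<close>, \<open>\<beta> = J\<phi>\<close>, \<open>\<gamma> = K\<phi>\<close> (\<open>lee_form_determines\<close>), and the Obata connection is \<open>\<nabla> + S\<close> for a tensor \<open>S\<close> that depends
  linearly on \<open>\<phi>\<close> alone. The theorem compares the two metrics by means of this tensor.

  The link to the scalar curvature is the curvature of the bundle spanned by \<open>I, J, K\<close>: in dimension greater than four
  it satisfies \<open>d\<alpha> + \<beta> \<and> \<gamma> = - \<nu> \<Omega>\<^sub>I\<close>, where \<open>\<nu>\<close> is the reduced scalar curvature. This is an algebraic fact
  about curvature tensors (\<open>A_scalar_curvature\<close>): the first Bianchi identity expresses the Ricci tensor by the three curvature
  forms, which for \<open>n > 1\<close> makes them correspond to each other, and pair symmetry makes them multiples of the fundamental forms.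

  Let \<open>\<phi>\<close> be closed. Then the equation above determines the symmetric form \<open>\<nabla>\<phi>\<close> (\<open>hess_eq\<close>):
  \<open>2 \<nabla>\<phi> = \<alpha> \<otimes> \<alpha> + \<beta> \<otimes> \<beta> + \<gamma> \<otimes> \<gamma> - \<phi> \<otimes> \<phi> - \<nu> g\<close>. Consequently \<open>f = g(\<phi>, \<phi>) + \<nu>\<close> satisfies \<open>df = - f \<phi>\<close>, and with these two
  formulas one checks that \<open>\<nabla> + S\<close> preserves \<open>f ((1 + L) (\<phi> \<otimes> \<phi>) + \<nu> g)\<close>. So it is the Levi-Civita connection of \<open>g0\<close>
  (\<open>levi_civita0\<close>), for which \<open>I, J, K\<close> are parallel; the equation for the potential \<open>2 f / \<nu>\<^sup>2\<close> is the curvature equation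
  multiplied by \<open>f\<close>.

  Conversely, for a hyper-Kaehler potential \<open>\<mu>\<close> the three potential equations give \<open>\<nabla>d\<mu> = g0\<close>, hence \<open>d(g0(d\<mu>, d\<mu>)) = 2 d\<mu>\<close>. With
  \<open>f = p g0(d\<mu>, d\<mu>) + 1\<close> and \<open>\<phi> = - d ln \<bar>f\<bar>\<close>, subtracting \<open>S\<close> from the Levi-Civita connection of \<open>g0\<close> yields that of the
  metric with parameter \<open>p\<close> (\<open>levi_civita_p\<close>). The derivatives of \<open>I, J, K\<close> then have the form above, so that their span is
  parallel and \<open>\<phi>\<close> is the Lee form, and \<open>d\<alpha> + \<beta> \<and> \<gamma> = - 4 p \<Omega>\<^sub>I\<close> identifies the reduced scalar curvature
  (\<open>reduced_scalar_curvature_p\<close>).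

  The signatures and the inversion formulas are pointwise: \<open>(1 + L) (\<phi> \<otimes> \<phi>)\<close> equals \<open>g(\<phi>, \<phi>) g\<close> on the quaternionic line of \<open>\<phi>\<close>
  and vanishes on its orthogonal complement.

  All computations take place in one chart. Two analytic points have to be supplied: Christoffel symbols and dual vectors are smooth, as
  solutions of linear systems with smooth coefficients (\<open>Ck_on_solution\<close>), and the Lee form transforms as a one-form under
  changes of charts (\<open>lee_form_change\<close>), which makes \<open>g0\<close> a tensor field.
\<close>

section \<open>Calculus of smooth functions on open sets\<close>

lemma frechet_derivative_eqI: "(f has_derivative D) (at x) \<Longrightarrow> frechet_derivative f (at x) v = D v"
  using frechet_derivative_at by metis

lemma Ck_on_cong:
  assumes "open S" "\<And>x. x \<in> S \<Longrightarrow> f x = g x" "Ck_on k f S"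
  shows "Ck_on k g S"
  using assms(2,3)
proof (induction k arbitrary: f g)
  case 0
  then show ?case
    by (simp add: continuous_on_eq)
next
  case (Suc k)
  have D: "(g has_derivative frechet_derivative f (at x)) (at x)" if "x \<in> S" for x
    using Suc.prems that assms(1)
    by (auto simp: frechet_derivative_works intro: has_derivative_transform_within_open)
  have "frechet_derivative f (at x) v = frechet_derivative g (at x) v" if "x \<in> S" for x v
    using frechet_derivative_eqI[OF D[OF that]] by simp
  then have "Ck_on k (\<lambda>x. frechet_derivative g (at x) v) S" for v
    using Suc.IH[of "\<lambda>x. frechet_derivative f (at x) v" "\<lambda>x. frechet_derivative g (at x) v"] Suc.prems
    by simp
  with D show ?case
    by (auto simp: differentiable_def)
qed

lemma Ck_on_SucI:
  assumes "open S" "\<And>x. x \<in> S \<Longrightarrow> (f has_derivative D x) (at x)" "\<And>v. Ck_on k (\<lambda>x. D x v) S"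
  shows "Ck_on (Suc k) f S"
proof -
  have "Ck_on k (\<lambda>x. frechet_derivative f (at x) v) S" for v
    by (rule Ck_on_cong[OF assms(1) _ assms(3)[of v]]) (simp add: frechet_derivative_eqI[OF assms(2)])
  then show ?thesis
    using assms(2) by (auto simp: differentiable_def)
qed

lemma Ck_on_SucD:
  assumes "Ck_on (Suc k) f S"
  shows "Ck_on k f S"
  using assms
proof (induction k arbitrary: f)
  case 0
  then show ?case
    by (auto intro!: continuous_at_imp_continuous_on differentiable_imp_continuous_within)
next
  case (Suc k)
  then show ?case by simp
qed

lemma Ck_on_has_derivative:
  "Ck_on (Suc k) f S \<Longrightarrow> x \<in> S \<Longrightarrow> (f has_derivative frechet_derivative f (at x)) (at x)"
  by (simp flip: frechet_derivative_works)

lemma Ck_on_subset: "Ck_on k f S \<Longrightarrow> T \<subseteq> S \<Longrightarrow> Ck_on k f T"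
  by (induction k arbitrary: f) (auto intro: continuous_on_subset)

lemma Ck_on_const: "open S \<Longrightarrow> Ck_on k (\<lambda>_. c) S"
  by (induction k arbitrary: c) auto

lemma Ck_on_bounded_linear:
  assumes "open S" "bounded_linear L" "Ck_on k f S"
  shows "Ck_on k (\<lambda>x. L (f x)) S"
  using assms(3)
proof (induction k arbitrary: f)
  case 0
  then show ?case using assms(2) by (simp add: bounded_linear.continuous_on)
next
  case (Suc k)
  show ?case
  proof (rule Ck_on_SucI[OF assms(1)])
    show "((\<lambda>x. L (f x)) has_derivative (\<lambda>v. L (frechet_derivative f (at x) v))) (at x)" if "x \<in> S" for x
      using Ck_on_has_derivative[OF Suc.prems that] bounded_linear.has_derivative[OF assms(2)] by blast
  qed (use Suc in auto)
qed

lemma Ck_on_add: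
  assumes "open S" "Ck_on k f S" "Ck_on k g S"
  shows "Ck_on k (\<lambda>x. f x + g x) S"
  using assms(2,3)
proof (induction k arbitrary: f g)
  case 0
  then show ?case by (simp add: continuous_on_add)
next
  case (Suc k)
  show ?case
  proof (rule Ck_on_SucI[OF assms(1)])
    show "((\<lambda>x. f x + g x) has_derivative
        (\<lambda>v. frechet_derivative f (at x) v + frechet_derivative g (at x) v)) (at x)" if "x \<in> S" for x
      using Suc.prems that Ck_on_has_derivative by (blast intro: has_derivative_add)
  qed (use Suc in auto)
qed

lemma Ck_on_sum:
  assumes "open S" "\<And>a. a \<in> A \<Longrightarrow> Ck_on k (f a) S"
  shows "Ck_on k (\<lambda>x. \<Sum>a\<in>A. f a x) S"
  using assms(2)
  by (induction A rule: infinite_finite_induct) (auto intro!: Ck_on_add Ck_on_const assms(1))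

lemma Ck_on_bilinear:
  assumes "open S" "bounded_bilinear P" "Ck_on k f S" "Ck_on k g S"
  shows "Ck_on k (\<lambda>x. P (f x) (g x)) S"
  using assms(3,4)
proof (induction k arbitrary: f g)
  case 0
  then show ?case using assms(2) by (simp add: bounded_bilinear.continuous_on)
next
  case (Suc k)
  show ?case
  proof (rule Ck_on_SucI[OF assms(1)])
    show "((\<lambda>x. P (f x) (g x)) has_derivative
       (\<lambda>v. P (f x) (frechet_derivative g (at x) v) + P (frechet_derivative f (at x) v) (g x))) (at x)"
      if "x \<in> S" for x
      using bounded_bilinear.FDERIV[OF assms(2)] Ck_on_has_derivative[OF Suc.prems(1) that]
        Ck_on_has_derivative[OF Suc.prems(2) that] by blast
  qed (use Suc in \<open>auto intro!: Ck_on_add assms(1) Suc.IH dest: Ck_on_SucD simp del: Ck_on.simps\<close>,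
      use Suc.prems in auto)
qed

lemma Ck_on_inverse:
  fixes f :: "'e::euclidean_space \<Rightarrow> real"
  assumes "open S" "Ck_on k f S" "\<And>x. x \<in> S \<Longrightarrow> f x \<noteq> 0"
  shows "Ck_on k (\<lambda>x. inverse (f x)) S"
  using assms(2)
proof (induction k)
  case 0
  then show ?case using assms(3) by (simp add: continuous_on_inverse)
next
  case (Suc k)
  show ?case
  proof (rule Ck_on_SucI[OF assms(1)])
    show "((\<lambda>x. inverse (f x)) has_derivative
       (\<lambda>v. - (inverse (f x) * frechet_derivative f (at x) v * inverse (f x)))) (at x)" if "x \<in> S" for x
      using Deriv.has_derivative_inverse[OF assms(3)[OF that] Ck_on_has_derivative[OF Suc.prems that]] .
    have "Ck_on k (\<lambda>x. inverse (f x)) S"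
      using Suc Ck_on_SucD by blast
    moreover have "Ck_on k (\<lambda>x. frechet_derivative f (at x) v) S" for v
      using Suc.prems by simp
    ultimately show "Ck_on k (\<lambda>x. - (inverse (f x) * frechet_derivative f (at x) v * inverse (f x))) S" for v
      by (intro Ck_on_bounded_linear[OF assms(1), of uminus]
          Ck_on_bilinear[OF assms(1) bounded_bilinear_mult] bounded_linear_minus bounded_linear_ident)
  qed
qed

text \<open>The mean value theorem, applied first along \<open>u\<close> and then along \<open>v\<close>, turns the second difference over a
  small parallelogram into a mixed derivative at a nearby point. Exchanging \<open>u\<close> and \<open>v\<close> leaves the difference
  unchanged and produces the other mixed derivative.\<close>
lemma mixed_derivative_mean_value:
  fixes f :: "'e::euclidean_space \<Rightarrow> real"
  assumes ball: "\<And>s t. 0 \<le> s \<Longrightarrow> s \<le> h \<Longrightarrow> 0 \<le> t \<Longrightarrow> t \<le> h \<Longrightarrow> x + s *\<^sub>R u + t *\<^sub>R v \<in> S"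
    and h: "h > 0" and f: "Ck_on 2 f S"
  obtains s t where "0 \<le> s" "s \<le> h" "0 \<le> t" "t \<le> h"
    "f (x + h *\<^sub>R u + h *\<^sub>R v) - f (x + h *\<^sub>R u) - f (x + h *\<^sub>R v) + f x =
     h\<^sup>2 * frechet_derivative (\<lambda>y. frechet_derivative f (at y) u) (at (x + s *\<^sub>R u + t *\<^sub>R v)) v"
proof -
  let ?D = "\<lambda>w y. frechet_derivative f (at y) w"
  have df: "(f has_derivative frechet_derivative f (at y)) (at y)" if "y \<in> S" for y
    using f that by (simp add: numeral_2_eq_2 flip: frechet_derivative_works)
  have ddf: "((?D w) has_derivative frechet_derivative (?D w) (at y)) (at y)" if "y \<in> S" for y w
    using f that by (simp add: numeral_2_eq_2 flip: frechet_derivative_works)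
  have lin: "linear (frechet_derivative f (at y))" if "y \<in> S" for y
    using df[OF that] by (rule has_derivative_linear)
  have lin2: "linear (frechet_derivative (?D w) (at y))" if "y \<in> S" for y w
    using ddf[OF that] by (rule has_derivative_linear)
  let ?G = "\<lambda>s. f (x + s *\<^sub>R u + h *\<^sub>R v) - f (x + s *\<^sub>R u)"
  have G: "(?G has_derivative (\<lambda>r. r * (?D u (x + s *\<^sub>R u + h *\<^sub>R v) - ?D u (x + s *\<^sub>R u)))) (at s)"
    if "0 \<le> s" "s \<le> h" for s
  proof -
    have p: "x + s *\<^sub>R u + h *\<^sub>R v \<in> S" "x + s *\<^sub>R u \<in> S"
      using ball[of s h] ball[of s 0] that h by auto
    have 1: "((\<lambda>s. f (x + s *\<^sub>R u + h *\<^sub>R v)) has_derivative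
        (\<lambda>r. frechet_derivative f (at (x + s *\<^sub>R u + h *\<^sub>R v)) (r *\<^sub>R u))) (at s)"
      by (rule has_derivative_compose[of "\<lambda>s. x + s *\<^sub>R u + h *\<^sub>R v", OF _ df[OF p(1)]])
        (auto intro!: derivative_eq_intros)
    have 2: "((\<lambda>s. f (x + s *\<^sub>R u)) has_derivative
        (\<lambda>r. frechet_derivative f (at (x + s *\<^sub>R u)) (r *\<^sub>R u))) (at s)"
      by (rule has_derivative_compose[of "\<lambda>s. x + s *\<^sub>R u", OF _ df[OF p(2)]])
        (auto intro!: derivative_eq_intros)
    show ?thesis
      using has_derivative_diff[OF 1 2] lin[OF p(1)] lin[OF p(2)]
      by (simp add: linear_scale right_diff_distrib)
  qed
  have "\<exists>s\<in>{0<..<h}. ?G h - ?G 0 =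
      (\<lambda>r. r * (?D u (x + s *\<^sub>R u + h *\<^sub>R v) - ?D u (x + s *\<^sub>R u))) (h - 0)"
    by (rule mvt_simple[OF h, of ?G
          "\<lambda>s r. r * (?D u (x + s *\<^sub>R u + h *\<^sub>R v) - ?D u (x + s *\<^sub>R u))"])
      (rule has_derivative_at_withinI, rule G, simp_all)
  then obtain s where s: "0 < s" "s < h"
    and sG: "?G h - ?G 0 = h * (?D u (x + s *\<^sub>R u + h *\<^sub>R v) - ?D u (x + s *\<^sub>R u))"
    unfolding greaterThanLessThan_iff Bex_def diff_zero by blast
  let ?H = "\<lambda>t. ?D u (x + s *\<^sub>R u + t *\<^sub>R v)"
  have H: "(?H has_derivative (\<lambda>r. r * frechet_derivative (?D u) (at (x + s *\<^sub>R u + t *\<^sub>R v)) v)) (at t)"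
    if "0 \<le> t" "t \<le> h" for t
  proof -
    have p: "x + s *\<^sub>R u + t *\<^sub>R v \<in> S"
      using ball[of s t] that s by auto
    have "(?H has_derivative (\<lambda>r. frechet_derivative (?D u) (at (x + s *\<^sub>R u + t *\<^sub>R v)) (r *\<^sub>R v))) (at t)"
      by (rule has_derivative_compose[of "\<lambda>t. x + s *\<^sub>R u + t *\<^sub>R v", OF _ ddf[OF p]])
        (auto intro!: derivative_eq_intros)
    then show ?thesis
      using lin2[OF p] by (simp add: linear_scale)
  qed
  have "\<exists>t\<in>{0<..<h}. ?H h - ?H 0 =
      (\<lambda>r. r * frechet_derivative (?D u) (at (x + s *\<^sub>R u + t *\<^sub>R v)) v) (h - 0)"
    by (rule mvt_simple[OF h, of ?H
          "\<lambda>t r. r * frechet_derivative (?D u) (at (x + s *\<^sub>R u + t *\<^sub>R v)) v"])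
      (rule has_derivative_at_withinI, rule H, simp_all)
  then obtain t where t: "0 < t" "t < h"
    and tH: "?H h - ?H 0 = h * frechet_derivative (?D u) (at (x + s *\<^sub>R u + t *\<^sub>R v)) v"
    unfolding greaterThanLessThan_iff Bex_def diff_zero by blast
  have "f (x + h *\<^sub>R u + h *\<^sub>R v) - f (x + h *\<^sub>R u) - f (x + h *\<^sub>R v) + f x = ?G h - ?G 0"
    by simp
  also have "\<dots> = h * (?H h - ?H 0)"
    using sG by simp
  also have "\<dots> = h\<^sup>2 * frechet_derivative (?D u) (at (x + s *\<^sub>R u + t *\<^sub>R v)) v"
    unfolding tH by (simp add: power2_eq_square)
  finally show thesis
    using that[of s t] s t by (simp add: less_imp_le)
qed

lemma mixed_derivatives_commute_real:
  fixes f :: "'e::euclidean_space \<Rightarrow> real"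
  assumes S: "open S" "x \<in> S" and f: "Ck_on 2 f S"
  shows "frechet_derivative (\<lambda>y. frechet_derivative f (at y) u) (at x) v =
         frechet_derivative (\<lambda>y. frechet_derivative f (at y) v) (at x) u"
    (is "?A x = ?B x")
proof -
  have cont: "continuous_on S (\<lambda>z. frechet_derivative (\<lambda>y. frechet_derivative f (at y) a) (at z) b)" for a b
    using f by (simp add: numeral_2_eq_2)
  obtain r where r: "r > 0" "ball x r \<subseteq> S"
    using S open_contains_ball by blast
  have "\<exists>y z. dist y x < \<epsilon> \<and> dist z x < \<epsilon> \<and> y \<in> S \<and> z \<in> S \<and> ?A y = ?B z" if "\<epsilon> > 0" for \<epsilon>
  proof -
    define h where "h = min \<epsilon> r / (2 * (1 + norm u + norm v))"
    have h: "h > 0"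
      using that r by (simp add: h_def add_pos_nonneg)
    have near: "dist (x + s *\<^sub>R u + t *\<^sub>R v) x < min \<epsilon> r" if "0 \<le> s" "s \<le> h" "0 \<le> t" "t \<le> h" for s t
    proof -
      have "dist (x + s *\<^sub>R u + t *\<^sub>R v) x \<le> s * norm u + t * norm v"
        using that norm_triangle_ineq[of "s *\<^sub>R u" "t *\<^sub>R v"] by (simp add: dist_norm add.assoc)
      also have "\<dots> \<le> h * (1 + norm u + norm v)"
        using that h mult_right_mono[of s h "norm u"] mult_right_mono[of t h "norm v"]
        by (simp add: algebra_simps)
      also have "\<dots> = min \<epsilon> r / 2"
      proof -
        have "c > 0 \<Longrightarrow> min \<epsilon> r / (2 * c) * c = min \<epsilon> r / 2" for c :: real
          by simp
        moreover have "1 + norm u + norm v > 0"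
          by (simp add: add_pos_nonneg)
        ultimately show ?thesis
          unfolding h_def by blast
      qed
      also have "\<dots> < min \<epsilon> r"
        using \<open>\<epsilon> > 0\<close> r by (simp add: min_def)
      finally show ?thesis .
    qed
    have inS: "x + s *\<^sub>R u + t *\<^sub>R v \<in> S" "x + s *\<^sub>R v + t *\<^sub>R u \<in> S"
      if "0 \<le> s" "s \<le> h" "0 \<le> t" "t \<le> h" for s t
    proof -
      have eq: "x + s *\<^sub>R v + t *\<^sub>R u = x + t *\<^sub>R u + s *\<^sub>R v"
        by simp
      have "x + s *\<^sub>R u + t *\<^sub>R v \<in> ball x r" "x + s *\<^sub>R v + t *\<^sub>R u \<in> ball x r"
        using near[of s t] near[of t s] that unfolding eq by (simp_all add: dist_commute)
      then show "x + s *\<^sub>R u + t *\<^sub>R v \<in> S" "x + s *\<^sub>R v + t *\<^sub>R u \<in> S"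
        using r by blast+
    qed
    obtain s t where st: "0 \<le> s" "s \<le> h" "0 \<le> t" "t \<le> h"
      "f (x + h *\<^sub>R u + h *\<^sub>R v) - f (x + h *\<^sub>R u) - f (x + h *\<^sub>R v) + f x = h\<^sup>2 * ?A (x + s *\<^sub>R u + t *\<^sub>R v)"
      by (rule mixed_derivative_mean_value[of h x u v S f, OF _ h f]) (erule (3) inS(1), rule that)
    obtain s' t' where st': "0 \<le> s'" "s' \<le> h" "0 \<le> t'" "t' \<le> h"
      "f (x + h *\<^sub>R v + h *\<^sub>R u) - f (x + h *\<^sub>R v) - f (x + h *\<^sub>R u) + f x = h\<^sup>2 * ?B (x + s' *\<^sub>R v + t' *\<^sub>R u)"
      by (rule mixed_derivative_mean_value[of h x v u S f, OF _ h f]) (erule (3) inS(2), rule that)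
    have "h\<^sup>2 * ?A (x + s *\<^sub>R u + t *\<^sub>R v) = h\<^sup>2 * ?B (x + s' *\<^sub>R v + t' *\<^sub>R u)"
      unfolding st(5)[symmetric] st'(5)[symmetric] by (simp add: algebra_simps)
    then have "?A (x + s *\<^sub>R u + t *\<^sub>R v) = ?B (x + s' *\<^sub>R v + t' *\<^sub>R u)"
      using h by simp
    moreover have "dist (x + s' *\<^sub>R v + t' *\<^sub>R u) x < \<epsilon>"
    proof -
      have eq: "x + s' *\<^sub>R v + t' *\<^sub>R u = x + t' *\<^sub>R u + s' *\<^sub>R v"
        by simp
      show ?thesis
        using near[of t' s'] st' unfolding eq by simp
    qed
    ultimately show ?thesis
      using near[of s t] st inS(1)[of s t] inS(2)[of s' t'] st' by auto
  qed
  note approx = this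
  have "dist (?A x) (?B x) < e" if "e > 0" for e
  proof -
    obtain d where d: "d > 0" "\<And>y. y \<in> S \<Longrightarrow> dist y x < d \<Longrightarrow> dist (?A y) (?A x) < e/2"
      using cont[of u v, unfolded continuous_on_iff, rule_format, OF S(2) half_gt_zero[OF \<open>e > 0\<close>]] by blast
    obtain d' where d': "d' > 0" "\<And>y. y \<in> S \<Longrightarrow> dist y x < d' \<Longrightarrow> dist (?B y) (?B x) < e/2"
      using cont[of v u, unfolded continuous_on_iff, rule_format, OF S(2) half_gt_zero[OF \<open>e > 0\<close>]] by blast
    obtain y z where yz: "dist y x < min d d'" "dist z x < min d d'" "y \<in> S" "z \<in> S" "?A y = ?B z"
      using approx[of "min d d'"] d(1) d'(1) by auto
    then have "dist (?A y) (?A x) < e/2" "dist (?A y) (?B x) < e/2"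
      using d(2)[of y] d'(2)[of z] yz by simp_all
    then show ?thesis
      by (rule dist_triangle_half_r)
  qed
  from this[of "dist (?A x) (?B x)"] show ?thesis
    by auto
qed

lemma mixed_derivatives_commute:
  fixes f :: "'e::euclidean_space \<Rightarrow> 'b::euclidean_space"
  assumes S: "open S" "x \<in> S" and f: "Ck_on 2 f S"
  shows "frechet_derivative (\<lambda>y. frechet_derivative f (at y) u) (at x) v =
         frechet_derivative (\<lambda>y. frechet_derivative f (at y) v) (at x) u"
proof (rule euclidean_eqI)
  fix b :: 'b
  have df: "(f has_derivative frechet_derivative f (at y)) (at y)" if "y \<in> S" for y
    using f that by (simp add: numeral_2_eq_2 flip: frechet_derivative_works)
  have ddf: "((\<lambda>y. frechet_derivative f (at y) w) has_derivative
      frechet_derivative (\<lambda>y. frechet_derivative f (at y) w) (at x)) (at x)" for w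
    using f S by (simp add: numeral_2_eq_2 flip: frechet_derivative_works)
  have 1: "frechet_derivative (\<lambda>y. f y \<bullet> b) (at y) w = frechet_derivative f (at y) w \<bullet> b" if "y \<in> S" for y w
    by (rule frechet_derivative_eqI) (auto intro!: derivative_eq_intros df that)
  have 2: "frechet_derivative (\<lambda>y. frechet_derivative (\<lambda>y. f y \<bullet> b) (at y) w) (at x) w' =
      frechet_derivative (\<lambda>y. frechet_derivative f (at y) w) (at x) w' \<bullet> b" for w w'
  proof (rule frechet_derivative_eqI)
    have "((\<lambda>y. frechet_derivative f (at y) w \<bullet> b) has_derivative
      (\<lambda>w'. frechet_derivative (\<lambda>y. frechet_derivative f (at y) w) (at x) w' \<bullet> b)) (at x)"
      by (intro has_derivative_inner_left ddf)
    then show "((\<lambda>y. frechet_derivative (\<lambda>y. f y \<bullet> b) (at y) w) has_derivative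
      (\<lambda>w'. frechet_derivative (\<lambda>y. frechet_derivative f (at y) w) (at x) w' \<bullet> b)) (at x)"
      by (rule has_derivative_transform_within_open[OF _ S]) (rule 1[symmetric])
  qed
  have "Ck_on 2 (\<lambda>y. f y \<bullet> b) S"
    by (rule Ck_on_bounded_linear[OF S(1) bounded_linear_inner_left f])
  from mixed_derivatives_commute_real[OF S this, of u v] show
    "frechet_derivative (\<lambda>y. frechet_derivative f (at y) u) (at x) v \<bullet> b =
     frechet_derivative (\<lambda>y. frechet_derivative f (at y) v) (at x) u \<bullet> b"
    unfolding 2 .
qed

section \<open>Traces and nondegenerate symmetric bilinear forms\<close>

lemma lin_trace_add: "lin_trace (\<lambda>z. f z + g z) = lin_trace f + lin_trace g"
  by (simp add: lin_trace_def inner_add_left sum.distrib)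

lemma lin_trace_diff: "lin_trace (\<lambda>z. f z - g z) = lin_trace f - lin_trace g"
  by (simp add: lin_trace_def inner_diff_left sum_subtractf)

lemma lin_trace_minus: "lin_trace (\<lambda>z. - f z) = - lin_trace f"
  by (simp add: lin_trace_def sum_negf)

lemma lin_trace_scaleR: "lin_trace (\<lambda>z. c *\<^sub>R f z) = c * lin_trace f"
  by (simp add: lin_trace_def sum_distrib_left)

lemma lin_trace_id: "lin_trace (\<lambda>z::'e::euclidean_space. z) = DIM('e)"
  by (simp add: lin_trace_def)

lemma linear_eq_sum_Basis:
  fixes f :: "'e::euclidean_space \<Rightarrow> 'b::real_vector"
  assumes "linear f"
  shows "f v = (\<Sum>b\<in>Basis. (v \<bullet> b) *\<^sub>R f b)"
proof -
  have "f v = f (\<Sum>b\<in>Basis. (v \<bullet> b) *\<^sub>R b)"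
    by (simp only: euclidean_representation)
  then show ?thesis
    unfolding linear_sum[OF assms] linear_scale[OF assms] .
qed

text \<open>This is how all contractions of curvature identities are evaluated: each correction term is of rank one.\<close>
lemma lin_trace_rank_one:
  assumes "linear \<theta>"
  shows "lin_trace (\<lambda>z. \<theta> z *\<^sub>R v) = \<theta> v"
  using linear_eq_sum_Basis[OF assms, of v] by (simp add: lin_trace_def mult.commute)

lemma lin_trace_commute:
  assumes "linear f" "linear g"
  shows "lin_trace (\<lambda>z. f (g z)) = lin_trace (\<lambda>z. g (f z))"
proof -
  have "lin_trace (\<lambda>z. f (g z)) = (\<Sum>b\<in>Basis. \<Sum>c\<in>Basis. (g b \<bullet> c) * (f c \<bullet> b))"
    unfolding lin_trace_def
    by (intro sum.cong refl, subst linear_eq_sum_Basis[OF assms(1)]) (simp add: inner_sum_left)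
  also have "\<dots> = (\<Sum>c\<in>Basis. \<Sum>b\<in>Basis. (g b \<bullet> c) * (f c \<bullet> b))"
    by (rule sum.swap)
  also have "\<dots> = lin_trace (\<lambda>z. g (f z))"
    unfolding lin_trace_def
    by (intro sum.cong refl, subst (2) linear_eq_sum_Basis[OF assms(2)])
      (simp add: inner_sum_left mult.commute)
  finally show ?thesis .
qed

lemma lin_trace_conjugate:
  assumes "linear f" "linear g" "linear h" "\<And>z. g (f z) = z"
  shows "lin_trace (\<lambda>z. f (h (g z))) = lin_trace h"
  using lin_trace_commute[of f "\<lambda>z. h (g z)"] linear_compose[OF assms(2,3)] assms
  by (simp add: o_def)

lemma lin_trace_adjoint:
  assumes "\<And>v w. f v \<bullet> w = v \<bullet> f' w"
  shows "lin_trace f = lin_trace f'"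
  unfolding lin_trace_def assms by (simp add: inner_commute)

lemma inj_linear_inverse:
  fixes f :: "'e::euclidean_space \<Rightarrow> 'e"
  assumes "linear f" "inj f"
  obtains g where "linear g" "\<And>v. g (f v) = v" "\<And>v. f (g v) = v"
  using that[of "inv f"] inj_linear_imp_inv_linear[OF assms] assms(2)
    surj_f_inv_f[OF linear_injective_imp_surjective[OF assms]]
  by simp

lemma linear_compose': "linear f \<Longrightarrow> linear g \<Longrightarrow> linear (\<lambda>z. f (g z))"
  using linear_compose[of g f] by (simp add: o_def)

lemma bilinearI:
  assumes "\<And>x. linear (B x)" "\<And>y. linear (\<lambda>x. B x y)"
  shows "bilinear B"
  using assms by (simp add: bilinear_def)

lemma bilinear_simps:
  assumes "bilinear B"
  shows "B (x + y) z = B x z + B y z" "B x (y + z) = B x y + B x z"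
    "B (c *\<^sub>R x) y = c *\<^sub>R B x y" "B x (c *\<^sub>R y) = c *\<^sub>R B x y"
    "B (- x) y = - B x y" "B x (- y) = - B x y"
    "B (x - y) z = B x z - B y z" "B x (y - z) = B x y - B x z"
    "B 0 y = 0" "B x 0 = 0"
  using assms by (simp_all add: bilinear_ladd bilinear_radd bilinear_lmul bilinear_rmul bilinear_lneg
      bilinear_rneg bilinear_lsub bilinear_rsub bilinear_lzero bilinear_rzero)

definition gram :: "('e::euclidean_space \<Rightarrow> 'e \<Rightarrow> real) \<Rightarrow> 'e \<Rightarrow> 'e" where
  "gram B v = (\<Sum>b\<in>Basis. B v b *\<^sub>R b)"

locale scalar_product =
  fixes B :: "'e::euclidean_space \<Rightarrow> 'e \<Rightarrow> real"
  assumes bilinear: "bilinear B"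
    and sym: "B v w = B w v"
    and nondegenerate: "(\<And>w. B v w = 0) \<Longrightarrow> v = 0"
begin

lemmas simps = bilinear_simps[OF bilinear]

lemma eqI: "(\<And>w. B v w = B v' w) \<Longrightarrow> v = v'"
  using nondegenerate[of "v - v'"] by (simp add: simps)

lemma linear_right: "linear (B v)"
  using bilinear by (simp add: bilinear_def)

lemma gram_inner: "gram B v \<bullet> w = B v w"
  using linear_eq_sum_Basis[OF linear_right, of v w]
  by (simp add: gram_def inner_sum_left inner_commute[of w] mult.commute)

lemma linear_gram: "linear (gram B)"
  unfolding gram_def[abs_def]
  by (intro linear_compose_sum ballI linearI) (simp_all add: simps algebra_simps)

lemma inj_gram: "inj (gram B)"
  by (rule injI, rule eqI) (simp flip: gram_inner)

text \<open>Nondegeneracy makes the Gram operator injective, hence surjective.\<close>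
lemma represented:
  assumes "linear \<alpha>"
  shows "\<exists>v. \<forall>w. B v w = \<alpha> w"
proof -
  obtain v where v: "gram B v = (\<Sum>b\<in>Basis. \<alpha> b *\<^sub>R b)"
    using linear_injective_imp_surjective[OF linear_gram inj_gram] by (metis surj_def)
  have "B v w = \<alpha> w" for w
    using linear_eq_sum_Basis[OF assms, of w]
    by (simp add: v inner_sum_left inner_commute[of w] mult.commute flip: gram_inner)
  then show ?thesis by blast
qed

lemma sharp_eqI: "(\<And>w. B v w = \<alpha> w) \<Longrightarrow> sharp B \<alpha> = v"
  unfolding sharp_def by (rule the_equality) (auto intro: eqI)

lemma sharp: "linear \<alpha> \<Longrightarrow> B (sharp B \<alpha>) w = \<alpha> w"
  using represented sharp_eqI by metis

text \<open>The Gram operator conjugates the transpose with respect to \<open>B\<close> into the Euclidean adjoint, whose trace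
  is read off in the standard basis. Symmetries of the curvature become statements about transposes in this way.\<close>
lemma lin_trace_transpose:
  assumes "linear f'" "\<And>v w. B (f v) w = B v (f' w)"
  shows "lin_trace f = lin_trace f'"
proof -
  have lf: "linear f"
    by (intro linearI; rule eqI) (simp_all add: assms simps)
  obtain T' where T': "linear T'" "\<And>v. T' (gram B v) = v" and TT': "\<And>v. gram B (T' v) = v"
    using inj_linear_inverse[OF linear_gram inj_gram] by blast
  have "gram B (f (T' v)) \<bullet> w = v \<bullet> f' w" for v w
    using gram_inner[of "T' v" "f' w"] by (simp add: gram_inner assms(2) TT')
  then have "lin_trace (\<lambda>v. gram B (f (T' v))) = lin_trace f'"
    by (rule lin_trace_adjoint)
  then show ?thesis
    using lin_trace_conjugate[OF linear_gram T'(1) lf T'(2)] by simp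
qed

end

section \<open>Smooth dependence of the solutions of linear systems\<close>

text \<open>The product is \<open>o(\<bar>x - a\<bar>)\<close>: the factor \<open>g\<close> is \<open>O(\<bar>x - a\<bar>)\<close> and \<open>f\<close> tends to \<open>0\<close>.\<close>
lemma has_derivative_vanishing_factor:
  fixes f :: "'e::real_normed_vector \<Rightarrow> real" and g :: "'e \<Rightarrow> 'b::real_normed_vector"
  assumes f: "isCont f a" "f a = 0" and g: "(g has_derivative g') (at a)" "g a = 0"
  shows "((\<lambda>x. f x *\<^sub>R g x) has_derivative (\<lambda>_. 0)) (at a)"
proof -
  obtain C where C: "C > 0" "\<And>h. norm (g' h) \<le> norm h * C"
    using bounded_linear.pos_bounded[OF has_derivative_bounded_linear[OF g(1)]] by auto
  obtain d where d: "d > 0" "\<And>y. norm (y - a) < d \<Longrightarrow> norm (g y - g a - g' (y - a)) \<le> 1 * norm (y - a)"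
    using g(1) unfolding has_derivative_at_alt by (metis zero_less_one)
  have bound: "norm (g y) \<le> (C + 1) * norm (y - a)" if "norm (y - a) < d" for y
  proof -
    have "norm (g y) \<le> norm (g' (y - a)) + norm (g y - g' (y - a))"
      using norm_triangle_ineq[of "g' (y - a)" "g y - g' (y - a)"] by simp
    then show ?thesis
      using d(2)[OF that] C(2)[of "y - a"] g(2) by (simp add: algebra_simps)
  qed
  show ?thesis
    unfolding has_derivative_at_alt
  proof (intro conjI allI impI bounded_linear_zero)
    fix e :: real assume "e > 0"
    then have "e / (C + 1) > 0" using C by simp
    then obtain r where r: "r > 0" "\<And>y. norm (y - a) < r \<Longrightarrow> \<bar>f y\<bar> < e / (C + 1)"
      using f unfolding continuous_at_eps_delta by (metis dist_norm diff_zero real_norm_def)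
    have "norm (f y *\<^sub>R g y - f a *\<^sub>R g a - 0) \<le> e * norm (y - a)" if "norm (y - a) < min r d" for y
    proof -
      have "\<bar>f y\<bar> * norm (g y) \<le> e / (C + 1) * ((C + 1) * norm (y - a))"
        using r(2)[of y] bound[of y] that C by (intro mult_mono) auto
      then show ?thesis using C f by simp
    qed
    then show "\<exists>d>0. \<forall>y. norm (y - a) < d \<longrightarrow> norm (f y *\<^sub>R g y - f a *\<^sub>R g a - 0) \<le> e * norm (y - a)"
      using r(1) d(1) by (intro exI[of _ "min r d"]) auto
  qed
qed

text \<open>Christoffel symbols and dual vectors are solutions \<open>Z\<close> of linear systems \<open>G\<^sub>x (Z\<^sub>x, w) = c\<^sub>x w\<close> that depend on a point;
  the purpose of the following locale is that \<open>Z\<close> is as smooth as \<open>G\<close> and \<open>c\<close>.\<close>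
locale linear_system =
  fixes S :: "'d::euclidean_space set" and G :: "'d \<Rightarrow> 'e::euclidean_space \<Rightarrow> 'e \<Rightarrow> real"
    and c :: "'d \<Rightarrow> 'e \<Rightarrow> real" and Z :: "'d \<Rightarrow> 'e"
  assumes S: "open S"
    and G: "\<And>x. x \<in> S \<Longrightarrow> scalar_product (G x)"
    and c: "\<And>x. x \<in> S \<Longrightarrow> linear (c x)"
    and solution: "\<And>x w. x \<in> S \<Longrightarrow> G x (Z x) w = c x w"
begin

abbreviation T :: "'d \<Rightarrow> 'e \<Rightarrow> 'e" where "T x \<equiv> gram (G x)"

lemmas T_inner = scalar_product.gram_inner[OF G]
lemmas linear_T = scalar_product.linear_gram[OF G]
lemmas inj_T = scalar_product.inj_gram[OF G]

lemma T_left_inverse: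
  assumes "x \<in> S"
  obtains T' where "linear T'" "\<And>v. T' (T x v) = v" "\<And>v. T x (T' v) = v"
  using inj_linear_inverse[OF linear_T[OF assms] inj_T[OF assms]] that by blast

definition rhs :: "'d \<Rightarrow> 'e" where "rhs x = (\<Sum>b\<in>Basis. c x b *\<^sub>R b)"

lemma T_Z: "x \<in> S \<Longrightarrow> T x (Z x) = rhs x"
  by (simp add: gram_def rhs_def solution)

text \<open>Near a point the matrices stay uniformly invertible, and so
  \<open>\<bar>Z\<^sub>x - Z\<^sub>a\<bar>\<close> is bounded by a multiple of the residual \<open>\<bar>c\<^sub>x - T\<^sub>x Z\<^sub>a\<bar>\<close>, which tends to \<open>0\<close>.\<close>
lemma isCont_Z:
  assumes a: "a \<in> S"
    and cG: "\<And>v w. isCont (\<lambda>x. G x v w) a" and cc: "\<And>w. isCont (\<lambda>x. c x w) a"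
  shows "isCont Z a"
proof -
  obtain \<beta> where \<beta>: "\<beta> > 0" "\<And>v. \<beta> * norm v \<le> norm (T a v)"
    using linear_inj_bounded_below_pos[OF linear_T inj_T, OF a a] by metis
  have cT: "isCont (\<lambda>x. T x v) a" for v
    unfolding gram_def by (intro continuous_intros cG)
  have crhs: "isCont rhs a"
    unfolding rhs_def by (intro continuous_intros cc)
  have "((\<lambda>x. \<Sum>b\<in>Basis. norm (T x b - T a b)) \<longlongrightarrow> (\<Sum>b\<in>Basis. norm (T a b - T a b))) (at a)"
    by (intro tendsto_sum tendsto_norm tendsto_diff tendsto_const cT[unfolded isCont_def])
  then have "\<forall>\<^sub>F x in at a. (\<Sum>b\<in>Basis. norm (T x b - T a b)) < \<beta> / 2"
    by (rule order_tendstoD(2)) (use \<beta> in simp)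
  moreover have "\<forall>\<^sub>F x in at a. x \<in> S"
    using S a by (rule eventually_at_in_open')
  ultimately have "\<forall>\<^sub>F x in at a. norm (Z x - Z a) \<le> 2 / \<beta> * norm (rhs x - T x (Z a))"
  proof eventually_elim
    case (elim x)
    have "norm (T x v - T a v) \<le> \<beta> / 2 * norm v" for v
    proof -
      have "T x v - T a v = (\<Sum>b\<in>Basis. (v \<bullet> b) *\<^sub>R (T x b - T a b))"
        by (subst linear_eq_sum_Basis[OF linear_T[OF elim(2)]],
            subst linear_eq_sum_Basis[OF linear_T[OF a]])
          (simp add: sum_subtractf scaleR_diff_right)
      also have "norm \<dots> \<le> (\<Sum>b\<in>Basis. \<bar>v \<bullet> b\<bar> * norm (T x b - T a b))"
        by (rule order_trans[OF norm_sum]) simp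
      also have "\<dots> \<le> (\<Sum>b\<in>Basis. norm v * norm (T x b - T a b))"
        by (intro sum_mono mult_right_mono Basis_le_norm) auto
      also have "\<dots> \<le> norm v * (\<beta> / 2)"
        unfolding sum_distrib_left[symmetric] using elim(1) by (intro mult_left_mono) auto
      finally show ?thesis by (simp add: mult.commute)
    qed
    from this[of "Z x - Z a"] have
      "\<beta> * norm (Z x - Z a) \<le> norm (T x (Z x - Z a)) + \<beta> / 2 * norm (Z x - Z a)"
      using \<beta>(2)[of "Z x - Z a"]
        norm_triangle_ineq4[of "T x (Z x - Z a)" "T x (Z x - Z a) - T a (Z x - Z a)"] by simp
    moreover have "T x (Z x - Z a) = rhs x - T x (Z a)"
      using linear_diff[OF linear_T[OF elim(2)]] T_Z[OF elim(2)] by simp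
    ultimately show ?case
      using \<beta>(1) by (simp add: field_simps)
  qed
  moreover have "((\<lambda>x. 2 / \<beta> * norm (rhs x - T x (Z a))) \<longlongrightarrow> 2 / \<beta> * norm (rhs a - T a (Z a))) (at a)"
    by (intro tendsto_mult tendsto_const tendsto_norm tendsto_diff cT[unfolded isCont_def]
        crhs[unfolded isCont_def])
  then have "((\<lambda>x. 2 / \<beta> * norm (rhs x - T x (Z a))) \<longlongrightarrow> 0) (at a)"
    using T_Z[OF a] by simp
  ultimately have "((\<lambda>x. Z x - Z a) \<longlongrightarrow> 0) (at a)"
    by (rule Lim_null_comparison)
  then show ?thesis
    unfolding isCont_def by (rule LIM_zero_cancel)
qed

text \<open>Comparison of the systems at \<open>x\<close> and \<open>a\<close> gives
  \<open>T\<^sub>a (Z\<^sub>x - Z\<^sub>a) = (c\<^sub>x - T\<^sub>x Z\<^sub>a) - (T\<^sub>x - T\<^sub>a) (Z\<^sub>x - Z\<^sub>a)\<close>. In the last term both factors vanish at \<open>a\<close>, so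
  that it has derivative \<open>0\<close>.\<close>
lemma has_derivative_Z:
  assumes a: "a \<in> S"
    and dG: "\<And>v w. (\<lambda>x. G x v w) differentiable (at a)" and dc: "\<And>w. (\<lambda>x. c x w) differentiable (at a)"
  obtains D where "(Z has_derivative D) (at a)"
    "\<And>u w. G a (D u) w = frechet_derivative (\<lambda>x. c x w) (at a) u -
        (\<Sum>b\<in>Basis. (Z a \<bullet> b) * frechet_derivative (\<lambda>x. G x b w) (at a) u)"
proof -
  obtain T' where T': "linear T'" "\<And>v. T' (T a v) = v" "\<And>v. T a (T' v) = v"
    using T_left_inverse[OF a] by blast
  have cZ: "isCont Z a"
    by (rule isCont_Z[OF a]) (rule differentiable_imp_continuous_within, rule dG dc)+
  have Gd: "((\<lambda>x. G x v w) has_derivative frechet_derivative (\<lambda>x. G x v w) (at a)) (at a)" for v w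
    using dG by (simp flip: frechet_derivative_works)
  have cd: "((\<lambda>x. c x w) has_derivative frechet_derivative (\<lambda>x. c x w) (at a)) (at a)" for w
    using dc by (simp flip: frechet_derivative_works)
  let ?T' = "\<lambda>v u. \<Sum>b\<in>Basis. frechet_derivative (\<lambda>x. G x v b) (at a) u *\<^sub>R b"
  let ?r' = "\<lambda>u. \<Sum>b\<in>Basis. frechet_derivative (\<lambda>x. c x b) (at a) u *\<^sub>R b"
  have Td: "((\<lambda>x. T x v) has_derivative ?T' v) (at a)" for v
    unfolding gram_def by (intro has_derivative_sum has_derivative_scaleR_left Gd)
  have rd: "(rhs has_derivative ?r') (at a)"
    unfolding rhs_def by (intro has_derivative_sum has_derivative_scaleR_left cd)
  let ?R = "\<lambda>x. \<Sum>b\<in>Basis. ((Z x - Z a) \<bullet> b) *\<^sub>R (T x b - T a b)"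
  have "((\<lambda>x. ((Z x - Z a) \<bullet> b) *\<^sub>R (T x b - T a b)) has_derivative (\<lambda>_. 0)) (at a)" for b
    by (rule has_derivative_vanishing_factor[OF _ _ has_derivative_diff[OF Td has_derivative_const]])
      (simp_all add: cZ isCont_diff continuous_inner)
  then have dR: "(?R has_derivative (\<lambda>u. \<Sum>b\<in>(Basis::'e set). 0)) (at a)"
    by (rule has_derivative_sum)
  have drhs: "((\<lambda>x. rhs x - (\<Sum>b\<in>Basis. (Z a \<bullet> b) *\<^sub>R T x b)) has_derivative
      (\<lambda>u. ?r' u - (\<Sum>b\<in>Basis. (Z a \<bullet> b) *\<^sub>R ?T' b u))) (at a)"
    by (intro has_derivative_diff has_derivative_sum has_derivative_scaleR_right rd Td)
  have dres: "((\<lambda>x. (rhs x - (\<Sum>b\<in>Basis. (Z a \<bullet> b) *\<^sub>R T x b)) - ?R x) has_derivative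
      (\<lambda>u. (?r' u - (\<Sum>b\<in>Basis. (Z a \<bullet> b) *\<^sub>R ?T' b u)) - (\<Sum>b\<in>(Basis::'e set). 0))) (at a)"
    by (rule has_derivative_diff[OF drhs dR])
  have lin: "((\<lambda>x. T' ((rhs x - (\<Sum>b\<in>Basis. (Z a \<bullet> b) *\<^sub>R T x b)) - ?R x) + Z a) has_derivative
      (\<lambda>u. T' ((?r' u - (\<Sum>b\<in>Basis. (Z a \<bullet> b) *\<^sub>R ?T' b u)) - (\<Sum>b\<in>(Basis::'e set). 0)) + 0)) (at a)"
    using T'(1) by (intro has_derivative_add[OF bounded_linear.has_derivative[OF _ dres] has_derivative_const])
      (simp add: linear_conv_bounded_linear)
  define D where "D u = T' (?r' u - (\<Sum>b\<in>Basis. (Z a \<bullet> b) *\<^sub>R ?T' b u))" for u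
  have eqZ: "T' ((rhs x - (\<Sum>b\<in>Basis. (Z a \<bullet> b) *\<^sub>R T x b)) - ?R x) + Z a = Z x" if x: "x \<in> S" for x
  proof -
    have "?R x = T x (Z x - Z a) - T a (Z x - Z a)"
      by (subst linear_eq_sum_Basis[OF linear_T[OF x]], subst linear_eq_sum_Basis[OF linear_T[OF a]])
        (simp add: sum_subtractf scaleR_diff_right)
    then have "(rhs x - (\<Sum>b\<in>Basis. (Z a \<bullet> b) *\<^sub>R T x b)) - ?R x = T a (Z x - Z a)"
      using linear_eq_sum_Basis[OF linear_T[OF x], of "Z a"] linear_diff[OF linear_T[OF x]] T_Z[OF x]
      by simp
    then show ?thesis using T'(2) by simp
  qed
  from has_derivative_transform_within_open[OF lin S a eqZ]
  have Zd: "(Z has_derivative D) (at a)"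
    by (simp add: D_def[abs_def])
  have "G a (D u) w = frechet_derivative (\<lambda>x. c x w) (at a) u -
        (\<Sum>b\<in>Basis. (Z a \<bullet> b) * frechet_derivative (\<lambda>x. G x b w) (at a) u)" for u w
  proof -
    have 1: "((\<lambda>x. T x v \<bullet> w) has_derivative (\<lambda>u. ?T' v u \<bullet> w)) (at a)" for v
      by (intro has_derivative_inner_left Td)
    have "((\<lambda>x. G x v w) has_derivative (\<lambda>u. ?T' v u \<bullet> w)) (at a)" for v
      by (rule has_derivative_transform_within_open[OF 1 S a]) (rule T_inner)
    then have 2: "?T' v u \<bullet> w = frechet_derivative (\<lambda>x. G x v w) (at a) u" for v
      by (rule frechet_derivative_eqI[symmetric])
    have "((\<lambda>x. rhs x \<bullet> w) has_derivative (\<lambda>u. ?r' u \<bullet> w)) (at a)"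
      by (intro has_derivative_inner_left rd)
    then have "((\<lambda>x. c x w) has_derivative (\<lambda>u. ?r' u \<bullet> w)) (at a)"
      by (rule has_derivative_transform_within_open[OF _ S a]) (simp add: solution T_inner flip: T_Z)
    then have 3: "?r' u \<bullet> w = frechet_derivative (\<lambda>x. c x w) (at a) u"
      by (rule frechet_derivative_eqI[symmetric])
    have "G a (D u) w = (?r' u - (\<Sum>b\<in>Basis. (Z a \<bullet> b) *\<^sub>R ?T' b u)) \<bullet> w"
      by (simp add: D_def T'(3) flip: T_inner[OF a])
    also have "\<dots> = ?r' u \<bullet> w - (\<Sum>b\<in>Basis. (Z a \<bullet> b) * (?T' b u \<bullet> w))"
      by (simp add: inner_diff_left inner_sum_left del: inner_sum_left_Basis)
    finally show ?thesis
      unfolding 2 3 .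
  qed
  with Zd that show thesis by blast
qed

end

text \<open>Differentiating the system shows that a directional derivative of \<open>Z\<close> solves a system with the same
  matrix and a right-hand side that involves \<open>Z\<close> itself. This makes an induction on the order possible.\<close>
lemma Ck_on_solution:
  fixes G :: "'d::euclidean_space \<Rightarrow> 'e::euclidean_space \<Rightarrow> 'e \<Rightarrow> real"
  assumes "linear_system S G c Z" "\<And>v w. Ck_on k (\<lambda>x. G x v w) S" "\<And>w. Ck_on k (\<lambda>x. c x w) S"
  shows "Ck_on k Z S"
  using assms
proof (induction k arbitrary: c Z)
  case 0
  interpret linear_system S G c Z by fact
  show ?case
    using 0(2,3) S by (auto intro!: continuous_at_imp_continuous_on isCont_Z simp: continuous_on_eq_continuous_at)
next
  case (Suc k)
  interpret linear_system S G c Z by fact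
  have "\<forall>a\<in>S. \<exists>D. (Z has_derivative D) (at a) \<and>
    (\<forall>u w. G a (D u) w = frechet_derivative (\<lambda>x. c x w) (at a) u -
        (\<Sum>b\<in>Basis. (Z a \<bullet> b) * frechet_derivative (\<lambda>x. G x b w) (at a) u))"
  proof
    fix a assume a: "a \<in> S"
    have dG: "(\<lambda>x. G x v w) differentiable (at a)" for v w
      using Suc.prems(2)[of v w] a by simp
    have dc: "(\<lambda>x. c x w) differentiable (at a)" for w
      using Suc.prems(3)[of w] a by simp
    show "\<exists>D. (Z has_derivative D) (at a) \<and>
      (\<forall>u w. G a (D u) w = frechet_derivative (\<lambda>x. c x w) (at a) u -
        (\<Sum>b\<in>Basis. (Z a \<bullet> b) * frechet_derivative (\<lambda>x. G x b w) (at a) u))"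
      by (rule has_derivative_Z[OF a dG dc]) blast
  qed
  from bchoice[OF this] obtain D where D: "\<And>a. a \<in> S \<Longrightarrow> (Z has_derivative D a) (at a)"
    "\<And>a u w. a \<in> S \<Longrightarrow> G a (D a u) w = frechet_derivative (\<lambda>x. c x w) (at a) u -
        (\<Sum>b\<in>Basis. (Z a \<bullet> b) * frechet_derivative (\<lambda>x. G x b w) (at a) u)"
    by blast
  have Z: "Ck_on k Z S"
    by (rule Suc.IH[OF Suc.prems(1)]) (rule Ck_on_SucD, rule Suc.prems)+
  show ?case
  proof (rule Ck_on_SucI[OF S D(1)])
    fix u
    let ?c = "\<lambda>a w. frechet_derivative (\<lambda>x. c x w) (at a) u -
        (\<Sum>b\<in>Basis. (Z a \<bullet> b) * frechet_derivative (\<lambda>x. G x b w) (at a) u)"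
    have eq: "?c a w = G a (D a u) w" if "a \<in> S" for a w
      using D(2) that by simp
    have lin: "linear (?c a)" if "a \<in> S" for a
      unfolding eq[OF that] using scalar_product.linear_right[OF G[OF that]] .
    have sys: "linear_system S G ?c (\<lambda>a. D a u)"
      by (rule linear_system.intro[OF S G lin D(2)])
    have ck: "Ck_on k (\<lambda>a. ?c a w) S" for w
      unfolding diff_conv_add_uminus
      by (intro Ck_on_add S Ck_on_bounded_linear[OF S, of uminus] bounded_linear_minus bounded_linear_ident
          Ck_on_sum Ck_on_bilinear[OF S bounded_bilinear_mult]
          Ck_on_bounded_linear[OF S bounded_linear_inner_left] Z) (use Suc.prems in simp_all)
    show "Ck_on k (\<lambda>a. D a u) S"
      by (rule Suc.IH[OF sys Ck_on_SucD[OF Suc.prems(2)] ck])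
  qed
qed

section \<open>Calculus in a coordinate chart\<close>

lemma linear_cmult: "linear f \<Longrightarrow> linear (\<lambda>z. c * f z)" for f :: "'b::real_vector \<Rightarrow> real"
  using linear_compose_scale_right[of f c] by simp

text \<open>Derivatives in a chart are derivatives on an open subset of a Euclidean space; injectivity of the coordinate
  map and openness of its image are what the transfer of the differentiation rules rests on.\<close>
locale chart =
  fixes M :: "('a, 'i, 'e::euclidean_space) manifold" and i :: 'i
  assumes open_image: "open (coord M i ` chart_dom M i)"
    and inj_coord: "inj_on (coord M i) (chart_dom M i)"
begin

abbreviation sm :: "('a \<Rightarrow> 'b::real_normed_vector) \<Rightarrow> bool" where
  "sm f \<equiv> smooth_in_chart M i f"

abbreviation dom :: "'a set" where
  "dom \<equiv> chart_dom M i"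

lemma chart_inv_coord [simp]: "x \<in> dom \<Longrightarrow> chart_inv M i (coord M i x) = x"
  using inj_coord by (simp add: chart_inv_def)

lemma coord_chart_inv [simp]: "y \<in> coord M i ` dom \<Longrightarrow> coord M i (chart_inv M i y) = y"
  by auto

lemma smE: "sm f \<Longrightarrow> Ck_on k (f \<circ> chart_inv M i) (coord M i ` dom)"
  by (simp add: smooth_in_chart_def smooth_on_def)

lemma smI: "(\<And>k. Ck_on k (f \<circ> chart_inv M i) (coord M i ` dom)) \<Longrightarrow> sm f"
  by (simp add: smooth_in_chart_def smooth_on_def)

lemma smI':
  assumes "\<And>k. Ck_on k f' (coord M i ` dom)" "\<And>x. x \<in> dom \<Longrightarrow> f' (coord M i x) = f x"
  shows "sm f"
  by (rule smI, rule Ck_on_cong[OF open_image _ assms(1)]) (auto simp: assms(2))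

lemma sm_cong: "sm f \<Longrightarrow> (\<And>x. x \<in> dom \<Longrightarrow> f x = g x) \<Longrightarrow> sm g"
  by (rule smI'[OF smE[of f]]) auto

lemma pd_has_derivative:
  "sm f \<Longrightarrow> x \<in> dom \<Longrightarrow> ((f \<circ> chart_inv M i) has_derivative pd M i f x) (at (coord M i x))"
  using Ck_on_has_derivative[OF smE[of f "Suc 0"], of "coord M i x"] by (simp add: pd_def[abs_def])

lemma pd_eqI:
  "((\<lambda>y. f (chart_inv M i y)) has_derivative D) (at (coord M i x)) \<Longrightarrow> pd M i f x v = D v"
  by (simp add: pd_def frechet_derivative_eqI o_def)

lemma pd_has_derivative':
  "sm f \<Longrightarrow> x \<in> dom \<Longrightarrow> ((\<lambda>y. f (chart_inv M i y)) has_derivative pd M i f x) (at (coord M i x))"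
  using pd_has_derivative by (simp add: o_def)

lemma linear_pd: "sm f \<Longrightarrow> x \<in> dom \<Longrightarrow> linear (pd M i f x)"
  using pd_has_derivative has_derivative_linear by blast

lemma has_derivative_cong_dom:
  assumes "((\<lambda>y. f (chart_inv M i y)) has_derivative D) (at (coord M i x))"
    and "x \<in> dom" "\<And>y. y \<in> dom \<Longrightarrow> f y = g y"
  shows "((\<lambda>y. g (chart_inv M i y)) has_derivative D) (at (coord M i x))"
  by (rule has_derivative_transform_within_open[OF assms(1) open_image]) (use assms(2,3) in auto)

lemma pd_cong:
  assumes "x \<in> dom" "\<And>y. y \<in> dom \<Longrightarrow> f y = g y"
  shows "pd M i f x v = pd M i g x v"
proof -
  have "((\<lambda>y. f (chart_inv M i y)) has_derivative D) (at (coord M i x)) \<longleftrightarrow>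
        ((\<lambda>y. g (chart_inv M i y)) has_derivative D) (at (coord M i x))" for D
    using has_derivative_cong_dom[of f D x g] has_derivative_cong_dom[of g D x f] assms by auto
  then show ?thesis
    by (simp add: pd_def frechet_derivative_def o_def)
qed

lemma sm_const [simp]: "sm (\<lambda>_. c)"
  by (rule smI'[of "\<lambda>_. c"]) (auto intro: Ck_on_const open_image)

lemma sm_bounded_linear: "bounded_linear L \<Longrightarrow> sm f \<Longrightarrow> sm (\<lambda>x. L (f x))"
  by (rule smI'[OF Ck_on_bounded_linear[OF open_image _ smE[of f]]]) auto

lemma sm_bilinear: "bounded_bilinear P \<Longrightarrow> sm f \<Longrightarrow> sm g \<Longrightarrow> sm (\<lambda>x. P (f x) (g x))"
  by (rule smI'[OF Ck_on_bilinear[OF open_image _ smE[of f] smE[of g]]]) auto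

lemma sm_add: "sm f \<Longrightarrow> sm g \<Longrightarrow> sm (\<lambda>x. f x + g x)"
  by (rule smI'[OF Ck_on_add[OF open_image smE[of f] smE[of g]]]) auto

lemma sm_minus: "sm f \<Longrightarrow> sm (\<lambda>x. - f x)"
  by (rule sm_bounded_linear[of uminus]) (auto intro: bounded_linear_minus bounded_linear_ident)

lemma sm_diff: "sm f \<Longrightarrow> sm g \<Longrightarrow> sm (\<lambda>x. f x - g x)"
  using sm_add[OF _ sm_minus[of g], of f] by simp

lemma sm_mult: "sm f \<Longrightarrow> sm g \<Longrightarrow> sm (\<lambda>x. f x * g x)" for f :: "'a \<Rightarrow> real"
  by (rule sm_bilinear[OF bounded_bilinear_mult])

lemma sm_scaleR: "sm f \<Longrightarrow> sm g \<Longrightarrow> sm (\<lambda>x. f x *\<^sub>R g x)"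
  by (rule sm_bilinear[OF bounded_bilinear_scaleR])

lemma sm_inner: "sm f \<Longrightarrow> sm g \<Longrightarrow> sm (\<lambda>x. f x \<bullet> g x)"
  by (rule sm_bilinear[OF bounded_bilinear_inner])

lemma sm_sum: "(\<And>a. a \<in> A \<Longrightarrow> sm (f a)) \<Longrightarrow> sm (\<lambda>x. \<Sum>a\<in>A. f a x)"
  by (induction A rule: infinite_finite_induct) (auto intro: sm_add)

lemma sm_inverse:
  fixes f :: "'a \<Rightarrow> real"
  assumes "sm f" "\<And>x. x \<in> dom \<Longrightarrow> f x \<noteq> 0"
  shows "sm (\<lambda>x. inverse (f x))"
  by (rule smI'[OF Ck_on_inverse[OF open_image smE[OF assms(1)]]]) (auto simp: assms(2))

lemma sm_divide: "sm f \<Longrightarrow> sm g \<Longrightarrow> (\<And>x. x \<in> dom \<Longrightarrow> g x \<noteq> 0) \<Longrightarrow> sm (\<lambda>x. f x / g x)"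
  for f :: "'a \<Rightarrow> real"
  using sm_mult[OF _ sm_inverse[of g], of f] by (simp add: divide_inverse)

lemma sm_pd: "sm f \<Longrightarrow> sm (\<lambda>x. pd M i f x v)"
proof (rule smI'[of "\<lambda>y. frechet_derivative (f \<circ> chart_inv M i) (at y) v"])
  show "Ck_on k (\<lambda>y. frechet_derivative (f \<circ> chart_inv M i) (at y) v) (coord M i ` dom)" if "sm f" for k
    using smE[OF that, of "Suc k"] by simp
qed (simp add: pd_def)

lemmas sm_intros = sm_const sm_add sm_minus sm_diff sm_mult sm_scaleR sm_inner sm_sum sm_inverse
  sm_divide sm_pd

lemma pd_const [simp]: "pd M i (\<lambda>_. c) x v = 0"
  by (rule pd_eqI) (rule has_derivative_const)

lemma pd_bounded_linear:
  "bounded_linear L \<Longrightarrow> sm f \<Longrightarrow> x \<in> dom \<Longrightarrow> pd M i (\<lambda>y. L (f y)) x v = L (pd M i f x v)"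
  by (rule pd_eqI) (rule bounded_linear.has_derivative[OF _ pd_has_derivative'])

lemma pd_bilinear:
  "bounded_bilinear P \<Longrightarrow> sm f \<Longrightarrow> sm g \<Longrightarrow> x \<in> dom \<Longrightarrow>
   pd M i (\<lambda>y. P (f y) (g y)) x v = P (f x) (pd M i g x v) + P (pd M i f x v) (g x)"
  using bounded_bilinear.FDERIV[of P "\<lambda>y. f (chart_inv M i y)" "pd M i f x" "coord M i x" UNIV
      "\<lambda>y. g (chart_inv M i y)" "pd M i g x"]
  by (intro pd_eqI) (simp add: pd_has_derivative')

lemma pd_add:
  "sm f \<Longrightarrow> sm g \<Longrightarrow> x \<in> dom \<Longrightarrow> pd M i (\<lambda>y. f y + g y) x v = pd M i f x v + pd M i g x v"
  by (rule pd_eqI) (intro has_derivative_add pd_has_derivative')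

lemma pd_diff:
  "sm f \<Longrightarrow> sm g \<Longrightarrow> x \<in> dom \<Longrightarrow> pd M i (\<lambda>y. f y - g y) x v = pd M i f x v - pd M i g x v"
  by (rule pd_eqI) (intro has_derivative_diff pd_has_derivative')

lemma pd_minus: "sm f \<Longrightarrow> x \<in> dom \<Longrightarrow> pd M i (\<lambda>y. - f y) x v = - pd M i f x v"
  by (rule pd_eqI) (intro has_derivative_minus pd_has_derivative')

lemma pd_sum:
  "(\<And>a. a \<in> A \<Longrightarrow> sm (f a)) \<Longrightarrow> x \<in> dom \<Longrightarrow>
   pd M i (\<lambda>y. \<Sum>a\<in>A. f a y) x v = (\<Sum>a\<in>A. pd M i (f a) x v)"
  by (rule pd_eqI) (intro has_derivative_sum pd_has_derivative')

lemma pd_mult: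
  "sm f \<Longrightarrow> sm g \<Longrightarrow> x \<in> dom \<Longrightarrow>
   pd M i (\<lambda>y. f y * g y) x v = f x * pd M i g x v + pd M i f x v * g x" for f :: "'a \<Rightarrow> real"
  by (rule pd_bilinear[OF bounded_bilinear_mult])

lemma pd_scaleR:
  "sm f \<Longrightarrow> sm g \<Longrightarrow> x \<in> dom \<Longrightarrow>
   pd M i (\<lambda>y. f y *\<^sub>R g y) x v = f x *\<^sub>R pd M i g x v + pd M i f x v *\<^sub>R g x"
  by (rule pd_bilinear[OF bounded_bilinear_scaleR])

lemma pd_cmult: "sm f \<Longrightarrow> x \<in> dom \<Longrightarrow> pd M i (\<lambda>y. c * f y) x v = c * pd M i f x v" for c :: real
  using pd_mult[of "\<lambda>_. c" f x v] by simp

lemma pd_inverse: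
  fixes f :: "'a \<Rightarrow> real"
  assumes "sm f" "x \<in> dom" "f x \<noteq> 0"
  shows "pd M i (\<lambda>y. inverse (f y)) x v = - (pd M i f x v / (f x)\<^sup>2)"
proof -
  have "pd M i (\<lambda>y. inverse (f y)) x v = - (inverse (f x) * pd M i f x v * inverse (f x))"
    using Deriv.has_derivative_inverse[OF _ pd_has_derivative'[OF assms(1,2)]] assms(2,3)
    by (intro pd_eqI) simp
  then show ?thesis
    by (simp add: field_simps power2_eq_square)
qed

lemma pd_ln_abs:
  fixes f :: "'a \<Rightarrow> real"
  assumes "sm f" "x \<in> dom" "f x \<noteq> 0"
  shows "pd M i (\<lambda>y. ln \<bar>f y\<bar>) x v = pd M i f x v / f x"
proof -
  have f: "((\<lambda>y. f (chart_inv M i y)) has_derivative pd M i f x) (at (coord M i x))"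
    by (rule pd_has_derivative'[OF assms(1,2)])
  have ln_abs: "ln \<bar>t\<bar> = ln t" "ln \<bar>t\<bar> = ln (- t)" for t :: real
    by (auto simp: abs_if ln_minus)
  have "((\<lambda>y. ln \<bar>f (chart_inv M i y)\<bar>) has_derivative (\<lambda>v. pd M i f x v / f x)) (at (coord M i x))"
  proof (cases "f x > 0")
    case True
    then show ?thesis
      unfolding ln_abs(1) using f assms(2) by (auto intro!: derivative_eq_intros simp: field_simps)
  next
    case False
    then show ?thesis
      unfolding ln_abs(2) using f assms(2,3) by (auto intro!: derivative_eq_intros simp: field_simps)
  qed
  then show ?thesis by (rule pd_eqI)
qed

lemma pd_commute:
  fixes f :: "'a \<Rightarrow> 'b::euclidean_space"
  assumes f: "sm f" and x: "x \<in> dom"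
  shows "pd M i (\<lambda>y. pd M i f y u) x v = pd M i (\<lambda>y. pd M i f y v) x u"
proof -
  let ?F = "f \<circ> chart_inv M i"
  have *: "pd M i (\<lambda>y. pd M i f y a) x b =
      frechet_derivative (\<lambda>y. frechet_derivative ?F (at y) a) (at (coord M i x)) b" for a b
  proof (rule pd_eqI)
    have "((\<lambda>y. frechet_derivative ?F (at y) a) has_derivative
        frechet_derivative (\<lambda>y. frechet_derivative ?F (at y) a) (at (coord M i x))) (at (coord M i x))"
      by (rule Ck_on_has_derivative[where k = 0 and S = "coord M i ` dom"]) (use smE[OF f, of 2] x in \<open>auto simp: numeral_2_eq_2\<close>)
    then show "((\<lambda>y. pd M i f (chart_inv M i y) a) has_derivative
        frechet_derivative (\<lambda>y. frechet_derivative ?F (at y) a) (at (coord M i x))) (at (coord M i x))"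
      by (rule has_derivative_transform_within_open[OF _ open_image]) (use x in \<open>auto simp: pd_def\<close>)
  qed
  show ?thesis
    unfolding * using mixed_derivatives_commute[OF open_image _ smE[OF f]] x by blast
qed

text \<open>A field of linear maps applied to a vector field: expanding in the standard basis reduces the
  Leibniz rule to that for scalar multiples.\<close>
context
  fixes A :: "'a \<Rightarrow> 'd::euclidean_space \<Rightarrow> 'b::real_normed_vector"
  assumes linA: "\<And>x. x \<in> dom \<Longrightarrow> linear (A x)" and smA: "\<And>v. sm (\<lambda>x. A x v)"
begin

lemma sm_apply:
  assumes Y: "sm Y"
  shows "sm (\<lambda>x. A x (Y x))"
proof (rule sm_cong)
  show "sm (\<lambda>x. \<Sum>b\<in>Basis. (Y x \<bullet> b) *\<^sub>R A x b)"
    by (intro sm_intros Y smA)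
qed (use linear_eq_sum_Basis[OF linA] in auto)

lemma pd_apply:
  assumes Y: "sm Y" and x: "x \<in> dom"
  shows "pd M i (\<lambda>y. A y (Y y)) x u = pd M i (\<lambda>y. A y (Y x)) x u + A x (pd M i Y x u)"
proof -
  have c: "pd M i (\<lambda>y. A y (Y y)) x u = pd M i (\<lambda>y. \<Sum>b\<in>Basis. (Y y \<bullet> b) *\<^sub>R A y b) x u" for Y
    by (rule pd_cong[OF x]) (rule linear_eq_sum_Basis[OF linA])
  have "pd M i (\<lambda>y. \<Sum>b\<in>Basis. (Y y \<bullet> b) *\<^sub>R A y b) x u =
      (\<Sum>b\<in>Basis. (Y x \<bullet> b) *\<^sub>R pd M i (\<lambda>y. A y b) x u + pd M i (\<lambda>y. Y y \<bullet> b) x u *\<^sub>R A x b)"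
    by (simp add: pd_sum pd_scaleR sm_intros Y smA x)
  also have "\<dots> = (\<Sum>b\<in>Basis. (Y x \<bullet> b) *\<^sub>R pd M i (\<lambda>y. A y b) x u) + A x (pd M i Y x u)"
    by (subst linear_eq_sum_Basis[OF linA[OF x], of "pd M i Y x u"])
      (simp add: sum.distrib pd_bounded_linear[OF bounded_linear_inner_left Y x])
  also have "(\<Sum>b\<in>Basis. (Y x \<bullet> b) *\<^sub>R pd M i (\<lambda>y. A y b) x u) =
      pd M i (\<lambda>y. \<Sum>b\<in>Basis. (Y x \<bullet> b) *\<^sub>R A y b) x u"
    by (simp add: pd_sum pd_scaleR sm_intros smA x)
  finally show ?thesis
    unfolding c .
qed

lemma linear_pd_field:
  assumes x: "x \<in> dom"
  shows "linear (\<lambda>w. pd M i (\<lambda>y. A y w) x u)"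
proof (rule linearI)
  show "pd M i (\<lambda>y. A y (v + w)) x u = pd M i (\<lambda>y. A y v) x u + pd M i (\<lambda>y. A y w) x u" for v w
    unfolding pd_add[OF smA smA x, symmetric] by (rule pd_cong[OF x]) (rule linear_add[OF linA])
  have "pd M i (\<lambda>y. c *\<^sub>R A y w) x u = c *\<^sub>R pd M i (\<lambda>y. A y w) x u" for c w
    using pd_scaleR[where f = "\<lambda>_. c" and g = "\<lambda>y. A y w", OF sm_const smA x] by simp
  then show "pd M i (\<lambda>y. A y (c *\<^sub>R w)) x u = c *\<^sub>R pd M i (\<lambda>y. A y w) x u" for c w
    using pd_cong[OF x, of "\<lambda>y. A y (c *\<^sub>R w)" "\<lambda>y. c *\<^sub>R A y w"] linear_scale[OF linA] by simp
qed

end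

lemma sm_lin_trace: "(\<And>z. sm (\<lambda>x. F x z)) \<Longrightarrow> sm (\<lambda>x. lin_trace (F x))"
  unfolding lin_trace_def by (intro sm_intros)

context
  fixes B :: "'a \<Rightarrow> 'd::euclidean_space \<Rightarrow> 'd \<Rightarrow> 'b::real_normed_vector"
  assumes bilB: "\<And>x. x \<in> dom \<Longrightarrow> bilinear (B x)" and smB: "\<And>v w. sm (\<lambda>x. B x v w)"
begin

lemma sm_apply2:
  assumes Y: "sm Y" and Z: "sm Z"
  shows "sm (\<lambda>x. B x (Y x) (Z x))"
proof (rule sm_apply[where A = "\<lambda>x. B x (Y x)", OF _ _ Z])
  show "linear (B x (Y x))" if "x \<in> dom" for x
    using bilB[OF that] by (simp add: bilinear_def)
  show "sm (\<lambda>x. B x (Y x) w)" for w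
    by (rule sm_apply[where A = "\<lambda>x v. B x v w", OF _ smB Y]) (use bilB in \<open>simp add: bilinear_def\<close>)
qed

lemma pd_apply2:
  assumes Y: "sm Y" and Z: "sm Z" and x: "x \<in> dom"
  shows "pd M i (\<lambda>y. B y (Y y) (Z y)) x u =
    pd M i (\<lambda>y. B y (Y x) (Z x)) x u + B x (pd M i Y x u) (Z x) + B x (Y x) (pd M i Z x u)"
proof -
  have "pd M i (\<lambda>y. B y (Y y) (Z y)) x u = pd M i (\<lambda>y. B y (Y y) (Z x)) x u + B x (Y x) (pd M i Z x u)"
    by (rule pd_apply[where A = "\<lambda>x. B x (Y x)"])
      (use bilB Y Z x in \<open>auto simp: bilinear_def intro: sm_apply2\<close>)
  also have "pd M i (\<lambda>y. B y (Y y) (Z x)) x u = pd M i (\<lambda>y. B y (Y x) (Z x)) x u + B x (pd M i Y x u) (Z x)"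
    by (rule pd_apply[where A = "\<lambda>y v. B y v (Z x)"]) (use bilB smB Y x in \<open>auto simp: bilinear_def\<close>)
  finally show ?thesis by simp
qed

end

end

section \<open>The Levi-Civita connection in a chart\<close>

locale metric_chart = chart M i
  for M :: "('a, 'i, 'e::euclidean_space) manifold" and i +
  fixes g :: "('a, 'i, 'e) form2"
  assumes scalar_product: "\<And>x. x \<in> dom \<Longrightarrow> scalar_product (g i x)"
    and sm_metric: "\<And>v w. sm (\<lambda>x. g i x v w)"
begin

lemma bilinear_g: "x \<in> dom \<Longrightarrow> bilinear (g i x)"
  using scalar_product scalar_product.bilinear by blast

text \<open>The dual vector solves a linear system whose matrix is the metric.\<close>
lemma sm_sharp:
  assumes "\<And>x. x \<in> dom \<Longrightarrow> linear (\<alpha> x)" "\<And>w. sm (\<lambda>x. \<alpha> x w)"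
  shows "sm (\<lambda>x. sharp (g i x) (\<alpha> x))"
proof (rule smI)
  let ?V = "coord M i ` dom"
  have "linear_system ?V (\<lambda>y. g i (chart_inv M i y)) (\<lambda>y. \<alpha> (chart_inv M i y))
      ((\<lambda>x. sharp (g i x) (\<alpha> x)) \<circ> chart_inv M i)"
    by (rule linear_system.intro)
      (auto simp: open_image scalar_product assms scalar_product.sharp)
  then show "Ck_on k ((\<lambda>x. sharp (g i x) (\<alpha> x)) \<circ> chart_inv M i) ?V" for k
    using smE[OF sm_metric] smE[OF assms(2)]
    by (intro Ck_on_solution[where G = "\<lambda>y. g i (chart_inv M i y)" and c = "\<lambda>y. \<alpha> (chart_inv M i y)"])
      (simp_all add: o_def)
qed

abbreviation dg where "dg x u v w \<equiv> pd M i (\<lambda>y. g i y v w) x u"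

lemma dg_linear:
  assumes "x \<in> dom"
  shows "linear (\<lambda>u. dg x u v w)" "linear (\<lambda>v. dg x u v w)" "linear (\<lambda>w. dg x u v w)"
proof -
  show "linear (\<lambda>u. dg x u v w)"
    by (rule linear_pd[OF sm_metric assms])
  show "linear (\<lambda>v. dg x u v w)"
    by (rule linear_pd_field[where A = "\<lambda>y v. g i y v w"])
      (use assms sm_metric bilinear_g in \<open>auto simp: bilinear_def\<close>)
  show "linear (\<lambda>w. dg x u v w)"
    by (rule linear_pd_field[where A = "\<lambda>y. g i y v"])
      (use assms sm_metric bilinear_g in \<open>auto simp: bilinear_def\<close>)
qed

lemma dg_sym: "x \<in> dom \<Longrightarrow> dg x u v w = dg x u w v"
  by (rule pd_cong) (auto intro: scalar_product.sym scalar_product)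

text \<open>The right-hand side of the Koszul formula for constant (commuting) coordinate fields.\<close>
definition koszul :: "'a \<Rightarrow> 'e \<Rightarrow> 'e \<Rightarrow> 'e \<Rightarrow> real" where
  "koszul x u v w = 1/2 * (dg x u v w + dg x v u w - dg x w u v)"

lemma koszul_linear:
  assumes "x \<in> dom"
  shows "linear (\<lambda>u. koszul x u v w)" "linear (\<lambda>v. koszul x u v w)" "linear (\<lambda>w. koszul x u v w)"
  unfolding koszul_def
  by (intro linear_cmult linear_compose_add linear_compose_sub dg_linear assms)+

lemma koszul_sym: "x \<in> dom \<Longrightarrow> koszul x u v w = koszul x v u w"
  using dg_sym[where x = x and u = w and v = u and w = v] by (simp add: koszul_def)

lemma koszul_metric: "x \<in> dom \<Longrightarrow> koszul x u v w + koszul x u w v = dg x u v w"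
  using dg_sym[where x = x and u = u and v = w and w = v] by (simp add: koszul_def field_simps)

abbreviation \<Gamma> where "\<Gamma> \<equiv> levi_civita M g i"

text \<open>In the alternating sum over the three arguments all but two of the six terms cancel by symmetry.\<close>
lemma levi_civita_koszul_unique:
  assumes x: "x \<in> dom"
    and G: "\<And>v w. G v w = G w v" "\<And>u v w. dg x u v w = g i x (G u v) w + g i x v (G u w)"
  shows "g i x (G u v) w = koszul x u v w"
proof -
  interpret g: scalar_product "g i x" by (rule scalar_product[OF x])
  show ?thesis
    unfolding koszul_def G(2) using G(1)[of v u] G(1)[of w u] G(1)[of w v] g.sym by (simp add: g.sym)
qed

lemma levi_civita_eqI:
  assumes x: "x \<in> dom"
    and G: "bilinear G" "\<And>v w. G v w = G w v" "\<And>u v w. dg x u v w = g i x (G u v) w + g i x v (G u w)"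
  shows "\<Gamma> x = G"
  unfolding levi_civita_def
proof (rule the_equality)
  fix G' assume G': "bilinear G' \<and> (\<forall>v w. G' v w = G' w v) \<and>
     (\<forall>u v w. dg x u v w = g i x (G' u v) w + g i x v (G' u w))"
  interpret g: scalar_product "g i x" by (rule scalar_product[OF x])
  show "G' = G"
  proof (intro ext g.eqI)
    fix u v w
    have "g i x (G' u v) w = koszul x u v w"
      by (rule levi_civita_koszul_unique[OF x]) (use G' in blast)+
    also have "\<dots> = g i x (G u v) w"
      by (rule levi_civita_koszul_unique[OF x G(2,3), symmetric])
    finally show "g i x (G' u v) w = g i x (G u v) w" .
  qed
qed (use G in auto)

lemma levi_civita_eq_sharp:
  assumes x: "x \<in> dom"
  shows "\<Gamma> x u v = sharp (g i x) (koszul x u v)"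
proof -
  interpret g: scalar_product "g i x" by (rule scalar_product[OF x])
  define G where "G u v = sharp (g i x) (koszul x u v)" for u v
  have G: "g i x (G u v) w = koszul x u v w" for u v w
    unfolding G_def by (rule g.sharp) (rule koszul_linear[OF x])
  have "\<Gamma> x = G"
  proof (rule levi_civita_eqI[OF x])
    show "bilinear G"
      by (intro bilinearI linearI g.eqI)
        (simp_all add: G g.simps linear_add[OF koszul_linear(1)[OF x]] linear_add[OF koszul_linear(2)[OF x]]
          linear_scale[OF koszul_linear(1)[OF x]] linear_scale[OF koszul_linear(2)[OF x]])
    show "G v w = G w v" for v w
      by (rule g.eqI) (simp add: G koszul_sym[OF x, of v w])
    show "dg x u v w = g i x (G u v) w + g i x v (G u w)" for u v w
      by (simp add: g.sym[of v] G koszul_metric[OF x])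
  qed
  then show ?thesis by (simp add: G_def)
qed

lemma levi_civita_koszul:
  assumes x: "x \<in> dom"
  shows "g i x (\<Gamma> x u v) w = koszul x u v w"
  unfolding levi_civita_eq_sharp[OF x]
  by (rule scalar_product.sharp[OF scalar_product[OF x]]) (rule koszul_linear[OF x])

lemma levi_civita_sym: "x \<in> dom \<Longrightarrow> \<Gamma> x u v = \<Gamma> x v u"
  by (rule scalar_product.eqI[OF scalar_product[of x]])
    (simp_all add: levi_civita_koszul koszul_sym[of x u v])

lemma levi_civita_metric:
  assumes x: "x \<in> dom"
  shows "dg x u v w = g i x (\<Gamma> x u v) w + g i x v (\<Gamma> x u w)"
  by (simp add: scalar_product.sym[OF scalar_product[OF x], of v] levi_civita_koszul[OF x]
      koszul_metric[OF x])

lemma levi_civita_bilinear: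
  assumes x: "x \<in> dom"
  shows "bilinear (\<Gamma> x)"
proof -
  interpret g: scalar_product "g i x" by (rule scalar_product[OF x])
  show ?thesis
    by (intro bilinearI linearI g.eqI)
      (simp_all add: levi_civita_koszul[OF x] g.simps linear_add[OF koszul_linear(1)[OF x]] linear_add[OF koszul_linear(2)[OF x]]
          linear_scale[OF koszul_linear(1)[OF x]] linear_scale[OF koszul_linear(2)[OF x]])
qed

lemma sm_levi_civita: "sm (\<lambda>x. \<Gamma> x u v)"
proof (rule sm_cong)
  show "sm (\<lambda>x. sharp (g i x) (koszul x u v))"
  proof (rule sm_sharp)
    show "sm (\<lambda>x. koszul x u v w)" for w
      unfolding koszul_def by (intro sm_intros sm_metric)
  qed (rule koszul_linear)
qed (simp add: levi_civita_eq_sharp)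

lemma sm_levi_civita': "sm Y \<Longrightarrow> sm Z \<Longrightarrow> sm (\<lambda>x. \<Gamma> x (Y x) (Z x))"
  by (rule sm_apply2) (auto intro: levi_civita_bilinear sm_levi_civita)

abbreviation nab ("\<nabla>") where "\<nabla> \<equiv> nabla M g i"

lemma nabla_const: "\<nabla> v (\<lambda>_. w) x = \<Gamma> x v w"
  by (simp add: nabla_def)

lemma sm_nabla: "sm Y \<Longrightarrow> sm (\<nabla> v Y)"
  unfolding nabla_def[abs_def] by (intro sm_intros sm_levi_civita')

lemma nabla_cong: "x \<in> dom \<Longrightarrow> (\<And>y. y \<in> dom \<Longrightarrow> Y y = Z y) \<Longrightarrow> \<nabla> v Y x = \<nabla> v Z x"
  using pd_cong[of x Y Z v] by (simp add: nabla_def)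

lemma nabla_add: "sm Y \<Longrightarrow> sm Z \<Longrightarrow> x \<in> dom \<Longrightarrow> \<nabla> v (\<lambda>y. Y y + Z y) x = \<nabla> v Y x + \<nabla> v Z x"
  by (simp add: nabla_def pd_add bilinear_simps[OF levi_civita_bilinear])

lemma nabla_diff: "sm Y \<Longrightarrow> sm Z \<Longrightarrow> x \<in> dom \<Longrightarrow> \<nabla> v (\<lambda>y. Y y - Z y) x = \<nabla> v Y x - \<nabla> v Z x"
  by (simp add: nabla_def pd_diff bilinear_simps[OF levi_civita_bilinear])

lemma nabla_scaleR:
  "sm f \<Longrightarrow> sm Y \<Longrightarrow> x \<in> dom \<Longrightarrow> \<nabla> v (\<lambda>y. f y *\<^sub>R Y y) x = f x *\<^sub>R \<nabla> v Y x + pd M i f x v *\<^sub>R Y x"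
  by (simp add: nabla_def pd_scaleR bilinear_simps[OF levi_civita_bilinear] algebra_simps)

lemma linear_nabla_direction: "sm Y \<Longrightarrow> x \<in> dom \<Longrightarrow> linear (\<lambda>v. \<nabla> v Y x)"
  unfolding nabla_def using levi_civita_bilinear[of x]
  by (intro linear_compose_add linear_pd) (auto simp: bilinear_def)

lemma nabla_metric:
  assumes "sm Y" "sm Z" "x \<in> dom"
  shows "pd M i (\<lambda>y. g i y (Y y) (Z y)) x v = g i x (\<nabla> v Y x) (Z x) + g i x (Y x) (\<nabla> v Z x)"
proof -
  have "pd M i (\<lambda>y. g i y (Y y) (Z y)) x v =
    dg x v (Y x) (Z x) + g i x (pd M i Y x v) (Z x) + g i x (Y x) (pd M i Z x v)"
    by (rule pd_apply2) (use assms bilinear_g sm_metric in auto)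
  then show ?thesis
    by (simp add: levi_civita_metric[OF assms(3)] nabla_def bilinear_simps[OF bilinear_g[OF assms(3)]])
qed

lemma nabla_apply:
  assumes A: "\<And>x. x \<in> dom \<Longrightarrow> linear (A i x)" "\<And>v. sm (\<lambda>x. A i x v)" and Y: "sm Y" and x: "x \<in> dom"
  shows "\<nabla> v (\<lambda>y. A i y (Y y)) x = A i x (\<nabla> v Y x) + nabla_endo M g A i x v (Y x)"
  using pd_apply[of "A i", OF A Y x] linear_add[OF A(1)[OF x]]
  by (simp add: nabla_endo_def nabla_def)

lemma curvature_eq:
  "curvature M g i x u v w = pd M i (\<lambda>y. \<Gamma> y v w) x u - pd M i (\<lambda>y. \<Gamma> y u w) x v
    + \<Gamma> x u (\<Gamma> x v w) - \<Gamma> x v (\<Gamma> x u w)"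
  by (simp add: curvature_def nabla_def[abs_def])

text \<open>The second derivatives of \<open>Y\<close> cancel because mixed derivatives commute, and the terms with one derivative of \<open>Y\<close>
  are symmetric in \<open>u\<close> and \<open>v\<close>. Hence the curvature computed on constant fields acts on all fields.\<close>
lemma nabla_commutator:
  assumes Y: "sm Y" and x: "x \<in> dom"
  shows "\<nabla> u (\<nabla> v Y) x - \<nabla> v (\<nabla> u Y) x = curvature M g i x u v (Y x)"
proof -
  note b = bilinear_simps[OF levi_civita_bilinear[OF x]]
  have "pd M i (\<lambda>y. \<Gamma> y v (Y y)) x u = pd M i (\<lambda>y. \<Gamma> y v (Y x)) x u + \<Gamma> x v (pd M i Y x u)" for u v
    by (rule pd_apply) (use levi_civita_bilinear Y x in \<open>auto simp: bilinear_def sm_levi_civita\<close>)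
  then have "\<nabla> u (\<nabla> v Y) x = pd M i (\<lambda>y. pd M i Y y v) x u + pd M i (\<lambda>y. \<Gamma> y v (Y x)) x u
      + \<Gamma> x v (pd M i Y x u) + \<Gamma> x u (pd M i Y x v) + \<Gamma> x u (\<Gamma> x v (Y x))" for u v
    using pd_add[OF sm_pd[OF Y] sm_levi_civita'[OF sm_const Y] x, of v v u]
    by (simp add: nabla_def[abs_def] b)
  then show ?thesis
    using pd_commute[OF Y x, of u v] by (simp add: curvature_eq)
qed

lemma curvature_linear:
  assumes x: "x \<in> dom"
  shows "linear (\<lambda>u. curvature M g i x u v w)" "linear (\<lambda>v. curvature M g i x u v w)"
    "linear (\<lambda>w. curvature M g i x u v w)"
proof -
  note b = levi_civita_bilinear[unfolded bilinear_def]
  have l: "linear (\<Gamma> x u)" "linear (\<lambda>v. \<Gamma> x v w)" if "x \<in> dom" for x u w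
    using b that by blast+
  have p: "linear (\<lambda>u. pd M i (\<lambda>y. \<Gamma> y v w) x u)" "linear (\<lambda>w. pd M i (\<lambda>y. \<Gamma> y v w) x u)"
    "linear (\<lambda>v. pd M i (\<lambda>y. \<Gamma> y v w) x u)" for u v w
    by (rule linear_pd linear_pd_field[where A = "\<lambda>y. \<Gamma> y v"] linear_pd_field[where A = "\<lambda>y v. \<Gamma> y v w"];
      use x l sm_levi_civita in blast)+
  note c = linear_compose'[OF l(1)[OF x]] linear_compose'[OF l(2)[OF x]]
  show "linear (\<lambda>u. curvature M g i x u v w)" "linear (\<lambda>v. curvature M g i x u v w)"
    "linear (\<lambda>w. curvature M g i x u v w)"
    unfolding curvature_eq by (intro linear_compose_add linear_compose_sub p l x c)+
qed

lemma curvature_skew: "curvature M g i x u v w = - curvature M g i x v u w"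
  by (simp add: curvature_def)

lemma curvature_bianchi:
  assumes x: "x \<in> dom"
  shows "curvature M g i x u v w + curvature M g i x v w u + curvature M g i x w u v = 0"
proof -
  have "pd M i (\<lambda>y. \<Gamma> y v w) x u = pd M i (\<lambda>y. \<Gamma> y w v) x u" for u v w
    by (rule pd_cong[OF x]) (rule levi_civita_sym)
  from this[of w v u] this[of v u w] this[of w u v] show ?thesis
    using levi_civita_sym[OF x, of w v] levi_civita_sym[OF x, of v u] levi_civita_sym[OF x, of w u]
    by (simp add: curvature_eq)
qed

text \<open>Differentiate \<open>g w z\<close> twice and antisymmetrise: the second derivatives and the mixed terms cancel.\<close>
lemma curvature_metric:
  assumes x: "x \<in> dom"
  shows "g i x (curvature M g i x u v w) z = - g i x (curvature M g i x u v z) w"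
proof -
  interpret g: scalar_product "g i x" by (rule scalar_product[OF x])
  have d: "dg y v w z = g i y (\<nabla> v (\<lambda>_. w) y) z + g i y w (\<nabla> v (\<lambda>_. z) y)" if "y \<in> dom" for v y
    using nabla_metric[OF sm_const sm_const that] by simp
  have s: "sm (\<lambda>y. g i y (Y y) (Z y))" if "sm Y" "sm Z" for Y Z
    by (rule sm_apply2) (use that bilinear_g sm_metric in auto)
  have "pd M i (\<lambda>y. dg y v w z) x u =
      g i x (\<nabla> u (\<nabla> v (\<lambda>_. w)) x) z + g i x (\<nabla> v (\<lambda>_. w) x) (\<nabla> u (\<lambda>_. z) x)
      + (g i x (\<nabla> u (\<lambda>_. w) x) (\<nabla> v (\<lambda>_. z) x) + g i x w (\<nabla> u (\<nabla> v (\<lambda>_. z)) x))" for u v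
  proof -
    have "pd M i (\<lambda>y. dg y v w z) x u =
        pd M i (\<lambda>y. g i y (\<nabla> v (\<lambda>_. w) y) z + g i y w (\<nabla> v (\<lambda>_. z) y)) x u"
      by (rule pd_cong[OF x d])
    also have "\<dots> = pd M i (\<lambda>y. g i y (\<nabla> v (\<lambda>_. w) y) z) x u + pd M i (\<lambda>y. g i y w (\<nabla> v (\<lambda>_. z) y)) x u"
      by (rule pd_add[OF _ _ x]) (rule s; simp add: sm_nabla)+
    also have "\<dots> = g i x (\<nabla> u (\<nabla> v (\<lambda>_. w)) x) z + g i x (\<nabla> v (\<lambda>_. w) x) (\<nabla> u (\<lambda>_. z) x)
      + (g i x (\<nabla> u (\<lambda>_. w) x) (\<nabla> v (\<lambda>_. z) x) + g i x w (\<nabla> u (\<nabla> v (\<lambda>_. z)) x))"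
      using nabla_metric[OF sm_nabla sm_const x] nabla_metric[OF sm_const sm_nabla x] by simp
    finally show ?thesis .
  qed
  from this[of v u] this[of u v] have
    "g i x (\<nabla> u (\<nabla> v (\<lambda>_. w)) x - \<nabla> v (\<nabla> u (\<lambda>_. w)) x) z = - g i x w (\<nabla> u (\<nabla> v (\<lambda>_. z)) x - \<nabla> v (\<nabla> u (\<lambda>_. z)) x)"
    using pd_commute[OF sm_metric[of w z] x, of v u] by (simp add: g.simps)
  then show ?thesis
    by (simp add: curvature_def g.sym[of w])
qed

end

section \<open>Quaternionic linear algebra\<close>

locale quaternionic_space =
  fixes I J K :: "'e::euclidean_space \<Rightarrow> 'e"
  assumes linI: "linear I" and linJ: "linear J" and linK: "linear K"
    and II: "I (I v) = - v" and JJ: "J (J v) = - v" and KK: "K (K v) = - v"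
    and IJK: "I (J (K v)) = - v"
begin

lemmas lin_simps = linear_add[OF linI] linear_diff[OF linI] linear_neg[OF linI] linear_scale[OF linI] linear_0[OF linI]
  linear_add[OF linJ] linear_diff[OF linJ] linear_neg[OF linJ] linear_scale[OF linJ] linear_0[OF linJ]
  linear_add[OF linK] linear_diff[OF linK] linear_neg[OF linK] linear_scale[OF linK] linear_0[OF linK]

lemma IJ: "I (J v) = K v"
  using IJK[of "K v"] by (simp add: KK lin_simps)

lemma JK: "J (K v) = I v"
  using IJK[of v] II[of "J (K v)"] by (simp add: lin_simps)

lemma IK: "I (K v) = - J v"
  using IJ[of v] II[of "J v"] by simp

lemma KJ: "K (J v) = - I v"
  using IJ[of "J v"] by (simp add: JJ lin_simps)

lemma JI: "J (I v) = - K v"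
  using JJ[of "K v"] by (simp add: JK)

lemma KI: "K (I v) = J v"
  using KK[of "J v"] by (simp add: KJ lin_simps)

lemmas quat = II JJ KK IJ JK KI JI KJ IK

lemma cyclic: "quaternionic_space J K I"
  by (rule quaternionic_space.intro) (rule linI linJ linK | simp add: quat)+

end

locale hermitian_space = scalar_product B + quaternionic_space I J K
  for B :: "'e::euclidean_space \<Rightarrow> 'e \<Rightarrow> real" and I J K +
  assumes orthI: "B (I v) (I w) = B v w" and orthJ: "B (J v) (J w) = B v w"
    and orthK: "B (K v) (K w) = B v w"
begin

lemma skewI: "B v (I w) = - B (I v) w"
  using orthI[of v "I w"] by (simp add: II simps)

lemma skewJ: "B v (J w) = - B (J v) w"
  using orthJ[of v "J w"] by (simp add: JJ simps)

lemma skewK: "B v (K w) = - B (K v) w"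
  using orthK[of v "K w"] by (simp add: KK simps)

lemma null_pairs: "B (I v) v = 0" "B (J v) v = 0" "B (K v) v = 0"
  using skewI[of v v] skewJ[of v v] skewK[of v v] sym[of v] by auto

lemma hermitian_cyclic: "hermitian_space B J K I"
proof -
  interpret c: quaternionic_space J K I by (rule cyclic)
  show ?thesis
    by unfold_locales (rule orthI orthJ orthK)+
qed

lemma traces: "lin_trace I = 0" "lin_trace J = 0" "lin_trace K = 0"
proof -
  have *: "lin_trace f = 0" if f: "linear f" "\<And>v w. B v (f w) = - B (f v) w" for f
  proof -
    have "lin_trace f = lin_trace (\<lambda>v. - f v)"
      by (rule lin_trace_transpose) (use f in \<open>auto simp: simps intro: linear_compose_neg\<close>)
    then show ?thesis by (simp add: lin_trace_minus)
  qed
  show "lin_trace I = 0" "lin_trace J = 0" "lin_trace K = 0"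
    by (rule *; use linI linJ linK skewI skewJ skewK in blast)+
qed

lemma nonnull_vector: obtains w where "B w w \<noteq> 0"
proof (rule ccontr)
  assume "\<not> thesis"
  then have 0: "B w w = 0" for w
    using that by blast
  have "B v w = 0" for v w
    using 0[of "v + w"] 0[of v] 0[of w] sym[of v w] by (simp add: simps)
  then have "v = 0" for v
    using nondegenerate by blast
  moreover obtain b :: 'e where "b \<in> Basis"
    using nonempty_Basis by blast
  ultimately show False
    using nonzero_Basis by blast
qed

end

section \<open>Algebraic curvature tensors of quaternionic Kaehler type\<close>

text \<open>The forms \<open>A, B, C\<close> are the components of the curvature of the bundle spanned by \<open>I, J, K\<close>. They are cyclically
  interchangeable, and identities are derived for \<open>I\<close> and transferred to \<open>J\<close> and \<open>K\<close> by reinterpretation.\<close>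
locale qk_curvature = hermitian_space g I J K
  for g :: "'e::euclidean_space \<Rightarrow> 'e \<Rightarrow> real" and I J K +
  fixes R :: "'e \<Rightarrow> 'e \<Rightarrow> 'e \<Rightarrow> 'e" and A B C :: "'e \<Rightarrow> 'e \<Rightarrow> real"
  assumes linR1: "linear (\<lambda>u. R u v w)" and linR3: "linear (R u v)"
    and R_skew: "R u v w = - R v u w"
    and R_bianchi: "R u v w + R v w u + R w u v = 0"
    and R_metric: "g (R u v w) z = - g (R u v z) w"
    and linA: "linear (\<lambda>u. A u v)" and linB: "linear (\<lambda>u. B u v)" and linC: "linear (\<lambda>u. C u v)"
    and A_skew: "A u v = - A v u" and B_skew: "B u v = - B v u" and C_skew: "C u v = - C v u"
    and RI: "R u v (I w) = I (R u v w) + C u v *\<^sub>R J w - B u v *\<^sub>R K w"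
    and RJ: "R u v (J w) = J (R u v w) + A u v *\<^sub>R K w - C u v *\<^sub>R I w"
    and RK: "R u v (K w) = K (R u v w) + B u v *\<^sub>R I w - A u v *\<^sub>R J w"
begin

lemma qk_cyclic: "qk_curvature g J K I R B C A"
proof -
  show ?thesis
    by (rule qk_curvature.intro[OF hermitian_cyclic qk_curvature_axioms.intro]) (fact linR1 linR3 R_skew R_bianchi R_metric linA linB linC A_skew B_skew C_skew RI RJ RK)+
qed

text \<open>The sum of the four Bianchi identities on the faces of the usual octahedron.\<close>
lemma pair_symmetry: "g (R u v w) z = g (R w z u) v"
proof -
  have b: "g (R u v w) z + g (R v w u) z + g (R w u v) z = 0" for u v w z
    using arg_cong[OF R_bianchi[of u v w], of "\<lambda>X. g X z"] by (simp add: simps)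
  have s: "g (R u v w) z = - g (R v u w) z" for u v w z
    using arg_cong[OF R_skew[of u v w], of "\<lambda>X. g X z"] by (simp add: simps)
  show ?thesis
    using b[of u v w z] b[of v w z u] b[of w z u v] b[of z u v w]
      R_metric[of u v w z] R_metric[of v w u z] R_metric[of w u v z] R_metric[of v w z u]
      R_metric[of w z v u] R_metric[of z v w u] R_metric[of w z u v] R_metric[of z u w v]
      R_metric[of u w z v] R_metric[of z u v w] R_metric[of u v z w] R_metric[of v z u w]
      s[of u w z v] s[of z v w u] s[of v z u w] s[of w u v z]
    by linarith
qed

definition ric :: "'e \<Rightarrow> 'e \<Rightarrow> real" where
  "ric v w = lin_trace (\<lambda>u. R u v w)"

text \<open>The trace of \<open>I\<close> against the curvature, contracted over a position that the first Bianchi identity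
  can move.\<close>
definition tI :: "'e \<Rightarrow> 'e \<Rightarrow> real" where
  "tI v w = lin_trace (\<lambda>u. I (R u v w))"

lemma transpose_R: "g (R u v w) z = g u (R z w v)"
  using pair_symmetry[of u v w z] R_metric[of w z u v] R_skew[of w z v] sym[of u] by (simp add: simps)

lemma ric_sym: "ric v w = ric w v"
  unfolding ric_def by (rule lin_trace_transpose) (use linR1 transpose_R in auto)

lemma tI_skew: "tI v w = - tI w v"
proof -
  have "tI v w = lin_trace (\<lambda>z. - R (I z) w v)"
    unfolding tI_def
  proof (rule lin_trace_transpose)
    show "linear (\<lambda>z. - R (I z) w v)"
      by (intro linear_compose_neg linear_compose'[OF linR1 linI])
    show "g (I (R u v w)) z = g u (- R (I z) w v)" for u z
      using skewI[of "R u v w" z] transpose_R[of u v w "I z"] by (simp add: simps)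
  qed
  also have "\<dots> = - tI w v"
    using lin_trace_commute[OF linI linR1, of w v] by (simp add: lin_trace_minus tI_def)
  finally show ?thesis .
qed

lemma trace_I_R: "lin_trace (\<lambda>w. I (R u v w)) = 2 * tI v u"
proof -
  have "I (R u v w) = I (R w v u) - I (R w u v)" for w
  proof -
    have "R u v w = R w v u - R w u v"
      using R_bianchi[of u v w] R_skew[of v w u] by (simp add: algebra_simps eq_neg_iff_add_eq_0)
    then show ?thesis by (simp add: lin_simps)
  qed
  then show ?thesis
    using tI_skew[of u v] by (simp add: lin_trace_diff flip: tI_def)
qed

text \<open>Multiply \<open>[R, J] = A K - C I\<close> by \<open>K\<close> and take the trace; both products with \<open>R\<close> on the left-hand side have
  the trace of \<open>I R\<close> up to sign, and \<open>J\<close> has trace \<open>0\<close>.\<close>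
lemma trace_I_R_A: "2 * lin_trace (\<lambda>w. I (R u v w)) = - DIM('e) * A u v"
proof -
  have "K (R u v (J w)) = - I (R u v w) - A u v *\<^sub>R w - C u v *\<^sub>R J w" for w
    by (simp add: RJ lin_simps quat)
  then have "lin_trace (\<lambda>w. K (R u v (J w))) =
      - lin_trace (\<lambda>w. I (R u v w)) - A u v * DIM('e) - C u v * lin_trace J"
    by (simp add: lin_trace_diff lin_trace_minus lin_trace_scaleR lin_trace_id)
  moreover have "lin_trace (\<lambda>w. K (R u v (J w))) = lin_trace (\<lambda>w. I (R u v w))"
    using lin_trace_commute[OF linear_compose'[OF linK linR3] linJ, of u v] by (simp add: quat)
  ultimately show ?thesis
    by (simp add: traces mult.commute)
qed

lemma tI_A: "4 * tI v u = - DIM('e) * A u v"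
  using trace_I_R[of u v] trace_I_R_A[of u v] by simp

text \<open>Moving \<open>I\<close> through the curvature in \<open>tI\<close> turns that trace into a Ricci curvature plus two rank-one terms.\<close>
lemma ric_A: "4 * ric v u = DIM('e) * A (I u) v + 4 * B (J u) v + 4 * C (K u) v"
proof -
  have "ric v (I (I u)) = tI v (I u) + C (J (I u)) v - B (K (I u)) v"
    unfolding ric_def tI_def RI[of _ _ "I u"]
    by (simp add: lin_trace_add lin_trace_diff lin_trace_rank_one linB linC)
  moreover have "ric v (- u) = - ric v u"
    unfolding ric_def using linear_neg[OF linR3] by (simp add: lin_trace_minus)
  moreover have "C (- K u) v = - C (K u) v"
    using linear_neg[OF linC] by simp
  ultimately show ?thesis
    using tI_A[of v "I u"] by (simp add: quat)
qed

end

locale qk_curvature8 = qk_curvature g I J K R A B C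
  for g :: "'e::euclidean_space \<Rightarrow> 'e \<Rightarrow> real" and I J K R A B C +
  fixes m :: real
  assumes dim: "DIM('e) > 4" and m: "m = (real DIM('e) + 8) / 4"
begin

lemma dim': "real DIM('e) > 4"
  using dim by simp

lemma m_pos: "m > 0"
  using dim' by (simp add: m)

text \<open>The three expressions for the Ricci tensor obtained by permuting \<open>I, J, K\<close> cyclically agree only
  if their three summands do; this is where the dimension must exceed four.\<close>
lemma A_eq_ric:
  shows "m * A (I u) v = ric v u" "m * B (J u) v = ric v u" "m * C (K u) v = ric v u"
proof -
  interpret c: qk_curvature g J K I R B C A by (rule qk_cyclic)
  interpret cc: qk_curvature g K I J R C A B by (rule c.qk_cyclic)
  have *: "4 * ric v u = DIM('e) * A (I u) v + 4 * B (J u) v + 4 * C (K u) v"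
    "4 * ric v u = DIM('e) * B (J u) v + 4 * C (K u) v + 4 * A (I u) v"
    "4 * ric v u = DIM('e) * C (K u) v + 4 * A (I u) v + 4 * B (J u) v"
    using ric_A[of v u] c.ric_A[of v u] cc.ric_A[of v u]
    by (simp_all add: ric_def c.ric_def cc.ric_def)
  have "(real DIM('e) - 4) * (A (I u) v - B (J u) v) = 0" "(real DIM('e) - 4) * (B (J u) v - C (K u) v) = 0"
    using *(1,2,3) by (simp_all add: algebra_simps)
  then have "A (I u) v = B (J u) v" "B (J u) v = C (K u) v"
    using dim' by auto
  with *(1) show "m * A (I u) v = ric v u" "m * B (J u) v = ric v u" "m * C (K u) v = ric v u"
    by (simp_all add: field_simps m)
qed

lemma ric_neg: "ric v (- u) = - ric v u"
  unfolding ric_def using linear_neg[OF linR3] by (simp add: lin_trace_minus)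

lemma ABC_ric: "m * A u v = - ric v (I u)" "m * B u v = - ric v (J u)" "m * C u v = - ric v (K u)"
  using A_eq_ric(1)[of "- I u" v] A_eq_ric(2)[of "- J u" v] A_eq_ric(3)[of "- K u" v]
  by (simp_all add: lin_simps quat ric_neg)

lemma ric_hermitian: "ric (I v) u = - ric v (I u)" "ric (J v) u = - ric v (J u)" "ric (K v) u = - ric v (K u)"
  using ABC_ric[of u v] ABC_ric[of v u] A_skew[of u v] B_skew[of u v] C_skew[of u v]
    ric_sym[of u "I v"] ric_sym[of u "J v"] ric_sym[of u "K v"]
  by (simp_all)

lemma A_C_J: "A (J u) (J v) = - A u v" "C (J u) (J v) = - C u v"
proof -
  have "m * A (J u) (J v) = m * (- A u v)" "m * C (J u) (J v) = m * (- C u v)"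
    using ABC_ric(1)[of u v] ABC_ric(3)[of u v]
    by (simp_all add: ABC_ric quat ric_hermitian ric_neg)
  then show "A (J u) (J v) = - A u v" "C (J u) (J v) = - C u v"
    using m_pos by (simp_all only: mult_left_cancel[of m] less_irrefl)
qed

lemma R_JJ: "g (R u v (J w)) (J z) = g (R u v w) z - A u v * g (I w) z - C u v * g (K w) z"
  by (simp add: RJ simps skewJ quat lin_simps)

text \<open>The curvature on four vectors rotated by \<open>J\<close> can be computed by first rotating either pair of arguments;
  pair symmetry makes the two results comparable.\<close>
lemma A_C_exchange: "A u v * g (I w) z + C u v * g (K w) z = A w z * g (I u) v + C w z * g (K u) v"
proof -
  have 1: "g (R (J u) (J v) (J w)) (J z) =
      g (R u v w) z - A w z * g (I u) v - C w z * g (K u) v + A u v * g (I w) z + C u v * g (K w) z"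
    for u v w z
    using R_JJ[of "J u" "J v" w z] pair_symmetry[of "J u" "J v" w z] R_JJ[of w z u v] pair_symmetry[of u v w z]
    by (simp add: A_C_J)
  show ?thesis
    using 1[of u v w z] 1[of w z u v] pair_symmetry[of "J u" "J v" "J w" "J z"] pair_symmetry[of u v w z]
    by simp
qed

text \<open>For a nonnull \<open>w\<close> the choice \<open>z = I w\<close> in the exchange relation removes the terms with \<open>C\<close>: the value
  \<open>C w (I w)\<close> is a multiple of \<open>ric w (J w)\<close>, which vanishes because the Ricci tensor is symmetric and Hermitian.\<close>
lemma A_proportional: obtains k where "\<And>u v. A u v = k * g (I u) v"
proof -
  obtain w where w: "g w w \<noteq> 0" by (rule nonnull_vector)
  have "g (K w) (I w) = 0"
    using null_pairs(2)[of w] by (simp add: skewI quat simps)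
  moreover have "C w (I w) = 0"
  proof -
    have "ric (I w) (K w) = ric w (J w)"
      by (simp add: ric_hermitian quat ric_neg)
    moreover have "ric w (J w) = 0"
      using ric_hermitian(2)[of w w] ric_sym[of w "J w"] by simp
    ultimately show ?thesis
      using ABC_ric(3)[of w "I w"] m_pos by (simp)
  qed
  ultimately have "A u v * g w w = A w (I w) * g (I u) v" for u v
    using A_C_exchange[of u v w "I w"] by (simp add: orthI)
  then have "A u v = A w (I w) / g w w * g (I u) v" for u v
    using w by (simp add: field_simps)
  then show thesis by (rule that)
qed

text \<open>As \<open>A\<close> is a multiple of the fundamental form, the Ricci tensor is a multiple of the metric (the metric is
  Einstein), and the trace of the Ricci tensor identifies the factor.\<close>
theorem A_scalar_curvature:
  fixes n :: real
  defines "n \<equiv> DIM('e) / 4"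
  defines "\<nu> \<equiv> lin_trace (\<lambda>v. sharp g (ric v)) / (4 * n * (n + 2))"
  shows "A u v = - \<nu> * g (I u) v"
proof -
  obtain k where k: "\<And>u v. A u v = k * g (I u) v"
    by (rule A_proportional) blast
  have "ric v u = - m * k * g v u" for u v
    using A_eq_ric(1)[of u v] sym[of u v] by (simp add: k quat simps)
  then have "sharp g (ric v) = (- m * k) *\<^sub>R v" for v
    by (intro sharp_eqI) (simp add: simps)
  then have "lin_trace (\<lambda>v. sharp g (ric v)) = - m * k * DIM('e)"
    using lin_trace_scaleR[of "- m * k" "\<lambda>v::'e. v"] by (simp add: lin_trace_id)
  moreover have "4 * n * (n + 2) = m * DIM('e)"
    by (simp add: n_def m field_simps)
  ultimately have "\<nu> = - k"
    using dim' m_pos unfolding \<nu>_def by simp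
  then show ?thesis by (simp add: k)
qed

end

section \<open>One-forms on a quaternionic vector space\<close>

context quaternionic_space
begin

text \<open>The form \<open>(1 + L) (\<phi> \<otimes> \<phi>)\<close>.\<close>
definition Q :: "('e \<Rightarrow> real) \<Rightarrow> 'e \<Rightarrow> 'e \<Rightarrow> real" where
  "Q \<phi> v w = \<phi> v * \<phi> w + \<phi> (I v) * \<phi> (I w) + \<phi> (J v) * \<phi> (J w) + \<phi> (K v) * \<phi> (K w)"

text \<open>This tensor will be the difference between the Obata connection, which is torsion-free and leaves \<open>I, J, K\<close>
  parallel, and the Levi-Civita connection of a quaternionic Kaehler metric with Lee form \<open>\<phi>\<close>. In both directions of
  the correspondence one metric has the Obata connection as its Levi-Civita connection.\<close>
definition S :: "('e \<Rightarrow> real) \<Rightarrow> 'e \<Rightarrow> 'e \<Rightarrow> 'e" where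
  "S \<phi> u v = - (1/2) *\<^sub>R (\<phi> u *\<^sub>R v + \<phi> v *\<^sub>R u - \<phi> (I u) *\<^sub>R I v - \<phi> (I v) *\<^sub>R I u
     - \<phi> (J u) *\<^sub>R J v - \<phi> (J v) *\<^sub>R J u - \<phi> (K u) *\<^sub>R K v - \<phi> (K v) *\<^sub>R K u)"

lemma Q_sym: "Q \<phi> v w = Q \<phi> w v"
  by (simp add: Q_def)

lemma S_sym: "S \<phi> u v = S \<phi> v u"
  by (simp add: S_def algebra_simps)

context
  fixes \<phi> :: "'e \<Rightarrow> real"
  assumes lin: "linear \<phi>"
begin

lemmas form_simps = linear_add[OF lin] linear_diff[OF lin] linear_neg[OF lin]
  linear_scale[OF lin, unfolded real_scaleR_def] linear_0[OF lin]

lemma Q_bilinear: "bilinear (Q \<phi>)"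
  by (intro bilinearI linearI) (simp_all add: Q_def form_simps lin_simps algebra_simps)

lemma Q_hermitian: "Q \<phi> (I v) (I w) = Q \<phi> v w" "Q \<phi> (J v) (J w) = Q \<phi> v w" "Q \<phi> (K v) (K w) = Q \<phi> v w"
  by (simp_all add: Q_def quat form_simps)

lemma S_bilinear: "bilinear (S \<phi>)"
  by (intro bilinearI linearI) (simp_all add: S_def form_simps lin_simps algebra_simps)

lemma S_commutator:
  "S \<phi> u (I v) - I (S \<phi> u v) = \<phi> (K u) *\<^sub>R J v - \<phi> (J u) *\<^sub>R K v"
  "S \<phi> u (J v) - J (S \<phi> u v) = \<phi> (I u) *\<^sub>R K v - \<phi> (K u) *\<^sub>R I v"
  "S \<phi> u (K v) - K (S \<phi> u v) = \<phi> (J u) *\<^sub>R I v - \<phi> (I u) *\<^sub>R J v"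
  unfolding S_def by (simp_all add: form_simps lin_simps quat scaleR_diff_right scaleR_add_right)
    (simp_all add: algebra_simps flip: scaleR_left_distrib)

end

end

context hermitian_space
begin

context
  fixes \<phi> :: "'e \<Rightarrow> real" and \<xi> :: 'e
  assumes lin: "linear \<phi>" and \<xi>: "\<And>w. B \<xi> w = \<phi> w"
begin

lemma form_orthogonal: "\<phi> (I \<xi>) = 0" "\<phi> (J \<xi>) = 0" "\<phi> (K \<xi>) = 0"
  using null_pairs[of \<xi>] sym[of \<xi>] by (simp_all flip: \<xi>)

lemma Q_dual: "Q \<phi> v \<xi> = \<phi> v * \<phi> \<xi>"
  by (simp add: Q_def form_orthogonal)

text \<open>The combination sends the dual vector \<open>\<xi>\<close> to \<open>(a \<bar>\<phi>\<bar>\<^sup>2 + b) \<phi>\<close>. A null direction is therefore killed by \<open>\<phi>\<close>, by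
  invariance also by \<open>\<phi> \<circ> I\<close>, \<open>\<phi> \<circ> J\<close>, \<open>\<phi> \<circ> K\<close>, and then only the nondegenerate form \<open>b B\<close> remains.\<close>
lemma hermitian_combination:
  assumes b: "b \<noteq> 0" and ab: "a * \<phi> \<xi> + b \<noteq> 0"
  shows "hermitian_space (\<lambda>v w. a * Q \<phi> v w + b * B v w) I J K"
proof -
  let ?B = "\<lambda>v w. a * Q \<phi> v w + b * B v w"
  note q = bilinear_simps[OF Q_bilinear[OF lin]]
  have herm: "?B (I v) (I w) = ?B v w" "?B (J v) (J w) = ?B v w" "?B (K v) (K w) = ?B v w" for v w
    by (simp_all add: Q_hermitian lin orthI orthJ orthK)
  have sp: "scalar_product ?B"
  proof
    show "bilinear ?B"
      by (intro bilinearI linearI) (simp_all add: q simps algebra_simps)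
    show "?B v w = ?B w v" for v w
      using Q_sym[of \<phi> v w] sym[of v w] by simp
    fix v assume 0: "\<And>w. ?B v w = 0"
    have z: "\<phi> v = 0" if "\<And>w. ?B v w = 0" for v
    proof -
      have "(a * \<phi> \<xi> + b) * \<phi> v = ?B v \<xi>"
        by (simp add: Q_dual sym[of v] \<xi> algebra_simps)
      then show ?thesis using that ab by simp
    qed
    have "?B (I v) w = - ?B v (I w)" "?B (J v) w = - ?B v (J w)" "?B (K v) w = - ?B v (K w)" for w
      using herm(1)[of v "I w"] herm(2)[of v "J w"] herm(3)[of v "K w"] by (simp_all add: quat simps q)
    then have "\<phi> v = 0" "\<phi> (I v) = 0" "\<phi> (J v) = 0" "\<phi> (K v) = 0"
      using 0 by (intro z; simp)+
    then have "B v w = 0" for w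
      using 0[of w] b by (simp add: Q_def)
    then show "v = 0" by (rule nondegenerate)
  qed
  show ?thesis
    by (rule hermitian_space.intro[OF sp quaternionic_space_axioms hermitian_space_axioms.intro]) (rule herm)+
qed

lemma combination_dual:
  assumes b: "b \<noteq> 0" and ab: "a * \<phi> \<xi> + b \<noteq> 0"
  shows "sharp (\<lambda>v w. a * Q \<phi> v w + b * B v w) (\<lambda>w. c * \<phi> w) = (c / (a * \<phi> \<xi> + b)) *\<^sub>R \<xi>"
proof -
  interpret h: hermitian_space "\<lambda>v w. a * Q \<phi> v w + b * B v w" I J K
    by (rule hermitian_combination[OF b ab])
  have "a * Q \<phi> \<xi> w + b * B \<xi> w = (a * \<phi> \<xi> + b) * \<phi> w" for w
    using Q_sym[of \<phi> \<xi> w] by (simp add: Q_dual \<xi> algebra_simps)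
  then show ?thesis
    using ab by (intro h.sharp_eqI) (simp only: h.simps, simp)
qed

end

end

section \<open>Covariant derivatives of one-forms\<close>

context metric_chart
begin

definition cov :: "('a \<Rightarrow> 'e \<Rightarrow> real) \<Rightarrow> 'a \<Rightarrow> 'e \<Rightarrow> 'e \<Rightarrow> real" where
  "cov \<phi> x u v = pd M i (\<lambda>y. \<phi> y v) x u - \<phi> x (\<Gamma> x u v)"

context
  fixes \<phi> :: "'a \<Rightarrow> 'e \<Rightarrow> real"
  assumes lin_form: "\<And>x. x \<in> dom \<Longrightarrow> linear (\<phi> x)" and sm_form: "\<And>v. sm (\<lambda>x. \<phi> x v)"
begin

lemma pd_form:
  assumes "sm Y" "x \<in> dom"
  shows "pd M i (\<lambda>y. \<phi> y (Y y)) x u = cov \<phi> x u (Y x) + \<phi> x (\<nabla> u Y x)"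
  using pd_apply[of \<phi>, OF lin_form sm_form assms] linear_add[OF lin_form[OF assms(2)]]
  by (simp add: cov_def nabla_def)

lemma cov_bilinear:
  assumes x: "x \<in> dom"
  shows "bilinear (cov \<phi> x)"
proof -
  have l: "linear (\<Gamma> x u)" "linear (\<lambda>u. \<Gamma> x u v)" for u v
    using levi_civita_bilinear[OF x] by (simp_all add: bilinear_def)
  show ?thesis
    unfolding cov_def
    by (intro bilinearI linear_compose_sub linear_pd[OF sm_form x] linear_pd_field[OF lin_form sm_form x]
        linear_compose'[OF lin_form[OF x] l(1)] linear_compose'[OF lin_form[OF x] l(2)])
qed

lemma sm_dual: "sm (\<lambda>x. sharp (g i x) (\<phi> x))"
  by (rule sm_sharp) (rule lin_form sm_form; assumption)+

text \<open>The covariant derivative of the dual vector field is dual to the covariant derivative of the form.\<close>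
lemma pd_norm:
  assumes x: "x \<in> dom"
  shows "pd M i (\<lambda>y. g i y (sharp (g i y) (\<phi> y)) (sharp (g i y) (\<phi> y))) x u
    = 2 * cov \<phi> x u (sharp (g i x) (\<phi> x))"
proof -
  let ?\<xi> = "\<lambda>y. sharp (g i y) (\<phi> y)"
  have sharp: "g i y (?\<xi> y) w = \<phi> y w" if "y \<in> dom" for y w
    using scalar_product.sharp[OF scalar_product lin_form] that by blast
  have "g i x (\<nabla> u ?\<xi> x) w = cov \<phi> x u w" for w
  proof -
    have "pd M i (\<lambda>y. \<phi> y w) x u = pd M i (\<lambda>y. g i y (?\<xi> y) w) x u"
      by (rule pd_cong[OF x]) (simp add: sharp)
    also have "\<dots> = g i x (\<nabla> u ?\<xi> x) w + g i x (?\<xi> x) (\<nabla> u (\<lambda>_. w) x)"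
      by (rule nabla_metric[OF sm_dual sm_const x])
    finally show ?thesis
      by (simp add: cov_def nabla_const sharp[OF x])
  qed
  then show ?thesis
    using nabla_metric[OF sm_dual sm_dual x] scalar_product.sym[OF scalar_product[OF x], of "?\<xi> x"] by simp
qed

end

end

section \<open>Hyper-Hermitian charts\<close>

locale hyperhermitian_chart = metric_chart M i g
  for M :: "('a, 'i, 'e::euclidean_space) manifold" and i g +
  fixes I J K :: "('a, 'i, 'e) endo"
  assumes hermitian: "\<And>x. x \<in> dom \<Longrightarrow> hermitian_space (g i x) (I i x) (J i x) (K i x)"
    and sm_I: "\<And>v. sm (\<lambda>x. I i x v)" and sm_J: "\<And>v. sm (\<lambda>x. J i x v)" and sm_K: "\<And>v. sm (\<lambda>x. K i x v)"
begin

lemma quaternionic: "x \<in> dom \<Longrightarrow> quaternionic_space (I i x) (J i x) (K i x)"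
  using hermitian hermitian_space.axioms(2) by blast

lemmas linI = quaternionic_space.linI[OF quaternionic]
lemmas linJ = quaternionic_space.linJ[OF quaternionic]
lemmas linK = quaternionic_space.linK[OF quaternionic]

lemma hyperhermitian_cyclic: "hyperhermitian_chart M i g J K I"
  by (rule hyperhermitian_chart.intro[OF metric_chart_axioms hyperhermitian_chart_axioms.intro])
    (rule hermitian_space.hermitian_cyclic[OF hermitian] sm_I sm_J sm_K; assumption)+

lemma sm_I': "sm Y \<Longrightarrow> sm (\<lambda>y. I i y (Y y))"
  by (rule sm_apply[OF linI sm_I])

lemma sm_J': "sm Y \<Longrightarrow> sm (\<lambda>y. J i y (Y y))"
  by (rule sm_apply[OF linJ sm_J])

lemma sm_K': "sm Y \<Longrightarrow> sm (\<lambda>y. K i y (Y y))"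
  by (rule sm_apply[OF linK sm_K])

context
  fixes \<phi> :: "'a \<Rightarrow> 'e \<Rightarrow> real"
  assumes lin_form: "\<forall>x\<in>dom. linear (\<phi> x)" and sm_form: "\<forall>v. sm (\<lambda>x. \<phi> x v)"
begin

abbreviation Q_field where "Q_field x \<equiv> quaternionic_space.Q (I i x) (J i x) (K i x) (\<phi> x)"

lemma sm_form_along: "sm Y \<Longrightarrow> sm (\<lambda>x. \<phi> x (Y x))"
  by (rule sm_apply) (use lin_form sm_form in auto)

lemma sm_Q: "sm (\<lambda>x. Q_field x v w)"
proof (rule sm_cong)
  show "sm (\<lambda>x. \<phi> x v * \<phi> x w + \<phi> x (I i x v) * \<phi> x (I i x w) + \<phi> x (J i x v) * \<phi> x (J i x w)
      + \<phi> x (K i x v) * \<phi> x (K i x w))"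
    by (intro sm_add sm_mult sm_form_along sm_I sm_J sm_K sm_const)
  show "\<phi> x v * \<phi> x w + \<phi> x (I i x v) * \<phi> x (I i x w) + \<phi> x (J i x v) * \<phi> x (J i x w)
      + \<phi> x (K i x v) * \<phi> x (K i x w) = Q_field x v w" if "x \<in> dom" for x
    by (rule quaternionic_space.Q_def[OF quaternionic[OF that], symmetric])
qed

lemma pd_Q:
  assumes x: "x \<in> dom"
  shows "pd M i (\<lambda>y. Q_field y v w) x u =
    \<phi> x v * pd M i (\<lambda>y. \<phi> y w) x u + pd M i (\<lambda>y. \<phi> y v) x u * \<phi> x w
    + (\<phi> x (I i x v) * pd M i (\<lambda>y. \<phi> y (I i y w)) x u + pd M i (\<lambda>y. \<phi> y (I i y v)) x u * \<phi> x (I i x w))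
    + (\<phi> x (J i x v) * pd M i (\<lambda>y. \<phi> y (J i y w)) x u + pd M i (\<lambda>y. \<phi> y (J i y v)) x u * \<phi> x (J i x w))
    + (\<phi> x (K i x v) * pd M i (\<lambda>y. \<phi> y (K i y w)) x u + pd M i (\<lambda>y. \<phi> y (K i y v)) x u * \<phi> x (K i x w))"
proof -
  have "pd M i (\<lambda>y. Q_field y v w) x u = pd M i (\<lambda>x. \<phi> x v * \<phi> x w + \<phi> x (I i x v) * \<phi> x (I i x w)
      + \<phi> x (J i x v) * \<phi> x (J i x w) + \<phi> x (K i x v) * \<phi> x (K i x w)) x u"
    by (rule pd_cong[OF x]) (rule quaternionic_space.Q_def[OF quaternionic])
  then show ?thesis
    by (simp add: pd_add pd_mult sm_add sm_mult sm_form sm_form_along sm_I sm_J sm_K x)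
qed

end

end

text \<open>The derivatives of \<open>I, J, K\<close> have this special form when the three structures are integrable and span a parallel
  bundle; the one-form \<open>\<phi>\<close> is then necessarily the Lee form of each of them.\<close>
locale lee_chart = hyperhermitian_chart M i g I J K
  for M :: "('a, 'i, 'e::euclidean_space) manifold" and i g I J K +
  fixes \<phi> :: "'a \<Rightarrow> 'e \<Rightarrow> real"
  assumes lin_\<phi>: "\<And>x. x \<in> dom \<Longrightarrow> linear (\<phi> x)" and sm_\<phi>: "\<And>v. sm (\<lambda>x. \<phi> x v)"
    and nabla_I: "\<And>x z v. x \<in> dom \<Longrightarrow> nabla_endo M g I i x z v =
      \<phi> x (J i x z) *\<^sub>R K i x v - \<phi> x (K i x z) *\<^sub>R J i x v"
    and nabla_J: "\<And>x z v. x \<in> dom \<Longrightarrow> nabla_endo M g J i x z v =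
      \<phi> x (K i x z) *\<^sub>R I i x v - \<phi> x (I i x z) *\<^sub>R K i x v"
    and nabla_K: "\<And>x z v. x \<in> dom \<Longrightarrow> nabla_endo M g K i x z v =
      \<phi> x (I i x z) *\<^sub>R J i x v - \<phi> x (J i x z) *\<^sub>R I i x v"
begin

lemma lee_cyclic: "lee_chart M i g J K I \<phi>"
  by (rule lee_chart.intro[OF hyperhermitian_cyclic lee_chart_axioms.intro])
    (rule lin_\<phi> sm_\<phi> nabla_I nabla_J nabla_K; assumption)+

lemma sm_\<phi>': "sm Y \<Longrightarrow> sm (\<lambda>y. \<phi> y (Y y))"
  by (rule sm_apply[OF lin_\<phi> sm_\<phi>])

lemmas sm_all = sm_\<phi>' sm_I' sm_J' sm_K' sm_nabla sm_const

abbreviation hess where "hess \<equiv> cov \<phi>"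

lemma nabla_IY:
  assumes "sm Y" "x \<in> dom"
  shows "\<nabla> u (\<lambda>y. I i y (Y y)) x =
    I i x (\<nabla> u Y x) + \<phi> x (J i x u) *\<^sub>R K i x (Y x) - \<phi> x (K i x u) *\<^sub>R J i x (Y x)"
  using nabla_apply[where A = I, OF linI sm_I assms] by (simp add: nabla_I assms)

lemma pd_\<phi>: "sm Y \<Longrightarrow> x \<in> dom \<Longrightarrow> pd M i (\<lambda>y. \<phi> y (Y y)) x u = hess x u (Y x) + \<phi> x (\<nabla> u Y x)"
  by (rule pd_form[OF lin_\<phi> sm_\<phi>])

lemma pd_\<phi>I:
  assumes "x \<in> dom"
  shows "pd M i (\<lambda>y. \<phi> y (I i y v)) x u = hess x u (I i x v) + \<phi> x (I i x (\<Gamma> x u v))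
    + \<phi> x (J i x u) * \<phi> x (K i x v) - \<phi> x (K i x u) * \<phi> x (J i x v)"
  by (simp add: pd_\<phi> sm_all nabla_IY nabla_const assms linear_add[OF lin_\<phi>] linear_diff[OF lin_\<phi>]
      linear_scale[OF lin_\<phi>])

text \<open>The curvature form \<open>d\<alpha> + \<beta> \<and> \<gamma>\<close> of the bundle spanned by \<open>I, J, K\<close>, where \<open>\<alpha> = - \<phi> \<circ> I\<close>,
  \<open>\<beta> = - \<phi> \<circ> J\<close>, \<open>\<gamma> = - \<phi> \<circ> K\<close>.\<close>
definition bundle_curvature :: "'a \<Rightarrow> 'e \<Rightarrow> 'e \<Rightarrow> real" where
  "bundle_curvature x u v = pd M i (\<lambda>y. \<phi> y (I i y u)) x v - pd M i (\<lambda>y. \<phi> y (I i y v)) x u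
     + \<phi> x (J i x u) * \<phi> x (K i x v) - \<phi> x (J i x v) * \<phi> x (K i x u)"

lemma bundle_curvature_eq:
  assumes x: "x \<in> dom"
  shows "bundle_curvature x u v = hess x v (I i x u) - hess x u (I i x v)
     + \<phi> x (J i x v) * \<phi> x (K i x u) - \<phi> x (J i x u) * \<phi> x (K i x v)"
  by (simp add: bundle_curvature_def pd_\<phi>I[OF x] levi_civita_sym[OF x, of v u])

lemma bundle_curvature_skew: "bundle_curvature x u v = - bundle_curvature x v u"
  by (simp add: bundle_curvature_def)

lemma bundle_curvature_linear:
  assumes x: "x \<in> dom"
  shows "linear (\<lambda>u. bundle_curvature x u v)"
  unfolding bundle_curvature_eq[OF x]
proof -
  interpret quaternionic_space "I i x" "J i x" "K i x" by (rule quaternionic[OF x])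
  note c = bilinear_simps[OF cov_bilinear[OF lin_\<phi> sm_\<phi> x]]
  note p = linear_add[OF lin_\<phi>[OF x]] linear_scale[OF lin_\<phi>[OF x]]
  show "linear (\<lambda>u. hess x v (I i x u) - hess x u (I i x v)
     + \<phi> x (J i x v) * \<phi> x (K i x u) - \<phi> x (J i x u) * \<phi> x (K i x v))"
    by (rule linearI) (simp_all add: lin_simps c p algebra_simps)
qed

end

context lee_chart
begin

text \<open>Differentiate the formula for \<open>\<nabla>I\<close> once more and antisymmetrise.\<close>
lemma curvature_I:
  assumes x: "x \<in> dom"
  shows "curvature M g i x u v (I i x w) = I i x (curvature M g i x u v w)
    + lee_chart.bundle_curvature M i K I J \<phi> x u v *\<^sub>R J i x w
    - lee_chart.bundle_curvature M i J K I \<phi> x u v *\<^sub>R K i x w"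
proof -
  interpret j: lee_chart M i g J K I \<phi> by (rule lee_cyclic)
  interpret k: lee_chart M i g K I J \<phi> by (rule j.lee_cyclic)
  interpret q: quaternionic_space "I i x" "J i x" "K i x" by (rule quaternionic[OF x])
  note l = linear_add[OF linI[OF x]] linear_diff[OF linI[OF x]]
  let ?W = "\<lambda>v. \<nabla> v (\<lambda>_. w)"
  have 1: "\<nabla> v (\<lambda>y. I i y w) y =
      I i y (?W v y) + \<phi> y (J i y v) *\<^sub>R K i y w - \<phi> y (K i y v) *\<^sub>R J i y w" if "y \<in> dom" for v y
    using nabla_IY[OF sm_const that] .
  have 2: "\<nabla> u (\<nabla> v (\<lambda>y. I i y w)) x =
      I i x (\<nabla> u (?W v) x) + \<phi> x (J i x u) *\<^sub>R K i x (?W v x) - \<phi> x (K i x u) *\<^sub>R J i x (?W v x)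
      + (\<phi> x (J i x v) *\<^sub>R (K i x (?W u x) + \<phi> x (I i x u) *\<^sub>R J i x w - \<phi> x (J i x u) *\<^sub>R I i x w)
          + pd M i (\<lambda>y. \<phi> y (J i y v)) x u *\<^sub>R K i x w)
      - (\<phi> x (K i x v) *\<^sub>R (J i x (?W u x) + \<phi> x (K i x u) *\<^sub>R I i x w - \<phi> x (I i x u) *\<^sub>R K i x w)
          + pd M i (\<lambda>y. \<phi> y (K i y v)) x u *\<^sub>R J i x w)" for u v
  proof -
    have "\<nabla> u (\<nabla> v (\<lambda>y. I i y w)) x = \<nabla> u (\<lambda>y. I i y (?W v y) + \<phi> y (J i y v) *\<^sub>R K i y w
        - \<phi> y (K i y v) *\<^sub>R J i y w) x"
      by (rule nabla_cong[OF x 1])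
    also have "\<dots> = \<nabla> u (\<lambda>y. I i y (?W v y)) x + \<nabla> u (\<lambda>y. \<phi> y (J i y v) *\<^sub>R K i y w) x
        - \<nabla> u (\<lambda>y. \<phi> y (K i y v) *\<^sub>R J i y w) x"
      by (simp add: nabla_add nabla_diff x sm_add sm_scaleR sm_all)
    also have "\<nabla> u (\<lambda>y. I i y (?W v y)) x =
        I i x (\<nabla> u (?W v) x) + \<phi> x (J i x u) *\<^sub>R K i x (?W v x) - \<phi> x (K i x u) *\<^sub>R J i x (?W v x)"
      by (rule nabla_IY[OF _ x]) (intro sm_all)
    also have "\<nabla> u (\<lambda>y. \<phi> y (J i y v) *\<^sub>R K i y w) x =
        \<phi> x (J i x v) *\<^sub>R (K i x (?W u x) + \<phi> x (I i x u) *\<^sub>R J i x w - \<phi> x (J i x u) *\<^sub>R I i x w)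
          + pd M i (\<lambda>y. \<phi> y (J i y v)) x u *\<^sub>R K i x w"
      by (simp add: nabla_scaleR x sm_all k.nabla_IY)
    also have "\<nabla> u (\<lambda>y. \<phi> y (K i y v) *\<^sub>R J i y w) x =
        \<phi> x (K i x v) *\<^sub>R (J i x (?W u x) + \<phi> x (K i x u) *\<^sub>R I i x w - \<phi> x (I i x u) *\<^sub>R K i x w)
          + pd M i (\<lambda>y. \<phi> y (K i y v)) x u *\<^sub>R J i x w"
      by (simp add: nabla_scaleR x sm_all j.nabla_IY)
    finally show ?thesis .
  qed
  have 3: "\<nabla> u (?W v) x = curvature M g i x u v w + \<nabla> v (?W u) x"
    by (simp add: curvature_def)
  show ?thesis
    by (subst nabla_commutator[OF sm_I x, symmetric])
      (simp add: 2[of u v] 2[of v u] 3 l j.bundle_curvature_def k.bundle_curvature_def algebra_simps)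
qed

text \<open>The symmetries of the curvature tensor, the first Bianchi identity and the cyclic versions of the commutator
  identity for \<open>I\<close> are exactly the hypotheses of the pointwise algebraic result on curvature tensors of
  quaternionic Kaehler type.\<close>
theorem bundle_curvature_scalar:
  assumes x: "x \<in> dom" and dim: "DIM('e) > 4"
  shows "bundle_curvature x u v = - reduced_scalar_curvature M g i x * g i x (I i x u) v"
proof -
  interpret j: lee_chart M i g J K I \<phi> by (rule lee_cyclic)
  interpret k: lee_chart M i g K I J \<phi> by (rule j.lee_cyclic)
  interpret h: hermitian_space "g i x" "I i x" "J i x" "K i x" by (rule hermitian[OF x])
  let ?R = "curvature M g i x"
  interpret R: qk_curvature8 "g i x" "I i x" "J i x" "K i x" ?R "bundle_curvature x"
    "j.bundle_curvature x" "k.bundle_curvature x" "(real DIM('e) + 8) / 4"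
  proof (rule qk_curvature8.intro[OF qk_curvature.intro[OF hermitian[OF x] qk_curvature_axioms.intro]
        qk_curvature8_axioms.intro])
    show "linear (\<lambda>u. ?R u v w)" "linear (?R u v)" for u v w
      using curvature_linear[OF x] by blast+
    show "?R u v w = - ?R v u w" "?R u v w + ?R v w u + ?R w u v = 0" for u v w
      using curvature_skew curvature_bianchi[OF x] by blast+
    show "g i x (?R u v w) z = - g i x (?R u v z) w" for u v w z
      by (rule curvature_metric[OF x])
    show "linear (\<lambda>u. bundle_curvature x u v)" "linear (\<lambda>u. j.bundle_curvature x u v)"
      "linear (\<lambda>u. k.bundle_curvature x u v)" for v
      by (rule bundle_curvature_linear[OF x] j.bundle_curvature_linear[OF x] k.bundle_curvature_linear[OF x])+
    show "bundle_curvature x u v = - bundle_curvature x v u" "j.bundle_curvature x u v = - j.bundle_curvature x v u"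
      "k.bundle_curvature x u v = - k.bundle_curvature x v u" for u v
      by (rule bundle_curvature_skew j.bundle_curvature_skew k.bundle_curvature_skew)+
    show "?R u v (I i x w) = I i x (?R u v w) + k.bundle_curvature x u v *\<^sub>R J i x w
        - j.bundle_curvature x u v *\<^sub>R K i x w" for u v w
      by (rule curvature_I[OF x])
    show "?R u v (J i x w) = J i x (?R u v w) + bundle_curvature x u v *\<^sub>R K i x w
        - k.bundle_curvature x u v *\<^sub>R I i x w" for u v w
      by (rule j.curvature_I[OF x])
    show "?R u v (K i x w) = K i x (?R u v w) + j.bundle_curvature x u v *\<^sub>R I i x w
        - bundle_curvature x u v *\<^sub>R J i x w" for u v w
      by (rule k.curvature_I[OF x])
    show "DIM('e) > 4" "(real DIM('e) + 8) / 4 = (real DIM('e) + 8) / 4"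
      using dim by simp_all
  qed
  show ?thesis
    using R.A_scalar_curvature[of u v]
    by (simp add: reduced_scalar_curvature_def scalar_curvature_def ricci_def[abs_def] R.ric_def[abs_def] Let_def)
qed

end

section \<open>The Lee form of a hypercomplex quaternionic Kaehler structure\<close>

text \<open>The algebra at one point: \<open>D1 z\<close>, \<open>D2 z\<close>, \<open>D3 z\<close> stand for the covariant derivatives of \<open>I, J, K\<close> in the
  direction \<open>z\<close>.\<close>
locale quaternionic_derivation = hermitian_space B I J K
  for B :: "'e::euclidean_space \<Rightarrow> 'e \<Rightarrow> real" and I J K +
  fixes D1 D2 D3 :: "'e \<Rightarrow> 'e \<Rightarrow> 'e"
  assumes lin1: "linear (\<lambda>z. D1 z v)" and lin2: "linear (\<lambda>z. D2 z v)" and lin3: "linear (\<lambda>z. D3 z v)"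
    and par1: "\<exists>a b c. \<forall>v. D1 z v = a *\<^sub>R I v + b *\<^sub>R J v + c *\<^sub>R K v"
    and par2: "\<exists>a b c. \<forall>v. D2 z v = a *\<^sub>R I v + b *\<^sub>R J v + c *\<^sub>R K v"
    and par3: "\<exists>a b c. \<forall>v. D3 z v = a *\<^sub>R I v + b *\<^sub>R J v + c *\<^sub>R K v"
    and square1: "D1 z (I v) = - I (D1 z v)" and square2: "D2 z (J v) = - J (D2 z v)"
    and square3: "D3 z (K v) = - K (D3 z v)"
    and product: "D3 z v = D1 z (J v) + I (D2 z v)"
    and nijenhuis1: "D1 (I v) w - D1 (I w) v + I (D1 w v) - I (D1 v w) = 0"
    and nijenhuis2: "D2 (J v) w - D2 (J w) v + J (D2 w v) - J (D2 v w) = 0"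
    and nijenhuis3: "D3 (K v) w - D3 (K w) v + K (D3 w v) - K (D3 v w) = 0"
begin

lemma trace_combination:
  "lin_trace (\<lambda>v. a *\<^sub>R v + b *\<^sub>R I v + c *\<^sub>R J v + d *\<^sub>R K v) = a * DIM('e)"
  by (simp add: lin_trace_add lin_trace_scaleR lin_trace_id traces)

text \<open>Composition with \<open>1, I, J, K\<close> followed by the trace isolates the four coefficients.\<close>
lemma combination_zero:
  assumes "\<And>v. a *\<^sub>R v + b *\<^sub>R I v + c *\<^sub>R J v + d *\<^sub>R K v = 0"
  shows "a = 0" "b = 0" "c = 0" "d = 0"
proof -
  have z: "lin_trace (\<lambda>v::'e. 0::'e) = 0"
    by (simp add: lin_trace_def)
  have *: "a = 0" if "\<And>v. a *\<^sub>R v + b *\<^sub>R I v + c *\<^sub>R J v + d *\<^sub>R K v = 0" for a b c d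
    using trace_combination[of a b c d] z by (simp add: that)
  show "a = 0" by (rule *[OF assms])
  show "b = 0"
    by (rule *[of b "-a" "-d" c]) (use assms[of "- I v" for v :: 'e] in \<open>simp add: lin_simps quat algebra_simps\<close>)
  show "c = 0"
    by (rule *[of c d "-a" "-b"]) (use assms[of "- J v" for v :: 'e] in \<open>simp add: lin_simps quat algebra_simps\<close>)
  show "d = 0"
    by (rule *[of d "-c" b "-a"]) (use assms[of "- K v" for v :: 'e] in \<open>simp add: lin_simps quat algebra_simps\<close>)
qed

definition \<alpha> where "\<alpha> z = - lin_trace (\<lambda>v. K (D2 z v)) / DIM('e)"
definition \<beta> where "\<beta> z = - lin_trace (\<lambda>v. I (D3 z v)) / DIM('e)"
definition \<gamma> where "\<gamma> z = - lin_trace (\<lambda>v. J (D1 z v)) / DIM('e)"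

lemma linear_coefficients: "linear \<alpha>" "linear \<beta>" "linear \<gamma>"
proof -
  have "linear (\<lambda>z. - lin_trace (\<lambda>v. L (D z v)) / DIM('e))"
    if "linear L" "\<And>v. linear (\<lambda>z. D z v)" for L :: "'e \<Rightarrow> 'e" and D :: "'e \<Rightarrow> 'e \<Rightarrow> 'e"
    by (rule linearI)
      (simp_all add: linear_add[OF that(2)] linear_scale[OF that(2)] linear_add[OF that(1)] linear_scale[OF that(1)]
        lin_trace_add lin_trace_scaleR diff_divide_distrib add_divide_distrib)
  from this[OF linK lin2] this[OF linI lin3] this[OF linJ lin1]
  show "linear \<alpha>" "linear \<beta>" "linear \<gamma>"
    by (simp_all add: \<alpha>_def[abs_def] \<beta>_def[abs_def] \<gamma>_def[abs_def])
qed

text \<open>Differentiating \<open>I\<^sup>2 = - 1\<close> removes the component of \<open>\<nabla>I\<close> along \<open>I\<close>, and differentiating \<open>K = I J\<close> relates the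
  remaining six components in pairs.\<close>
lemma derivatives:
  "D1 z v = \<gamma> z *\<^sub>R J v - \<beta> z *\<^sub>R K v"
  "D2 z v = \<alpha> z *\<^sub>R K v - \<gamma> z *\<^sub>R I v"
  "D3 z v = \<beta> z *\<^sub>R I v - \<alpha> z *\<^sub>R J v"
proof -
  obtain a1 b1 c1 where 1: "\<And>v. D1 z v = a1 *\<^sub>R I v + b1 *\<^sub>R J v + c1 *\<^sub>R K v"
    using par1 by blast
  obtain a2 b2 c2 where 2: "\<And>v. D2 z v = a2 *\<^sub>R I v + b2 *\<^sub>R J v + c2 *\<^sub>R K v"
    using par2 by blast
  obtain a3 b3 c3 where 3: "\<And>v. D3 z v = a3 *\<^sub>R I v + b3 *\<^sub>R J v + c3 *\<^sub>R K v"
    using par3 by blast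
  have "a1 *\<^sub>R v + a1 *\<^sub>R v = 0" for v :: 'e
    using square1[of z v] by (simp add: 1 lin_simps quat algebra_simps)
  then have "(a1 + a1) *\<^sub>R v + 0 *\<^sub>R I v + 0 *\<^sub>R J v + 0 *\<^sub>R K v = 0" for v :: 'e
    by (simp only: scaleR_add_left scaleR_zero_left add_0_right)
  from combination_zero(1)[OF this] have a1: "a1 = 0" by simp
  have "b2 *\<^sub>R v + b2 *\<^sub>R v = 0" for v :: 'e
    using square2[of z v] by (simp add: 2 lin_simps quat algebra_simps)
  then have "(b2 + b2) *\<^sub>R v + 0 *\<^sub>R I v + 0 *\<^sub>R J v + 0 *\<^sub>R K v = 0" for v :: 'e
    by (simp only: scaleR_add_left scaleR_zero_left add_0_right)
  from combination_zero(1)[OF this] have b2: "b2 = 0" by simp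
  have "c3 *\<^sub>R v + c3 *\<^sub>R v = 0" for v :: 'e
    using square3[of z v] by (simp add: 3 lin_simps quat algebra_simps)
  then have "(c3 + c3) *\<^sub>R v + 0 *\<^sub>R I v + 0 *\<^sub>R J v + 0 *\<^sub>R K v = 0" for v :: 'e
    by (simp only: scaleR_add_left scaleR_zero_left add_0_right)
  from combination_zero(1)[OF this] have c3: "c3 = 0" by simp
  have "(b1 + a2) *\<^sub>R v + (a3 + c1) *\<^sub>R I v + (b3 + c2) *\<^sub>R J v + 0 *\<^sub>R K v = 0" for v
    using product[of z v] by (simp add: 1 2 3 a1 b2 c3 lin_simps quat algebra_simps)
  note r = combination_zero[OF this]
  have "\<alpha> z = c2"
    using trace_combination[of "- c2" 0 a2 0] by (simp add: \<alpha>_def 2 b2 lin_simps quat)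
  moreover have "\<beta> z = a3"
    using trace_combination[of "- a3" 0 0 b3] by (simp add: \<beta>_def 3 c3 lin_simps quat)
  moreover have "\<gamma> z = b1"
    using trace_combination[of "- b1" c1 0 0] by (simp add: \<gamma>_def 1 a1 lin_simps quat add.commute)
  moreover have "a2 = - b1" "a3 = - c1" "b3 = - c2"
    using r by auto
  ultimately show
    "D1 z v = \<gamma> z *\<^sub>R J v - \<beta> z *\<^sub>R K v"
    "D2 z v = \<alpha> z *\<^sub>R K v - \<gamma> z *\<^sub>R I v"
    "D3 z v = \<beta> z *\<^sub>R I v - \<alpha> z *\<^sub>R J v"
    by (simp_all add: 1 2 3 a1 b2 c3)
qed

text \<open>Contracting \<open>J\<close> times the Nijenhuis tensor of \<open>I\<close> in its second argument leaves a multiple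
  of \<open>\<gamma> \<circ> I - \<beta>\<close>.\<close>
lemma integrability:
  assumes dim: "DIM('e) > 4"
  shows "\<beta> v = \<gamma> (I v)" "\<gamma> v = \<alpha> (J v)" "\<alpha> v = \<beta> (K v)"
proof -
  have d: "real DIM('e) > 2"
    using dim by simp
  note l = linear_neg[OF linear_coefficients(1)] linear_neg[OF linear_coefficients(2)]
    linear_neg[OF linear_coefficients(3)]
  note lc = linear_compose'[OF linear_coefficients(1)] linear_compose'[OF linear_coefficients(2)]
    linear_compose'[OF linear_coefficients(3)]
  note r = lin_trace_add lin_trace_diff lin_trace_minus lin_trace_scaleR lin_trace_id traces
  have z: "lin_trace (\<lambda>v::'e. 0::'e) = 0"
    by (simp add: lin_trace_def)
  have eq: "t = 0" if "real DIM('e) * t = 2 * t" for t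
    using that d by simp
  have "lin_trace (\<lambda>w. J (D1 (I v) w - D1 (I w) v + I (D1 w v) - I (D1 v w))) = 0"
    by (simp add: nijenhuis1 lin_simps z)
  then have "lin_trace (\<lambda>w. (\<beta> v - \<gamma> (I v)) *\<^sub>R w + (- \<beta> (I v) - \<gamma> v) *\<^sub>R I w
      + (\<gamma> (I w) *\<^sub>R v - \<beta> w *\<^sub>R v) + (\<beta> (I w) *\<^sub>R I v + \<gamma> w *\<^sub>R I v)) = 0"
    by (simp add: derivatives lin_simps quat algebra_simps)
  then have "real DIM('e) * (\<beta> v - \<gamma> (I v)) = 2 * (\<beta> v - \<gamma> (I v))"
    by (simp add: r lin_trace_rank_one linear_coefficients lc linI quat l algebra_simps)
  from eq[OF this] show "\<beta> v = \<gamma> (I v)" by simp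
  have "lin_trace (\<lambda>w. K (D2 (J v) w - D2 (J w) v + J (D2 w v) - J (D2 v w))) = 0"
    by (simp add: nijenhuis2 lin_simps z)
  then have "lin_trace (\<lambda>w. (\<gamma> v - \<alpha> (J v)) *\<^sub>R w + (- \<gamma> (J v) - \<alpha> v) *\<^sub>R J w
      + (\<alpha> (J w) *\<^sub>R v - \<gamma> w *\<^sub>R v) + (\<gamma> (J w) *\<^sub>R J v + \<alpha> w *\<^sub>R J v)) = 0"
    by (simp add: derivatives lin_simps quat algebra_simps)
  then have "real DIM('e) * (\<gamma> v - \<alpha> (J v)) = 2 * (\<gamma> v - \<alpha> (J v))"
    by (simp add: r lin_trace_rank_one linear_coefficients lc linJ quat l algebra_simps)
  from eq[OF this] show "\<gamma> v = \<alpha> (J v)" by simp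
  have "lin_trace (\<lambda>w. I (D3 (K v) w - D3 (K w) v + K (D3 w v) - K (D3 v w))) = 0"
    by (simp add: nijenhuis3 lin_simps z)
  then have "lin_trace (\<lambda>w. (\<alpha> v - \<beta> (K v)) *\<^sub>R w + (- \<alpha> (K v) - \<beta> v) *\<^sub>R K w
      + (\<beta> (K w) *\<^sub>R v - \<alpha> w *\<^sub>R v) + (\<alpha> (K w) *\<^sub>R K v + \<beta> w *\<^sub>R K v)) = 0"
    by (simp add: derivatives lin_simps quat algebra_simps)
  then have "real DIM('e) * (\<alpha> v - \<beta> (K v)) = 2 * (\<alpha> v - \<beta> (K v))"
    by (simp add: r lin_trace_rank_one linear_coefficients lc linK quat l algebra_simps)
  from eq[OF this] show "\<alpha> v = \<beta> (K v)" by simp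
qed

text \<open>Integrability expresses all three coefficient forms by one form \<open>\<phi>\<close>, and the trace that defines the Lee form
  returns \<open>\<phi>\<close> itself.\<close>
lemma lee_form_determines:
  assumes dim: "DIM('e) > 4"
  defines "\<phi> \<equiv> \<lambda>v. 1/2 * lin_trace (\<lambda>z. I (D1 z v))"
  shows "linear \<phi>"
    "D1 z v = \<phi> (J z) *\<^sub>R K v - \<phi> (K z) *\<^sub>R J v"
    "D2 z v = \<phi> (K z) *\<^sub>R I v - \<phi> (I z) *\<^sub>R K v"
    "D3 z v = \<phi> (I z) *\<^sub>R J v - \<phi> (J z) *\<^sub>R I v"
proof -
  have "lin_trace (\<lambda>z. I (D1 z v)) = \<gamma> (K v) + \<beta> (J v)" for v
    by (simp add: derivatives lin_simps quat lin_trace_add lin_trace_rank_one linear_coefficients)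
  moreover have "\<gamma> (K v) = \<alpha> (I v)" "\<beta> (J v) = \<alpha> (I v)" for v
    using integrability(2)[OF dim, of "K v"] integrability(1)[OF dim, of "J v"] by (simp_all add: quat)
  ultimately have \<phi>: "\<phi> v = \<alpha> (I v)" for v
    by (simp add: \<phi>_def)
  show "linear \<phi>"
    using linear_compose'[OF linear_coefficients(1) linI] by (simp add: \<phi>[abs_def])
  have "\<gamma> z = - \<phi> (K z)" "\<beta> z = - \<phi> (J z)" "\<alpha> z = - \<phi> (I z)" for z
    using integrability(2)[OF dim, of z] integrability(1)[OF dim, of z] integrability(2)[OF dim, of "I z"]
      linear_neg[OF linear_coefficients(1)] by (simp_all add: \<phi> quat)
  then show "D1 z v = \<phi> (J z) *\<^sub>R K v - \<phi> (K z) *\<^sub>R J v"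
    "D2 z v = \<phi> (K z) *\<^sub>R I v - \<phi> (I z) *\<^sub>R K v"
    "D3 z v = \<phi> (I z) *\<^sub>R J v - \<phi> (J z) *\<^sub>R I v"
    by (simp_all add: derivatives)
qed

end

context metric_chart
begin

context
  fixes A :: "('a, 'i, 'e) endo"
  assumes linA: "\<And>x. x \<in> dom \<Longrightarrow> linear (A i x)" and smA: "\<And>v. sm (\<lambda>x. A i x v)"
begin

lemma sm_nabla_endo: "sm (\<lambda>x. nabla_endo M g A i x z v)"
  unfolding nabla_endo_def
  by (rule sm_diff[OF sm_nabla[OF smA] sm_apply[where A = "A i", OF linA smA sm_nabla[OF sm_const]]])

lemma linear_nabla_endo: "x \<in> dom \<Longrightarrow> linear (\<lambda>z. nabla_endo M g A i x z v)"
  unfolding nabla_endo_def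
  by (intro linear_compose_sub linear_compose'[OF linA] linear_nabla_direction smA sm_const)

lemma nabla_endo_square:
  assumes sq: "\<And>x v. x \<in> dom \<Longrightarrow> A i x (A i x v) = - v" and x: "x \<in> dom"
  shows "nabla_endo M g A i x z (A i x v) = - A i x (nabla_endo M g A i x z v)"
proof -
  have "\<nabla> z (\<lambda>y. A i y (A i y v)) x = \<nabla> z (\<lambda>y. - v) x"
    by (rule nabla_cong[OF x]) (rule sq)
  then show ?thesis
    using nabla_apply[where A = A, OF linA smA smA x, of z v] nabla_apply[where A = A, OF linA smA sm_const x, of z v]
    by (simp add: nabla_const linear_add[OF linA[OF x]] sq[OF x] bilinear_simps[OF levi_civita_bilinear[OF x]]
        eq_neg_iff_add_eq_0 add.commute)
qed

text \<open>Partial derivatives may be replaced by covariant ones, because the Christoffel terms cancel by symmetry.\<close>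
lemma nijenhuis_nabla:
  assumes x: "x \<in> dom"
  shows "nijenhuis M A i x v w = nabla_endo M g A i x (A i x v) w - nabla_endo M g A i x (A i x w) v
    + A i x (nabla_endo M g A i x w v) - A i x (nabla_endo M g A i x v w)"
  using levi_civita_sym[OF x, of "A i x v" "A i x w"] levi_civita_sym[OF x, of w "A i x v"]
    levi_civita_sym[OF x, of v "A i x w"] levi_civita_sym[OF x, of v w]
  by (simp add: nijenhuis_def lie_bracket_def nabla_endo_def nabla_def linear_add[OF linA[OF x]]
      linear_diff[OF linA[OF x]] linear_neg[OF linA[OF x]] linear_0[OF linA[OF x]])

end

end

context hyperhermitian_chart
begin

lemma lee_chartI:
  assumes dim: "DIM('e) > 4"
    and par: "\<And>x z A. x \<in> dom \<Longrightarrow> A \<in> {I, J, K} \<Longrightarrow> nabla_endo M g A i x z \<in> endo_span I J K i x"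
    and nij: "\<And>x v w A. x \<in> dom \<Longrightarrow> A \<in> {I, J, K} \<Longrightarrow> nijenhuis M A i x v w = 0"
  shows "lee_chart M i g I J K (lee_form M g I i)"
proof -
  have D: "quaternionic_derivation (g i x) (I i x) (J i x) (K i x)
    (nabla_endo M g I i x) (nabla_endo M g J i x) (nabla_endo M g K i x)" if x: "x \<in> dom" for x
  proof (rule quaternionic_derivation.intro[OF hermitian[OF x] quaternionic_derivation_axioms.intro])
    interpret q: quaternionic_space "I i x" "J i x" "K i x" by (rule quaternionic[OF x])
    show "linear (\<lambda>z. nabla_endo M g I i x z v)" "linear (\<lambda>z. nabla_endo M g J i x z v)"
      "linear (\<lambda>z. nabla_endo M g K i x z v)" for v
      by (rule linear_nabla_endo[where A = I, OF linI sm_I x] linear_nabla_endo[where A = J, OF linJ sm_J x]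
        linear_nabla_endo[where A = K, OF linK sm_K x]; assumption)+
    show "\<exists>a b c. \<forall>v. nabla_endo M g I i x z v = a *\<^sub>R I i x v + b *\<^sub>R J i x v + c *\<^sub>R K i x v"
      "\<exists>a b c. \<forall>v. nabla_endo M g J i x z v = a *\<^sub>R I i x v + b *\<^sub>R J i x v + c *\<^sub>R K i x v"
      "\<exists>a b c. \<forall>v. nabla_endo M g K i x z v = a *\<^sub>R I i x v + b *\<^sub>R J i x v + c *\<^sub>R K i x v" for z
      using par[OF x, of I z] par[OF x, of J z] par[OF x, of K z] by (auto simp: endo_span_def fun_eq_iff)
    show "nabla_endo M g I i x z (I i x v) = - I i x (nabla_endo M g I i x z v)" for z v
      by (rule nabla_endo_square[where A = I, OF linI sm_I _ x]) (simp_all add: quaternionic_space.II[OF quaternionic])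
    show "nabla_endo M g J i x z (J i x v) = - J i x (nabla_endo M g J i x z v)" for z v
      by (rule nabla_endo_square[where A = J, OF linJ sm_J _ x]) (simp_all add: quaternionic_space.JJ[OF quaternionic])
    show "nabla_endo M g K i x z (K i x v) = - K i x (nabla_endo M g K i x z v)" for z v
      by (rule nabla_endo_square[where A = K, OF linK sm_K _ x]) (simp_all add: quaternionic_space.KK[OF quaternionic])
    show "nabla_endo M g K i x z v = nabla_endo M g I i x z (J i x v) + I i x (nabla_endo M g J i x z v)" for z v
    proof -
      have "\<nabla> z (\<lambda>y. K i y v) x = \<nabla> z (\<lambda>y. I i y (J i y v)) x"
        by (rule nabla_cong[OF x]) (simp add: quaternionic_space.IJ[OF quaternionic])
      then show ?thesis
        using nabla_apply[where A = I, OF linI sm_I sm_J x, of z v] nabla_apply[where A = J, OF linJ sm_J sm_const x, of z v]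
          nabla_apply[where A = K, OF linK sm_K sm_const x, of z v]
        by (simp add: q.quat q.lin_simps)
    qed
    show "nabla_endo M g I i x (I i x v) w - nabla_endo M g I i x (I i x w) v
       + I i x (nabla_endo M g I i x w v) - I i x (nabla_endo M g I i x v w) = 0" for v w
      using nij[OF x, of I] nijenhuis_nabla[where A = I, OF linI sm_I x] by simp
    show "nabla_endo M g J i x (J i x v) w - nabla_endo M g J i x (J i x w) v
       + J i x (nabla_endo M g J i x w v) - J i x (nabla_endo M g J i x v w) = 0" for v w
      using nij[OF x, of J] nijenhuis_nabla[where A = J, OF linJ sm_J x] by simp
    show "nabla_endo M g K i x (K i x v) w - nabla_endo M g K i x (K i x w) v
       + K i x (nabla_endo M g K i x w v) - K i x (nabla_endo M g K i x v w) = 0" for v w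
      using nij[OF x, of K] nijenhuis_nabla[where A = K, OF linK sm_K x] by simp
  qed
  note d = quaternionic_derivation.lee_form_determines[OF D dim, folded lee_form_def]
  show ?thesis
  proof (rule lee_chart.intro[OF hyperhermitian_chart_axioms lee_chart_axioms.intro])
    show "sm (\<lambda>x. lee_form M g I i x v)" for v
      unfolding lee_form_def
      by (intro sm_mult sm_const sm_lin_trace sm_I' sm_nabla_endo linI sm_I)
    show "linear (lee_form M g I i x)" if "x \<in> dom" for x
      using d(1)[OF that] by (simp add: lee_form_def[abs_def])
  qed (rule d(2-4); assumption)+
qed

end

section \<open>From quaternionic Kaehler to hyper-Kaehler metrics\<close>

locale closed_lee_chart = lee_chart M i g I J K \<phi>
  for M :: "('a, 'i, 'e::euclidean_space) manifold" and i g I J K \<phi> +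
  fixes \<nu> :: real
  assumes dim: "DIM('e) > 4"
    and closed: "\<And>x u v. x \<in> dom \<Longrightarrow> pd M i (\<lambda>y. \<phi> y v) x u = pd M i (\<lambda>y. \<phi> y u) x v"
    and \<nu>: "\<And>x. x \<in> dom \<Longrightarrow> reduced_scalar_curvature M g i x = \<nu>"
begin

lemma closed_cyclic: "closed_lee_chart M i g J K I \<phi> \<nu>"
  by (rule closed_lee_chart.intro[OF lee_cyclic closed_lee_chart_axioms.intro])
    (rule dim closed \<nu>; assumption)+

lemma hess_sym: "x \<in> dom \<Longrightarrow> hess x u v = hess x v u"
  by (simp add: cov_def closed[of x u v] levi_civita_sym[of x u v])

lemma hess_I:
  assumes x: "x \<in> dom"
  shows "hess x (I i x u) (I i x v) = - hess x u v + \<phi> x (J i x u) * \<phi> x (J i x v)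
    + \<phi> x (K i x u) * \<phi> x (K i x v) - \<nu> * g i x u v"
proof -
  interpret h: hermitian_space "g i x" "I i x" "J i x" "K i x" by (rule hermitian[OF x])
  show ?thesis
    using bundle_curvature_eq[OF x, of u "I i x v"] bundle_curvature_scalar[OF x dim, of u "I i x v"]
      hess_sym[OF x, of "I i x v" "I i x u"]
    by (simp add: \<nu>[OF x] h.orthI h.quat linear_neg[OF lin_\<phi>[OF x]]
        bilinear_simps[OF cov_bilinear[OF lin_\<phi> sm_\<phi> x]] algebra_simps)
qed

text \<open>The curvature equation prescribes the \<open>I\<close>-invariant part of \<open>\<nabla>\<phi>\<close>, and its cyclic variants prescribe the
  invariant parts for \<open>J\<close> and \<open>K\<close>. Together they determine \<open>\<nabla>\<phi>\<close>, since no nonzero bilinear form is anti-invariant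
  under \<open>I\<close>, \<open>J\<close> and \<open>K = I J\<close>.\<close>
lemma hess_eq:
  assumes x: "x \<in> dom"
  shows "hess x u v = 1/2 * (\<phi> x (I i x u) * \<phi> x (I i x v) + \<phi> x (J i x u) * \<phi> x (J i x v)
    + \<phi> x (K i x u) * \<phi> x (K i x v) - \<phi> x u * \<phi> x v - \<nu> * g i x u v)"
proof -
  interpret j: closed_lee_chart M i g J K I \<phi> \<nu> by (rule closed_cyclic)
  interpret k: closed_lee_chart M i g K I J \<phi> \<nu> by (rule j.closed_cyclic)
  interpret h: hermitian_space "g i x" "I i x" "J i x" "K i x" by (rule hermitian[OF x])
  have "hess x (I i x (J i x u)) (I i x (J i x v)) = hess x (K i x u) (K i x v)"
    by (simp add: h.quat)
  then show ?thesis
    using hess_I[OF x, of "J i x u" "J i x v"] j.hess_I[OF x, of u v] k.hess_I[OF x, of u v]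
    by (simp add: h.orthJ h.quat linear_neg[OF lin_\<phi>[OF x]])
qed

definition norm2 :: "'a \<Rightarrow> real" where
  "norm2 x = g i x (sharp (g i x) (\<phi> x)) (sharp (g i x) (\<phi> x))"

definition f :: "'a \<Rightarrow> real" where "f x = norm2 x + \<nu>"

lemma dual: "x \<in> dom \<Longrightarrow> g i x (sharp (g i x) (\<phi> x)) w = \<phi> x w"
  using scalar_product.sharp[OF scalar_product lin_\<phi>] by blast

lemma norm2_eq: "x \<in> dom \<Longrightarrow> norm2 x = \<phi> x (sharp (g i x) (\<phi> x))"
  by (simp add: norm2_def dual)

lemma sm_norm2: "sm norm2"
  unfolding norm2_def[abs_def]
  by (rule sm_apply2[where B = "g i", OF bilinear_g sm_metric sm_dual[OF lin_\<phi> sm_\<phi>] sm_dual[OF lin_\<phi> sm_\<phi>]])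

text \<open>The dual vector of \<open>\<phi>\<close> is annihilated by \<open>\<phi> \<circ> I\<close>, \<open>\<phi> \<circ> J\<close>, \<open>\<phi> \<circ> K\<close>, so that only two terms of \<open>\<nabla>\<phi>\<close> survive.\<close>
lemma pd_norm2:
  assumes x: "x \<in> dom"
  shows "pd M i norm2 x u = - f x * \<phi> x u"
proof -
  interpret h: hermitian_space "g i x" "I i x" "J i x" "K i x" by (rule hermitian[OF x])
  have "pd M i norm2 x u = 2 * hess x u (sharp (g i x) (\<phi> x))"
    unfolding norm2_def[abs_def] by (rule pd_norm[OF lin_\<phi> sm_\<phi> x])
  also have "\<dots> = - norm2 x * \<phi> x u - \<nu> * \<phi> x u"
    using h.form_orthogonal[OF lin_\<phi>[OF x] dual[OF x]] h.sym[of u "sharp (g i x) (\<phi> x)"]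
    by (simp add: hess_eq[OF x] norm2_eq[OF x] dual[OF x])
  finally show ?thesis by (simp add: f_def algebra_simps)
qed

lemma sm_f: "sm f"
  unfolding f_def[abs_def] by (intro sm_add sm_norm2 sm_const)

lemma pd_f: "x \<in> dom \<Longrightarrow> pd M i f x u = - f x * \<phi> x u"
  unfolding f_def[abs_def] using pd_add[OF sm_norm2 sm_const, of x \<nu> u]
  by (simp add: pd_norm2 f_def)

abbreviation Qx where "Qx x \<equiv> quaternionic_space.Q (I i x) (J i x) (K i x) (\<phi> x)"
abbreviation Sx where "Sx x \<equiv> quaternionic_space.S (I i x) (J i x) (K i x) (\<phi> x)"

end

locale to_hyperkaehler_chart = closed_lee_chart M i g I J K \<phi> \<nu>
  for M :: "('a, 'i, 'e::euclidean_space) manifold" and i g I J K \<phi> \<nu> +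
  fixes g0 :: "('a, 'i, 'e) form2"
  assumes \<nu>_nz: "\<And>x. x \<in> dom \<Longrightarrow> \<nu> \<noteq> 0" and f_nz: "\<And>x. x \<in> dom \<Longrightarrow> f x \<noteq> 0"
    and g0: "\<And>x v w. x \<in> dom \<Longrightarrow> g0 i x v w = 1 / \<nu>\<^sup>2 * f x * (Qx x v w + \<nu> * g i x v w)"
begin

lemma to_hyperkaehler_cyclic: "to_hyperkaehler_chart M i g J K I \<phi> \<nu> g0"
proof -
  interpret j: closed_lee_chart M i g J K I \<phi> \<nu> by (rule closed_cyclic)
  have "quaternionic_space.Q (J i x) (K i x) (I i x) (\<phi> x) = Qx x" if "x \<in> dom" for x
    using quaternionic_space.Q_def[OF quaternionic[OF that]] quaternionic_space.Q_def[OF j.quaternionic[OF that]]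
    by (simp add: fun_eq_iff)
  then show ?thesis
    using \<nu>_nz f_nz g0
    by (intro to_hyperkaehler_chart.intro[OF closed_cyclic to_hyperkaehler_chart_axioms.intro]) simp_all
qed

lemma g0_combination: "x \<in> dom \<Longrightarrow> g0 i x = (\<lambda>v w. (f x / \<nu>\<^sup>2) * Qx x v w + (f x / \<nu>) * g i x v w)"
  using \<nu>_nz[of x] by (intro ext) (simp add: g0 field_simps power2_eq_square)

lemma coefficients:
  assumes x: "x \<in> dom"
  shows "f x / \<nu> \<noteq> 0" "f x / \<nu>\<^sup>2 * \<phi> x (sharp (g i x) (\<phi> x)) + f x / \<nu> = (f x)\<^sup>2 / \<nu>\<^sup>2"
    "f x / \<nu>\<^sup>2 * \<phi> x (sharp (g i x) (\<phi> x)) + f x / \<nu> \<noteq> 0"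
proof -
  show 1: "f x / \<nu> \<noteq> 0" using \<nu>_nz[OF x] f_nz[OF x] by simp
  show 2: "f x / \<nu>\<^sup>2 * \<phi> x (sharp (g i x) (\<phi> x)) + f x / \<nu> = (f x)\<^sup>2 / \<nu>\<^sup>2"
    using \<nu>_nz[OF x] by (simp add: field_simps power2_eq_square norm2_eq[OF x] f_def)
  show "f x / \<nu>\<^sup>2 * \<phi> x (sharp (g i x) (\<phi> x)) + f x / \<nu> \<noteq> 0"
    unfolding 2 using \<nu>_nz[OF x] f_nz[OF x] by simp
qed

lemma hermitian0: "x \<in> dom \<Longrightarrow> hermitian_space (g0 i x) (I i x) (J i x) (K i x)"
  unfolding g0_combination
  by (rule hermitian_space.hermitian_combination[OF hermitian lin_\<phi> dual coefficients(1,3)])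

lemma form_assms: "\<forall>x\<in>dom. linear (\<phi> x)" "\<forall>v. sm (\<lambda>x. \<phi> x v)"
  using lin_\<phi> sm_\<phi> by auto

lemma sm_g0: "sm (\<lambda>x. g0 i x v w)"
  by (rule sm_cong[where f = "\<lambda>x. 1 / \<nu>\<^sup>2 * f x * (Qx x v w + \<nu> * g i x v w)"])
    (intro sm_mult sm_add sm_const sm_f sm_Q[OF form_assms] sm_metric, simp add: g0)

lemma hyperhermitian0: "hyperhermitian_chart M i g0 I J K"
proof (rule hyperhermitian_chart.intro[OF metric_chart.intro[OF chart_axioms metric_chart_axioms.intro]
      hyperhermitian_chart_axioms.intro])
  show "scalar_product (g0 i x)" if "x \<in> dom" for x
    using hermitian0[OF that] hermitian_space.axioms(1) by blast
qed (rule sm_g0 hermitian0 sm_I sm_J sm_K; assumption)+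

text \<open>This says that the Obata connection preserves \<open>f (Q + \<nu> g)\<close>, with the factor \<open>f\<close> divided out by means of
  \<open>df = - f \<phi>\<close>.\<close>
lemma metric_compatibility:
  assumes x: "x \<in> dom"
  shows "pd M i (\<lambda>y. Qx y v w) x u + \<nu> * dg x u v w - \<phi> x u * (Qx x v w + \<nu> * g i x v w) =
    Qx x (\<Gamma> x u v + Sx x u v) w + \<nu> * g i x (\<Gamma> x u v + Sx x u v) w
    + Qx x v (\<Gamma> x u w + Sx x u w) + \<nu> * g i x v (\<Gamma> x u w + Sx x u w)"
proof -
  interpret j: lee_chart M i g J K I \<phi> by (rule lee_cyclic)
  interpret k: lee_chart M i g K I J \<phi> by (rule j.lee_cyclic)
  interpret h: hermitian_space "g i x" "I i x" "J i x" "K i x" by (rule hermitian[OF x])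
  note p = h.form_simps[OF lin_\<phi>[OF x]]
  have s: "g i x v u = g i x u v" "g i x w u = g i x u w" "g i x w v = g i x v w"
    by (rule h.sym)+
  have sI: "g i x (A v) u = - g i x (A u) v" "g i x (A w) u = - g i x (A u) w" "g i x (A w) v = - g i x (A v) w"
    if "\<And>v w. g i x v (A w) = - g i x (A v) w" for A
    using that h.sym by metis+
  note c = sI[OF h.skewI] sI[OF h.skewJ] sI[OF h.skewK]
  show ?thesis
    unfolding pd_Q[OF form_assms x] pd_\<phi>I[OF x] j.pd_\<phi>I[OF x] k.pd_\<phi>I[OF x] levi_civita_metric[OF x]
      pd_\<phi>[OF sm_const x] nabla_const hess_eq[OF x] h.Q_def h.S_def
    by (simp add: p h.lin_simps h.quat h.simps h.skewI h.skewJ h.skewK s c) (simp add: field_simps)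
qed

lemma levi_civita0:
  assumes x: "x \<in> dom"
  shows "levi_civita M g0 i x = (\<lambda>u v. \<Gamma> x u v + Sx x u v)"
proof -
  interpret h0: hyperhermitian_chart M i g0 I J K by (rule hyperhermitian0)
  interpret q: quaternionic_space "I i x" "J i x" "K i x" by (rule quaternionic[OF x])
  show ?thesis
  proof (rule h0.levi_civita_eqI[OF x])
    show "bilinear (\<lambda>u v. \<Gamma> x u v + Sx x u v)"
      using levi_civita_bilinear[OF x] q.S_bilinear[OF lin_\<phi>[OF x]]
      by (auto simp: bilinear_def intro: linear_compose_add)
    show "\<Gamma> x v w + Sx x v w = \<Gamma> x w v + Sx x w v" for v w
      using levi_civita_sym[OF x, of v w] q.S_sym[of "\<phi> x" v w] by simp
    fix u v w
    have "pd M i (\<lambda>y. g0 i y v w) x u = pd M i (\<lambda>y. 1 / \<nu>\<^sup>2 * (f y * (Qx y v w + \<nu> * g i y v w))) x u"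
      by (rule pd_cong[OF x]) (simp add: g0)
    also have "\<dots> = 1 / \<nu>\<^sup>2 * (f x * (pd M i (\<lambda>y. Qx y v w) x u + \<nu> * dg x u v w)
        - f x * \<phi> x u * (Qx x v w + \<nu> * g i x v w))"
      by (simp only: pd_cmult pd_mult pd_add pd_f sm_mult sm_add sm_const sm_f sm_Q[OF form_assms] sm_metric x)
        (simp add: algebra_simps)
    also have "\<dots> = 1 / \<nu>\<^sup>2 * f x * (pd M i (\<lambda>y. Qx y v w) x u + \<nu> * dg x u v w
        - \<phi> x u * (Qx x v w + \<nu> * g i x v w))"
      by (simp only: right_diff_distrib mult.assoc)
    also have "\<dots> = g0 i x (\<Gamma> x u v + Sx x u v) w + g0 i x v (\<Gamma> x u w + Sx x u w)"
      unfolding metric_compatibility[OF x] g0[OF x] by (simp add: algebra_simps)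
    finally show "pd M i (\<lambda>y. g0 i y v w) x u =
      g0 i x (\<Gamma> x u v + Sx x u v) w + g0 i x v (\<Gamma> x u w + Sx x u w)" .
  qed
qed

lemma parallel0_I:
  assumes x: "x \<in> dom"
  shows "nabla_endo M g0 I i x z v = 0"
proof -
  interpret q: quaternionic_space "I i x" "J i x" "K i x" by (rule quaternionic[OF x])
  have "nabla_endo M g0 I i x z v = nabla_endo M g I i x z v + (Sx x z (I i x v) - I i x (Sx x z v))"
    by (simp add: nabla_endo_def nabla_def levi_civita0[OF x] q.lin_simps)
  then show ?thesis
    by (simp add: nabla_I[OF x] q.S_commutator[OF lin_\<phi>[OF x]])
qed

lemma diff_potential:
  assumes \<mu>: "\<And>x. x \<in> dom \<Longrightarrow> \<mu> x = 2 / \<nu>\<^sup>2 * f x" and x: "x \<in> dom"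
  shows "pd M i \<mu> x u = - 2 * f x / \<nu>\<^sup>2 * \<phi> x u"
proof -
  have "pd M i \<mu> x u = pd M i (\<lambda>x. 2 / \<nu>\<^sup>2 * f x) x u"
    by (rule pd_cong[OF x \<mu>])
  then show ?thesis
    by (simp only: pd_cmult[OF sm_f x] pd_f[OF x]) simp
qed

text \<open>Up to the factor \<open>f\<close> this is the curvature equation: \<open>d (f \<alpha>) = f (d\<alpha> - \<phi> \<and> \<alpha>)\<close>, and \<open>d\<alpha>\<close> is known from
  \<open>bundle_curvature_scalar\<close>.\<close>
lemma potential_I:
  assumes \<mu>: "\<And>x. x \<in> dom \<Longrightarrow> \<mu> x = 2 / \<nu>\<^sup>2 * f x" and x: "x \<in> dom"
  shows "1/2 * ext_diff M (act_form I (diff M \<mu>)) i x v w = g0 i x (I i x v) w"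
proof -
  interpret h: hermitian_space "g i x" "I i x" "J i x" "K i x" by (rule hermitian[OF x])
  have d: "diff M \<mu> i y u = - 2 / \<nu>\<^sup>2 * (f y * \<phi> y u)" if "y \<in> dom" for y u
    using diff_potential[OF \<mu> that] by (simp add: diff_def)
  have 1: "pd M i (\<lambda>y. act_form I (diff M \<mu>) i y w) x u
      = 2 / \<nu>\<^sup>2 * (f x * pd M i (\<lambda>y. \<phi> y (I i y w)) x u - f x * \<phi> x u * \<phi> x (I i x w))" for u w
  proof -
    have "pd M i (\<lambda>y. act_form I (diff M \<mu>) i y w) x u = pd M i (\<lambda>y. 2 / \<nu>\<^sup>2 * (f y * \<phi> y (I i y w))) x u"
      by (rule pd_cong[OF x]) (simp add: act_form_def d)
    then show ?thesis
      by (simp only: pd_cmult pd_mult pd_f sm_mult sm_add sm_f sm_all x)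
        (simp add: algebra_simps)
  qed
  have 2: "pd M i (\<lambda>y. \<phi> y (I i y w)) x v - pd M i (\<lambda>y. \<phi> y (I i y v)) x w =
    \<nu> * g i x (I i x v) w + \<phi> x (J i x v) * \<phi> x (K i x w) - \<phi> x (J i x w) * \<phi> x (K i x v)"
    using bundle_curvature_scalar[OF x dim, of v w] by (simp add: bundle_curvature_def \<nu>[OF x])
  have 3: "Qx x (I i x v) w = \<phi> x (I i x v) * \<phi> x w - \<phi> x v * \<phi> x (I i x w)
      - \<phi> x (K i x v) * \<phi> x (J i x w) + \<phi> x (J i x v) * \<phi> x (K i x w)"
    by (simp add: h.Q_def h.quat h.form_simps[OF lin_\<phi>[OF x]])
  have "1/2 * ext_diff M (act_form I (diff M \<mu>)) i x v w = 1 / \<nu>\<^sup>2 * f x *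
      ((pd M i (\<lambda>y. \<phi> y (I i y w)) x v - pd M i (\<lambda>y. \<phi> y (I i y v)) x w)
        - \<phi> x v * \<phi> x (I i x w) + \<phi> x w * \<phi> x (I i x v))"
    unfolding ext_diff_def 1 by (simp add: algebra_simps add_divide_distrib diff_divide_distrib)
  then show ?thesis
    unfolding 2 g0[OF x] 3 by (simp add: algebra_simps)
qed

lemma dual_potential:
  assumes x: "x \<in> dom"
  shows "sharp (g0 i x) (\<lambda>u. - 2 * f x / \<nu>\<^sup>2 * \<phi> x u) = (- 2 / f x) *\<^sub>R sharp (g i x) (\<phi> x)"
proof -
  interpret h: hermitian_space "g i x" "I i x" "J i x" "K i x" by (rule hermitian[OF x])
  have "sharp (g0 i x) (\<lambda>u. - 2 * f x / \<nu>\<^sup>2 * \<phi> x u) =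
      ((- 2 * f x / \<nu>\<^sup>2) / ((f x)\<^sup>2 / \<nu>\<^sup>2)) *\<^sub>R sharp (g i x) (\<phi> x)"
    unfolding g0_combination[OF x] coefficients(2)[OF x, symmetric]
    by (rule h.combination_dual[OF lin_\<phi>[OF x] dual[OF x] coefficients(1,3)[OF x]])
  moreover have "(- 2 * f x / \<nu>\<^sup>2) / ((f x)\<^sup>2 / \<nu>\<^sup>2) = - 2 / f x"
    using \<nu>_nz[OF x] f_nz[OF x] by (simp add: field_simps power2_eq_square)
  ultimately show ?thesis
    by simp
qed

lemma norm_potential:
  assumes x: "x \<in> dom"
  defines "s \<equiv> sharp (g0 i x) (\<lambda>u. - 2 * f x / \<nu>\<^sup>2 * \<phi> x u)"
  shows "g0 i x s s = 4 * norm2 x / \<nu>\<^sup>2"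
proof -
  interpret h0: hermitian_space "g0 i x" "I i x" "J i x" "K i x" by (rule hermitian0[OF x])
  have "g0 i x s s = - 2 * f x / \<nu>\<^sup>2 * \<phi> x s"
    unfolding s_def by (rule h0.sharp) (intro linear_cmult lin_\<phi> x)
  also have "\<phi> x s = - 2 / f x * norm2 x"
    unfolding s_def dual_potential[OF x] norm2_eq[OF x]
    by (subst linear_scale[OF lin_\<phi>[OF x]]) simp
  finally show ?thesis
    using f_nz[OF x] by (simp add: field_simps power2_eq_square)
qed

end

context to_hyperkaehler_chart
begin

text \<open>Since \<open>d\<mu>\<close> is a multiple of \<open>\<phi>\<close>, both metrics are combinations of \<open>g\<close> and the quaternionic
  square of \<open>\<phi>\<close>, and the multiples of this square cancel.\<close>
lemma recover_metric:
  fixes c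
  assumes x: "x \<in> dom" and c: "c = 1/4 * \<nu> * (4 * norm2 x / \<nu>\<^sup>2) + 1"
  shows "c \<noteq> 0"
    "- (1/4 * \<nu> / c\<^sup>2) * quaternionic_space.Q (I i x) (J i x) (K i x) (\<lambda>u. - 2 * f x / \<nu>\<^sup>2 * \<phi> x u) v w
       + 1 / c * g0 i x v w = g i x v w"
proof -
  interpret q: quaternionic_space "I i x" "J i x" "K i x" by (rule quaternionic[OF x])
  have c': "c = f x / \<nu>"
    using \<nu>_nz[OF x] by (simp add: c f_def field_simps power2_eq_square)
  then show "c \<noteq> 0"
    using \<nu>_nz[OF x] f_nz[OF x] by simp
  have Q: "q.Q (\<lambda>u. t * \<phi> x u) v w = t\<^sup>2 * Qx x v w" for t
    by (simp add: q.Q_def algebra_simps power2_eq_square)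
  show "- (1/4 * \<nu> / c\<^sup>2) * q.Q (\<lambda>u. - 2 * f x / \<nu>\<^sup>2 * \<phi> x u) v w + 1 / c * g0 i x v w = g i x v w"
    unfolding Q g0[OF x] c' using \<nu>_nz[OF x] f_nz[OF x]
    by (simp add: power2_eq_square field_simps)
qed

end

context lee_chart
begin

text \<open>The two rank-one terms of \<open>I \<nabla>I\<close> contribute \<open>\<phi>\<close> each.\<close>
lemma lee_form_eq:
  assumes x: "x \<in> dom"
  shows "lee_form M g I i x v = \<phi> x v"
proof -
  interpret q: quaternionic_space "I i x" "J i x" "K i x" by (rule quaternionic[OF x])
  note l = linear_compose'[OF lin_\<phi>[OF x]]
  have "lin_trace (\<lambda>z. I i x (nabla_endo M g I i x z v)) =
      lin_trace (\<lambda>z. \<phi> x (J i x z) *\<^sub>R (- J i x v) - \<phi> x (K i x z) *\<^sub>R K i x v)"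
    by (simp add: nabla_I[OF x] q.lin_simps q.quat)
  also have "\<dots> = 2 * \<phi> x v"
    by (subst lin_trace_diff, subst lin_trace_rank_one[OF l[OF q.linJ]], subst lin_trace_rank_one[OF l[OF q.linK]])
      (simp add: q.lin_simps q.quat linear_neg[OF lin_\<phi>[OF x]])
  finally show ?thesis
    by (simp add: lee_form_def)
qed

end

section \<open>From hyper-Kaehler metrics with potential to quaternionic Kaehler metrics\<close>

locale hyperkaehler_chart = hyperhermitian_chart M i g I J K
  for M :: "('a, 'i, 'e::euclidean_space) manifold" and i g I J K +
  fixes \<mu> :: "'a \<Rightarrow> real"
  assumes parallel_I: "\<And>x z v. x \<in> dom \<Longrightarrow> nabla_endo M g I i x z v = 0"
    and parallel_J: "\<And>x z v. x \<in> dom \<Longrightarrow> nabla_endo M g J i x z v = 0"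
    and parallel_K: "\<And>x z v. x \<in> dom \<Longrightarrow> nabla_endo M g K i x z v = 0"
    and sm_\<mu>: "sm \<mu>"
    and potential_I: "\<And>x v w. x \<in> dom \<Longrightarrow> pd M i (\<lambda>y. pd M i \<mu> y (I i y v)) x w
        - pd M i (\<lambda>y. pd M i \<mu> y (I i y w)) x v = 2 * g i x (I i x v) w"
    and potential_J: "\<And>x v w. x \<in> dom \<Longrightarrow> pd M i (\<lambda>y. pd M i \<mu> y (J i y v)) x w
        - pd M i (\<lambda>y. pd M i \<mu> y (J i y w)) x v = 2 * g i x (J i x v) w"
    and potential_K: "\<And>x v w. x \<in> dom \<Longrightarrow> pd M i (\<lambda>y. pd M i \<mu> y (K i y v)) x w
        - pd M i (\<lambda>y. pd M i \<mu> y (K i y w)) x v = 2 * g i x (K i x v) w"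
begin

lemma hyperkaehler_cyclic: "hyperkaehler_chart M i g J K I \<mu>"
  by (rule hyperkaehler_chart.intro[OF hyperhermitian_cyclic hyperkaehler_chart_axioms.intro])
    (fact parallel_I parallel_J parallel_K sm_\<mu> potential_I potential_J potential_K)+

abbreviation d\<mu> where "d\<mu> \<equiv> pd M i \<mu>"

lemma lin_d\<mu>: "x \<in> dom \<Longrightarrow> linear (d\<mu> x)"
  by (rule linear_pd[OF sm_\<mu>])

lemma sm_d\<mu>: "sm (\<lambda>x. d\<mu> x v)"
  by (rule sm_pd[OF sm_\<mu>])

abbreviation hess where "hess \<equiv> cov d\<mu>"

lemma hess_sym: "x \<in> dom \<Longrightarrow> hess x u v = hess x v u"
  by (simp add: cov_def pd_commute[OF sm_\<mu>, of x v u] levi_civita_sym[of x u v])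

lemma pd_d\<mu>I:
  assumes x: "x \<in> dom"
  shows "pd M i (\<lambda>y. d\<mu> y (I i y v)) x u = hess x u (I i x v) + d\<mu> x (I i x (\<Gamma> x u v))"
  using pd_form[OF lin_d\<mu> sm_d\<mu> sm_I x, of v u] nabla_apply[where A = I, OF linI sm_I sm_const x, of u v]
  by (simp add: nabla_const parallel_I[OF x])

lemma hess_I:
  assumes x: "x \<in> dom"
  shows "hess x (I i x u) (I i x v) + hess x u v = 2 * g i x u v"
proof -
  interpret h: hermitian_space "g i x" "I i x" "J i x" "K i x" by (rule hermitian[OF x])
  show ?thesis
    using potential_I[OF x, of v "I i x u"] hess_sym[OF x, of u v]
    by (simp add: pd_d\<mu>I[OF x] levi_civita_sym[OF x, of v] h.quat h.orthI h.sym[of v u]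
        bilinear_simps[OF cov_bilinear[OF lin_d\<mu> sm_d\<mu> x]])
qed

text \<open>The three potential equations prescribe the invariant parts of the Hessian for \<open>I\<close>, \<open>J\<close> and \<open>K = I J\<close>, and these
  determine it.\<close>
lemma hess_eq_metric:
  assumes x: "x \<in> dom"
  shows "hess x u v = g i x u v"
proof -
  interpret j: hyperkaehler_chart M i g J K I \<mu> by (rule hyperkaehler_cyclic)
  interpret k: hyperkaehler_chart M i g K I J \<mu> by (rule j.hyperkaehler_cyclic)
  interpret h: hermitian_space "g i x" "I i x" "J i x" "K i x" by (rule hermitian[OF x])
  show ?thesis
    using hess_I[OF x, of "J i x u" "J i x v"] j.hess_I[OF x, of u v] k.hess_I[OF x, of u v]
    by (simp add: h.quat h.orthJ)
qed

definition norm2 :: "'a \<Rightarrow> real" where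
  "norm2 x = g i x (sharp (g i x) (d\<mu> x)) (sharp (g i x) (d\<mu> x))"

lemma dual: "x \<in> dom \<Longrightarrow> g i x (sharp (g i x) (d\<mu> x)) w = d\<mu> x w"
  using scalar_product.sharp[OF scalar_product lin_d\<mu>] by blast

lemma norm2_eq: "x \<in> dom \<Longrightarrow> norm2 x = d\<mu> x (sharp (g i x) (d\<mu> x))"
  by (simp add: norm2_def dual)

lemma sm_norm2: "sm norm2"
  unfolding norm2_def[abs_def]
  by (rule sm_apply2[where B = "g i", OF bilinear_g sm_metric sm_dual[OF lin_d\<mu> sm_d\<mu>] sm_dual[OF lin_d\<mu> sm_d\<mu>]])

lemma pd_norm2:
  assumes x: "x \<in> dom"
  shows "pd M i norm2 x u = 2 * d\<mu> x u"
proof -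
  have "pd M i norm2 x u = 2 * hess x u (sharp (g i x) (d\<mu> x))"
    unfolding norm2_def[abs_def] by (rule pd_norm[OF lin_d\<mu> sm_d\<mu> x])
  then show ?thesis
    using scalar_product.sym[OF scalar_product[OF x], of u] by (simp add: hess_eq_metric[OF x] dual[OF x])
qed

end

locale from_hyperkaehler_chart = hyperkaehler_chart M i g I J K \<mu>
  for M :: "('a, 'i, 'e::euclidean_space) manifold" and i g I J K \<mu> +
  fixes p :: real and f :: "'a \<Rightarrow> real" and gp :: "('a, 'i, 'e) form2"
  assumes p_nz: "p \<noteq> 0"
    and f_eq: "\<And>x. x \<in> dom \<Longrightarrow> f x = p * norm2 x + 1"
    and f_nz: "\<And>x. x \<in> dom \<Longrightarrow> f x \<noteq> 0"
    and gp_eq: "\<And>x v w. x \<in> dom \<Longrightarrow> gp i x v w =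
      - (p / (f x)\<^sup>2) * quaternionic_space.Q (I i x) (J i x) (K i x) (d\<mu> x) v w + 1 / f x * g i x v w"
begin

lemma from_hyperkaehler_cyclic: "from_hyperkaehler_chart M i g J K I \<mu> p f gp"
proof -
  interpret j: hyperkaehler_chart M i g J K I \<mu> by (rule hyperkaehler_cyclic)
  have Q: "quaternionic_space.Q (J i x) (K i x) (I i x) (d\<mu> x) = quaternionic_space.Q (I i x) (J i x) (K i x) (d\<mu> x)"
    if "x \<in> dom" for x
    using quaternionic_space.Q_def[OF quaternionic[OF that]] quaternionic_space.Q_def[OF j.quaternionic[OF that]]
    by (simp add: fun_eq_iff)
  show ?thesis
  proof (rule from_hyperkaehler_chart.intro[OF hyperkaehler_cyclic from_hyperkaehler_chart_axioms.intro])
    show "p \<noteq> 0" by (rule p_nz)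
    show "f x = p * norm2 x + 1" if "x \<in> dom" for x
      by (rule f_eq[OF that])
    show "f x \<noteq> 0" if "x \<in> dom" for x
      by (rule f_nz[OF that])
    show "gp i x v w = - (p / (f x)\<^sup>2) * quaternionic_space.Q (J i x) (K i x) (I i x) (d\<mu> x) v w
        + 1 / f x * g i x v w" if "x \<in> dom" for x v w
      unfolding Q[OF that] by (rule gp_eq[OF that])
  qed
qed

lemma sm_f: "sm f"
  by (rule sm_cong[where f = "\<lambda>x. p * norm2 x + 1"]) (intro sm_add sm_mult sm_const sm_norm2, simp add: f_eq)

lemma pd_f: 
  assumes x: "x \<in> dom"
  shows "pd M i f x u = 2 * p * d\<mu> x u"
proof -
  have "pd M i f x u = pd M i (\<lambda>x. p * norm2 x + 1) x u"
    by (rule pd_cong[OF x]) (rule f_eq)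
  also have "\<dots> = 2 * p * d\<mu> x u"
    by (simp add: pd_add sm_mult sm_const sm_norm2 x pd_cmult pd_norm2)
  finally show ?thesis .
qed

definition \<phi> :: "'a \<Rightarrow> 'e \<Rightarrow> real" where
  "\<phi> x v = - 2 * p * (inverse (f x) * d\<mu> x v)"

lemma \<phi>_log: "x \<in> dom \<Longrightarrow> \<phi> x v = - pd M i (\<lambda>y. ln \<bar>f y\<bar>) x v"
  by (simp add: \<phi>_def pd_ln_abs[OF sm_f _ f_nz] pd_f field_simps)

lemma lin_\<phi>: "x \<in> dom \<Longrightarrow> linear (\<phi> x)"
  unfolding \<phi>_def[abs_def] by (intro linear_cmult lin_d\<mu>)

lemma sm_inverse_f: "sm (\<lambda>x. inverse (f x))"
  by (rule sm_inverse[OF sm_f f_nz])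

lemma sm_\<phi>: "sm (\<lambda>x. \<phi> x v)"
  unfolding \<phi>_def by (intro sm_mult sm_const sm_inverse_f sm_d\<mu>)

lemma pd_inverse_f: "x \<in> dom \<Longrightarrow> pd M i (\<lambda>x. inverse (f x)) x u = \<phi> x u * inverse (f x)"
  by (simp only: pd_inverse[OF sm_f _ f_nz] pd_f) (simp add: \<phi>_def field_simps power2_eq_square)

lemma pd_\<phi>:
  assumes x: "x \<in> dom"
  shows "pd M i (\<lambda>y. \<phi> y v) x u = \<phi> x u * \<phi> x v - 2 * p * inverse (f x) * g i x u v + \<phi> x (\<Gamma> x u v)"
proof -
  have "pd M i (\<lambda>y. d\<mu> y v) x u = g i x u v + d\<mu> x (\<Gamma> x u v)"
    using hess_eq_metric[OF x, of u v] by (simp add: cov_def)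
  moreover have "pd M i (\<lambda>y. \<phi> y v) x u = - 2 * p * (inverse (f x) * pd M i (\<lambda>y. d\<mu> y v) x u
      + pd M i (\<lambda>x. inverse (f x)) x u * d\<mu> x v)"
    unfolding \<phi>_def by (simp only: pd_cmult pd_mult sm_mult sm_inverse_f sm_d\<mu> x)
  ultimately show ?thesis
    unfolding pd_inverse_f[OF x] by (simp add: \<phi>_def algebra_simps)
qed

lemma pd_\<phi>I:
  assumes x: "x \<in> dom"
  shows "pd M i (\<lambda>y. \<phi> y (I i y v)) x u =
    \<phi> x u * \<phi> x (I i x v) - 2 * p * inverse (f x) * g i x u (I i x v) + \<phi> x (I i x (\<Gamma> x u v))"
proof -
  have "pd M i (\<lambda>y. \<phi> y (I i y v)) x u = - 2 * p * (inverse (f x) * pd M i (\<lambda>y. d\<mu> y (I i y v)) x u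
      + pd M i (\<lambda>x. inverse (f x)) x u * d\<mu> x (I i x v))"
    unfolding \<phi>_def
    by (simp only: pd_cmult pd_mult sm_mult sm_inverse_f sm_apply[OF lin_d\<mu> sm_d\<mu> sm_I] x)
  then show ?thesis
    unfolding pd_inverse_f[OF x] pd_d\<mu>I[OF x] hess_eq_metric[OF x] by (simp add: \<phi>_def algebra_simps)
qed

abbreviation Qx where "Qx x \<equiv> quaternionic_space.Q (I i x) (J i x) (K i x) (\<phi> x)"
abbreviation Sx where "Sx x \<equiv> quaternionic_space.S (I i x) (J i x) (K i x) (\<phi> x)"

lemma Q_d\<mu>:
  assumes x: "x \<in> dom"
  shows "Qx x v w = 4 * p\<^sup>2 / (f x)\<^sup>2 * quaternionic_space.Q (I i x) (J i x) (K i x) (d\<mu> x) v w"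
proof -
  interpret q: quaternionic_space "I i x" "J i x" "K i x" by (rule quaternionic[OF x])
  show ?thesis
    using f_nz[OF x] by (simp add: q.Q_def \<phi>_def field_simps power2_eq_square)
qed

text \<open>Written with \<open>\<phi>\<close> in place of \<open>d\<mu>\<close> the metric is easy to differentiate: \<open>d(1/f) = \<phi>/f\<close>, and \<open>\<nabla>\<phi>\<close> is a combination
  of \<open>\<phi> \<otimes> \<phi>\<close> and \<open>g\<close>.\<close>
lemma gp_Q: "x \<in> dom \<Longrightarrow> gp i x v w = - (1 / (4 * p)) * Qx x v w + inverse (f x) * g i x v w"
  using p_nz f_nz[of x] by (simp add: gp_eq Q_d\<mu> field_simps power2_eq_square)

lemma gp_combination: "x \<in> dom \<Longrightarrow> gp i x = (\<lambda>v w. (- p / (f x)\<^sup>2) *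
    quaternionic_space.Q (I i x) (J i x) (K i x) (d\<mu> x) v w + (1 / f x) * g i x v w)"
  by (intro ext) (simp add: gp_eq)

lemma coefficients:
  assumes x: "x \<in> dom"
  shows "1 / f x \<noteq> 0" "- p / (f x)\<^sup>2 * d\<mu> x (sharp (g i x) (d\<mu> x)) + 1 / f x = 1 / (f x)\<^sup>2"
    "- p / (f x)\<^sup>2 * d\<mu> x (sharp (g i x) (d\<mu> x)) + 1 / f x \<noteq> 0"
proof -
  show "1 / f x \<noteq> 0" using f_nz[OF x] by simp
  have "p * d\<mu> x (sharp (g i x) (d\<mu> x)) = f x - 1"
    by (simp add: f_eq[OF x] norm2_eq[OF x])
  then show 2: "- p / (f x)\<^sup>2 * d\<mu> x (sharp (g i x) (d\<mu> x)) + 1 / f x = 1 / (f x)\<^sup>2"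
    using f_nz[OF x] by (simp add: field_simps power2_eq_square)
  show "- p / (f x)\<^sup>2 * d\<mu> x (sharp (g i x) (d\<mu> x)) + 1 / f x \<noteq> 0"
    unfolding 2 using f_nz[OF x] by simp
qed

lemma hermitian_p: "x \<in> dom \<Longrightarrow> hermitian_space (gp i x) (I i x) (J i x) (K i x)"
  unfolding gp_combination
  by (rule hermitian_space.hermitian_combination[OF hermitian lin_d\<mu> dual coefficients(1,3)])

lemma form_assms: "\<forall>x\<in>dom. linear (\<phi> x)" "\<forall>v. sm (\<lambda>x. \<phi> x v)"
  using lin_\<phi> sm_\<phi> by auto

lemma sm_gp: "sm (\<lambda>x. gp i x v w)"
  by (rule sm_cong[where f = "\<lambda>x. - (1 / (4 * p)) * Qx x v w + inverse (f x) * g i x v w"])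
    (intro sm_mult sm_add sm_const sm_inverse_f sm_Q[OF form_assms] sm_metric, simp add: gp_Q)

lemma hyperhermitian_p: "hyperhermitian_chart M i gp I J K"
proof (rule hyperhermitian_chart.intro[OF metric_chart.intro[OF chart_axioms metric_chart_axioms.intro]
      hyperhermitian_chart_axioms.intro])
  show "scalar_product (gp i x)" if "x \<in> dom" for x
    using hermitian_p[OF that] hermitian_space.axioms(1) by blast
qed (rule sm_gp hermitian_p sm_I sm_J sm_K; assumption)+

lemma metric_compatibility:
  assumes x: "x \<in> dom"
  shows "pd M i (\<lambda>y. Qx y v w) x u =
    Qx x (\<Gamma> x u v - Sx x u v) w + Qx x v (\<Gamma> x u w - Sx x u w)
    + 4 * p * inverse (f x) * (\<phi> x u * g i x v w + g i x (Sx x u v) w + g i x v (Sx x u w))"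
proof -
  interpret j: from_hyperkaehler_chart M i g J K I \<mu> p f gp by (rule from_hyperkaehler_cyclic)
  interpret k: from_hyperkaehler_chart M i g K I J \<mu> p f gp by (rule j.from_hyperkaehler_cyclic)
  interpret h: hermitian_space "g i x" "I i x" "J i x" "K i x" by (rule hermitian[OF x])
  note p = h.form_simps[OF lin_\<phi>[OF x]]
  have s: "g i x v u = g i x u v" "g i x w u = g i x u w" "g i x w v = g i x v w"
    by (rule h.sym)+
  have sI: "g i x (A v) u = - g i x (A u) v" "g i x (A w) u = - g i x (A u) w" "g i x (A w) v = - g i x (A v) w"
    if "\<And>v w. g i x v (A w) = - g i x (A v) w" for A
    using that h.sym by metis+
  note c = sI[OF h.skewI] sI[OF h.skewJ] sI[OF h.skewK]
  obtain t where t: "p * inverse (f x) = t"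
    by blast
  have t': "4 * p * inverse (f x) = 4 * t" "2 * p * inverse (f x) = 2 * t"
    using t by simp_all
  show ?thesis
    unfolding pd_Q[OF form_assms x] pd_\<phi>I[OF x] j.pd_\<phi>I[OF x] k.pd_\<phi>I[OF x] pd_\<phi>[OF x] h.Q_def h.S_def t'
    by (simp add: p h.lin_simps h.quat h.simps h.skewI h.skewJ h.skewK s c) (simp add: field_simps)
qed

lemma levi_civita_p:
  assumes x: "x \<in> dom"
  shows "levi_civita M gp i x = (\<lambda>u v. \<Gamma> x u v - Sx x u v)"
proof -
  interpret hp: hyperhermitian_chart M i gp I J K by (rule hyperhermitian_p)
  interpret q: quaternionic_space "I i x" "J i x" "K i x" by (rule quaternionic[OF x])
  note b = bilinear_simps[OF bilinear_g[OF x]]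
  show ?thesis
  proof (rule hp.levi_civita_eqI[OF x])
    show "bilinear (\<lambda>u v. \<Gamma> x u v - Sx x u v)"
      using levi_civita_bilinear[OF x] q.S_bilinear[OF lin_\<phi>[OF x]]
      by (auto simp: bilinear_def intro: linear_compose_sub)
    show "\<Gamma> x v w - Sx x v w = \<Gamma> x w v - Sx x w v" for v w
      using levi_civita_sym[OF x, of v w] q.S_sym[of "\<phi> x" v w] by simp
    fix u v w
    have "pd M i (\<lambda>y. gp i y v w) x u =
      pd M i (\<lambda>y. - (1 / (4 * p)) * Qx y v w + inverse (f y) * g i y v w) x u"
      by (rule pd_cong[OF x]) (rule gp_Q)
    also have "\<dots> = - (1 / (4 * p)) * pd M i (\<lambda>y. Qx y v w) x u
        + (inverse (f x) * dg x u v w + \<phi> x u * inverse (f x) * g i x v w)"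
      by (simp only: pd_cmult pd_mult pd_add pd_inverse_f sm_mult sm_const sm_inverse_f sm_Q[OF form_assms] sm_metric x)
    also have "\<dots> = gp i x (\<Gamma> x u v - Sx x u v) w + gp i x v (\<Gamma> x u w - Sx x u w)"
      unfolding metric_compatibility[OF x] gp_Q[OF x] levi_civita_metric[OF x] b
      using p_nz by (simp add: field_simps) (simp add: add_divide_distrib diff_divide_distrib)
    finally show "pd M i (\<lambda>y. gp i y v w) x u =
      gp i x (\<Gamma> x u v - Sx x u v) w + gp i x v (\<Gamma> x u w - Sx x u w)" .
  qed
qed

lemma nabla_endo_p:
  assumes x: "x \<in> dom"
  shows "nabla_endo M gp I i x z v = \<phi> x (J i x z) *\<^sub>R K i x v - \<phi> x (K i x z) *\<^sub>R J i x v"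
proof -
  interpret q: quaternionic_space "I i x" "J i x" "K i x" by (rule quaternionic[OF x])
  have "nabla_endo M gp I i x z v = nabla_endo M g I i x z v - (Sx x z (I i x v) - I i x (Sx x z v))"
    by (simp add: nabla_endo_def nabla_def levi_civita_p[OF x] q.lin_simps)
  then show ?thesis
    by (simp add: parallel_I[OF x] q.S_commutator[OF lin_\<phi>[OF x]])
qed

lemma lee_chart_p: "lee_chart M i gp I J K \<phi>"
proof -
  interpret j: from_hyperkaehler_chart M i g J K I \<mu> p f gp by (rule from_hyperkaehler_cyclic)
  interpret k: from_hyperkaehler_chart M i g K I J \<mu> p f gp by (rule j.from_hyperkaehler_cyclic)
  show ?thesis
    by (rule lee_chart.intro[OF hyperhermitian_p lee_chart_axioms.intro])
      (rule lin_\<phi> sm_\<phi> nabla_endo_p j.nabla_endo_p k.nabla_endo_p; assumption)+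
qed

text \<open>The bundle curvature is computed directly from the derivatives of \<open>\<phi>\<close>; by the general theory it is the
  fundamental form times minus the reduced scalar curvature.\<close>
lemma reduced_scalar_curvature_p:
  assumes x: "x \<in> dom" and dim: "DIM('e) > 4"
  shows "reduced_scalar_curvature M gp i x = 4 * p"
proof -
  interpret l: lee_chart M i gp I J K \<phi> by (rule lee_chart_p)
  interpret h: hermitian_space "g i x" "I i x" "J i x" "K i x" by (rule hermitian[OF x])
  interpret hp: hermitian_space "gp i x" "I i x" "J i x" "K i x" by (rule hermitian_p[OF x])
  have Q: "Qx x (I i x u) v = \<phi> x (I i x u) * \<phi> x v - \<phi> x u * \<phi> x (I i x v)
      - \<phi> x (K i x u) * \<phi> x (J i x v) + \<phi> x (J i x u) * \<phi> x (K i x v)" for u v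
    by (simp add: h.Q_def h.quat h.form_simps[OF lin_\<phi>[OF x]])
  have "l.bundle_curvature x u v = - 4 * p * gp i x (I i x u) v" for u v
    unfolding l.bundle_curvature_def pd_\<phi>I[OF x] gp_Q[OF x] Q
    using p_nz levi_civita_sym[OF x, of u v] h.skewI[of u v] h.sym[of v "I i x u"]
    by (simp add: algebra_simps)
  then have *: "reduced_scalar_curvature M gp i x * gp i x (I i x u) v = 4 * p * gp i x (I i x u) v" for u v
    using l.bundle_curvature_scalar[OF x dim, of u v] by auto
  obtain w where w: "gp i x w w \<noteq> 0"
    by (rule hp.nonnull_vector)
  have "gp i x (I i x w) (I i x w) \<noteq> 0"
    using w by (simp add: hp.orthI)
  then show ?thesis
    using *[of w "I i x w"] by simp
qed

lemma dual_p:
  assumes x: "x \<in> dom"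
  shows "sharp (gp i x) (\<phi> x) = (- 2 * p * f x) *\<^sub>R sharp (g i x) (d\<mu> x)"
proof -
  interpret h: hermitian_space "g i x" "I i x" "J i x" "K i x" by (rule hermitian[OF x])
  have "sharp (gp i x) (\<lambda>v. (- 2 * p / f x) * d\<mu> x v) = ((- 2 * p / f x) / (1 / (f x)\<^sup>2)) *\<^sub>R sharp (g i x) (d\<mu> x)"
    unfolding gp_combination[OF x] coefficients(2)[OF x, symmetric]
    by (rule h.combination_dual[OF lin_d\<mu>[OF x] dual[OF x] coefficients(1,3)[OF x]])
  moreover have "(\<lambda>v. (- 2 * p / f x) * d\<mu> x v) = \<phi> x"
    by (simp add: \<phi>_def fun_eq_iff field_simps)
  moreover have "(- 2 * p / f x) / (1 / (f x)\<^sup>2) = - 2 * p * f x"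
    using f_nz[OF x] by (simp add: power2_eq_square)
  ultimately show ?thesis by simp
qed

lemma norm_p:
  assumes x: "x \<in> dom"
  shows "gp i x (sharp (gp i x) (\<phi> x)) (sharp (gp i x) (\<phi> x)) = 4 * p\<^sup>2 * norm2 x"
proof -
  interpret hp: hermitian_space "gp i x" "I i x" "J i x" "K i x" by (rule hermitian_p[OF x])
  have "gp i x (sharp (gp i x) (\<phi> x)) (sharp (gp i x) (\<phi> x)) = \<phi> x (sharp (gp i x) (\<phi> x))"
    by (rule hp.sharp[OF lin_\<phi>[OF x]])
  also have "\<dots> = (- 2 * p * f x) * \<phi> x (sharp (g i x) (d\<mu> x))"
    unfolding dual_p[OF x] by (subst linear_scale[OF lin_\<phi>[OF x]]) simp
  also have "\<dots> = 4 * p\<^sup>2 * norm2 x"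
    using f_nz[OF x] by (simp add: \<phi>_def norm2_eq[OF x] power2_eq_square)
  finally show ?thesis .
qed

lemma recover_metric_p:
  assumes x: "x \<in> dom"
  shows "1 / (4 * p)\<^sup>2 * (4 * p\<^sup>2 * norm2 x + 4 * p) * (Qx x v w + 4 * p * gp i x v w) = g i x v w"
proof -
  have "4 * p\<^sup>2 * norm2 x + 4 * p = 4 * p * f x"
    by (simp add: f_eq[OF x] algebra_simps power2_eq_square)
  moreover have "Qx x v w + 4 * p * gp i x v w = 4 * p / f x * g i x v w"
    using p_nz by (simp add: gp_Q[OF x] field_simps)
  ultimately show ?thesis
    using p_nz f_nz[OF x] by (simp add: power2_eq_square)
qed

end

section \<open>Open submanifolds\<close>

lemma smooth_manifold_chart:
  assumes "smooth_manifold M"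
  shows "chart M i"
proof
  show "open (coord M i ` chart_dom M i)"
    using assms by (simp add: smooth_manifold_def)
  have d: "openin (points M) (chart_dom M i)"
    and h: "homeomorphic_map (subtopology (points M) (chart_dom M i))
          (top_of_set (coord M i ` chart_dom M i)) (coord M i)"
    using assms by (auto simp: smooth_manifold_def)
  have "topspace (subtopology (points M) (chart_dom M i)) = chart_dom M i"
    using openin_subset[OF d] by (simp add: Int_absorb1)
  then show "inj_on (coord M i) (chart_dom M i)"
    using h homeomorphic_imp_injective_map by metis
qed

lemma chart_dom_openin: "smooth_manifold M \<Longrightarrow> openin (points M) (chart_dom M i)"
  by (simp add: smooth_manifold_def)

lemma chart_dom_topspace: "smooth_manifold M \<Longrightarrow> chart_dom M i \<subseteq> topspace (points M)"
  by (meson chart_dom_openin openin_subset)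

lemma in_some_chart: "smooth_manifold M \<Longrightarrow> x \<in> topspace (points M) \<Longrightarrow> \<exists>i. x \<in> chart_dom M i"
  unfolding smooth_manifold_def by blast

lemma coord_homeomorphic:
  assumes "smooth_manifold M"
  shows "homeomorphic_map (subtopology (points M) (chart_dom M i)) (top_of_set (coord M i ` chart_dom M i)) (coord M i)"
  using assms by (simp add: smooth_manifold_def)

lemma open_coord_image:
  assumes M: "smooth_manifold M" and V: "openin (points M) V"
  shows "open (coord M i ` (chart_dom M i \<inter> V))"
proof -
  have "openin (subtopology (points M) (chart_dom M i)) (chart_dom M i \<inter> V)"
    using V by (metis inf_commute openin_subtopology)
  then have "openin (top_of_set (coord M i ` chart_dom M i)) (coord M i ` (chart_dom M i \<inter> V))"
    using coord_homeomorphic[OF M] homeomorphic_imp_open_map open_map_def by blast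
  then show ?thesis
    using chart.open_image[OF smooth_manifold_chart[OF M]] openin_open_trans by blast
qed

lemma chart_dom_submanifold [simp]: "chart_dom (submanifold M V) i = chart_dom M i \<inter> V"
  and coord_submanifold [simp]: "coord (submanifold M V) = coord M"
  and points_submanifold [simp]: "points (submanifold M V) = subtopology (points M) V"
  by (simp_all add: submanifold_def)

lemma submanifold_topspace:
  assumes "smooth_manifold M"
  shows "submanifold M (topspace (points M)) = M"
proof -
  have "(\<lambda>i. chart_dom M i \<inter> topspace (points M)) = chart_dom M"
    using chart_dom_topspace[OF assms] by (intro ext) blast
  then show ?thesis
    by (simp add: submanifold_def subtopology_topspace)
qed

lemma chart_inv_submanifold:
  assumes M: "smooth_manifold M" and y: "y \<in> coord M i ` (chart_dom M i \<inter> V)"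
  shows "chart_inv (submanifold M V) i y = chart_inv M i y"
proof -
  interpret chart M i by (rule smooth_manifold_chart[OF M])
  obtain x where x: "x \<in> dom" "x \<in> V" "y = coord M i x"
    using y by blast
  have "inj_on (coord M i) (dom \<inter> V)"
    using inj_coord inj_on_subset by blast
  then have "inv_into (dom \<inter> V) (coord M i) (coord M i x) = x"
    using x by (intro inv_into_f_f) auto
  then show ?thesis
    using x by (simp add: chart_inv_def inv_into_f_f[OF inj_coord])
qed

lemma smooth_manifold_submanifold:
  assumes M: "smooth_manifold M" and V: "openin (points M) V"
  shows "smooth_manifold (submanifold M V)"
  unfolding smooth_manifold_def
proof (intro conjI allI)
  show "Hausdorff_space (points (submanifold M V))" "second_countable (points (submanifold M V))"
    using M by (simp_all add: smooth_manifold_def Hausdorff_space_subtopology second_countable_subtopology)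
  show "(\<Union>i. chart_dom (submanifold M V) i) = topspace (points (submanifold M V))"
    using M by (auto simp: smooth_manifold_def)
  fix i
  have D: "openin (points M) (chart_dom M i)"
    by (rule chart_dom_openin[OF M])
  show "openin (points (submanifold M V)) (chart_dom (submanifold M V) i)"
    using D by (auto simp: openin_subtopology)
  show "open (coord (submanifold M V) i ` chart_dom (submanifold M V) i)"
    using open_coord_image[OF M V] by simp
  have "homeomorphic_map (subtopology (subtopology (points M) (chart_dom M i)) (chart_dom M i \<inter> V))
      (subtopology (top_of_set (coord M i ` chart_dom M i)) (coord M i ` (chart_dom M i \<inter> V))) (coord M i)"
  proof (rule homeomorphic_map_subtopologies[OF coord_homeomorphic[OF M]])
    interpret chart M i by (rule smooth_manifold_chart[OF M])
    have t: "topspace (subtopology (points M) dom) = dom"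
      using openin_subset[OF D] by (simp add: Int_absorb1)
    show "coord M i ` (topspace (subtopology (points M) dom) \<inter> (dom \<inter> V)) =
      topspace (top_of_set (coord M i ` dom)) \<inter> coord M i ` (dom \<inter> V)"
      unfolding t by auto
  qed
  moreover have "coord M i ` chart_dom M i \<inter> coord M i ` (chart_dom M i \<inter> V) = coord M i ` (chart_dom M i \<inter> V)"
    by blast
  moreover have "chart_dom M i \<inter> (chart_dom M i \<inter> V) = V \<inter> (chart_dom M i \<inter> V)"
    by blast
  ultimately show "homeomorphic_map (subtopology (points (submanifold M V)) (chart_dom (submanifold M V) i))
     (top_of_set (coord (submanifold M V) i ` chart_dom (submanifold M V) i)) (coord (submanifold M V) i)"
    by (simp add: subtopology_subtopology)
  fix j
  have W: "openin (points M) (chart_dom M j \<inter> V)"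
    using V chart_dom_openin[OF M] by blast
  have open': "open (coord M i ` (chart_dom M i \<inter> (chart_dom M j \<inter> V)))"
    by (rule open_coord_image[OF M W])
  have e: "chart_dom M i \<inter> V \<inter> (chart_dom M j \<inter> V) = chart_dom M i \<inter> (chart_dom M j \<inter> V)"
    by blast
  have base: "Ck_on k (coord M j \<circ> chart_inv M i) (coord M i ` (chart_dom M i \<inter> (chart_dom M j \<inter> V)))" for k
  proof (rule Ck_on_subset)
    show "Ck_on k (coord M j \<circ> chart_inv M i) (coord M i ` (chart_dom M i \<inter> chart_dom M j))"
      using M by (simp add: smooth_manifold_def smooth_on_def)
  qed auto
  have agree: "(coord M j \<circ> chart_inv M i) y = (coord M j \<circ> chart_inv (submanifold M V) i) y"
    if "y \<in> coord M i ` (chart_dom M i \<inter> (chart_dom M j \<inter> V))" for y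
  proof -
    have "y \<in> coord M i ` (chart_dom M i \<inter> V)"
      using that by auto
    from chart_inv_submanifold[OF M this] show ?thesis by simp
  qed
  have "Ck_on k (coord M j \<circ> chart_inv (submanifold M V) i)
      (coord M i ` (chart_dom M i \<inter> (chart_dom M j \<inter> V)))" for k
    by (rule Ck_on_cong[OF open' agree base])
  then show "smooth_on (coord (submanifold M V) i ` (chart_dom (submanifold M V) i \<inter> chart_dom (submanifold M V) j))
        (coord (submanifold M V) j \<circ> chart_inv (submanifold M V) i)"
    by (simp add: smooth_on_def e)
qed

text \<open>Derivatives on an open submanifold agree with those on the ambient manifold at each of its points, although the
  inverse of the coordinate map is a different function outside the image.\<close>
locale open_part =
  fixes M :: "('a, 'i, 'e::euclidean_space) manifold" and V :: "'a set"
  assumes M: "smooth_manifold M" and V: "openin (points M) V"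
begin

abbreviation N where "N \<equiv> submanifold M V"

lemma smooth_N: "smooth_manifold N"
  by (rule smooth_manifold_submanifold[OF M V])

lemma chart_N: "chart N i"
  by (rule smooth_manifold_chart[OF smooth_N])

lemma pd_N:
  assumes x: "x \<in> chart_dom M i" "x \<in> V"
  shows "pd N i f x v = pd M i f x v"
proof -
  let ?W = "coord M i ` (chart_dom M i \<inter> V)"
  have W: "open ?W" "coord M i x \<in> ?W"
    using open_coord_image[OF M V] x by auto
  have "((f \<circ> chart_inv N i) has_derivative D) (at (coord M i x)) \<longleftrightarrow>
        ((f \<circ> chart_inv M i) has_derivative D) (at (coord M i x))" for D
    using has_derivative_transform_within_open[OF _ W, of "f \<circ> chart_inv N i" D UNIV "f \<circ> chart_inv M i"]
      has_derivative_transform_within_open[OF _ W, of "f \<circ> chart_inv M i" D UNIV "f \<circ> chart_inv N i"]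
    by (auto simp: chart_inv_submanifold[OF M])
  then show ?thesis
    by (simp add: pd_def frechet_derivative_def)
qed

lemma smooth_in_chart_N:
  assumes "smooth_in_chart M i f"
  shows "smooth_in_chart N i f"
  unfolding smooth_in_chart_def smooth_on_def
proof
  fix k
  have agree: "(f \<circ> chart_inv M i) y = (f \<circ> chart_inv N i) y" if "y \<in> coord M i ` (chart_dom M i \<inter> V)" for y
    using chart_inv_submanifold[OF M that] by simp
  have base: "Ck_on k (f \<circ> chart_inv M i) (coord M i ` (chart_dom M i \<inter> V))"
  proof (rule Ck_on_subset)
    show "Ck_on k (f \<circ> chart_inv M i) (coord M i ` chart_dom M i)"
      using assms by (simp add: smooth_in_chart_def smooth_on_def)
  qed auto
  show "Ck_on k (f \<circ> chart_inv N i) (coord N i ` chart_dom N i)"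
    unfolding chart_dom_submanifold coord_submanifold
    by (rule Ck_on_cong[OF open_coord_image[OF M V] agree base])
qed

lemma jac_N: "x \<in> chart_dom M i \<Longrightarrow> x \<in> V \<Longrightarrow> jac N i j x v = jac M i j x v"
  by (simp add: jac_def pd_N)

lemma levi_civita_N: "x \<in> chart_dom M i \<Longrightarrow> x \<in> V \<Longrightarrow> levi_civita N g i x = levi_civita M g i x"
  by (simp add: levi_civita_def pd_N)

lemma nabla_N: "x \<in> chart_dom M i \<Longrightarrow> x \<in> V \<Longrightarrow> nabla N g i v Y x = nabla M g i v Y x"
  by (simp add: nabla_def pd_N levi_civita_N)

lemma nabla_endo_N: "x \<in> chart_dom M i \<Longrightarrow> x \<in> V \<Longrightarrow> nabla_endo N g A i x v w = nabla_endo M g A i x v w"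
  by (simp add: nabla_endo_def nabla_N)

lemma nijenhuis_N: "x \<in> chart_dom M i \<Longrightarrow> x \<in> V \<Longrightarrow> nijenhuis N A i x v w = nijenhuis M A i x v w"
  by (simp add: nijenhuis_def lie_bracket_def pd_N)

lemma endo_field_N: "endo_field M A \<Longrightarrow> endo_field N A"
  by (auto simp: endo_field_def jac_N intro: smooth_in_chart_N)

lemma metric_chart_N:
  assumes "metric_chart M i g"
  shows "metric_chart N i g"
proof -
  interpret metric_chart M i g by fact
  show ?thesis
    by (rule metric_chart.intro[OF chart_N metric_chart_axioms.intro])
      (auto intro: scalar_product smooth_in_chart_N sm_metric)
qed

lemma hyperhermitian_chart_N:
  assumes "hyperhermitian_chart M i g I J K"
  shows "hyperhermitian_chart N i g I J K"
proof -
  interpret hyperhermitian_chart M i g I J K by fact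
  show ?thesis
    by (rule hyperhermitian_chart.intro[OF metric_chart_N[OF metric_chart_axioms] hyperhermitian_chart_axioms.intro])
      (auto intro: hermitian smooth_in_chart_N sm_I sm_J sm_K)
qed

lemma lee_chart_N:
  assumes "lee_chart M i g I J K \<phi>"
  shows "lee_chart N i g I J K \<phi>"
proof -
  interpret lee_chart M i g I J K \<phi> by fact
  show ?thesis
    by (rule lee_chart.intro[OF hyperhermitian_chart_N[OF hyperhermitian_chart_axioms] lee_chart_axioms.intro])
      (auto intro: lin_\<phi> smooth_in_chart_N sm_\<phi> simp: nabla_endo_N nabla_I nabla_J nabla_K)
qed

lemma hyperkaehler_chart_N:
  assumes "hyperkaehler_chart M i g I J K \<mu>"
  shows "hyperkaehler_chart N i g I J K \<mu>"
proof -
  interpret hyperkaehler_chart M i g I J K \<mu> by fact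
  interpret n: chart N i by (rule chart_N)
  have d: "pd N i (\<lambda>y. pd N i \<mu> y (A i y v)) x w = pd M i (\<lambda>y. pd M i \<mu> y (A i y v)) x w"
    if x: "x \<in> chart_dom N i" for A :: "('a, 'i, 'e) endo" and x v w
  proof -
    have "pd N i (\<lambda>y. pd N i \<mu> y (A i y v)) x w = pd N i (\<lambda>y. pd M i \<mu> y (A i y v)) x w"
      by (rule n.pd_cong[OF x]) (simp add: pd_N)
    then show ?thesis
      using x by (simp add: pd_N)
  qed
  show ?thesis
    by (rule hyperkaehler_chart.intro[OF hyperhermitian_chart_N[OF hyperhermitian_chart_axioms] hyperkaehler_chart_axioms.intro])
      (use parallel_I parallel_J parallel_K sm_\<mu> potential_I potential_J potential_K in
        \<open>simp_all add: d nabla_endo_N smooth_in_chart_N\<close>)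
qed

end

section \<open>Change of coordinates\<close>

lemma Ck_on_compose:
  fixes f :: "'d::euclidean_space \<Rightarrow> 'b::real_normed_vector" and h :: "'e::euclidean_space \<Rightarrow> 'd"
  assumes S: "open S" and T: "open T" and hST: "h ` S \<subseteq> T" and h: "\<And>k. Ck_on k h S" and f: "Ck_on k f T"
  shows "Ck_on k (\<lambda>x. f (h x)) S"
  using f
proof (induction k arbitrary: f)
  case 0
  then show ?case
    using h[of 0] hST continuous_on_compose2[of T f S h] by simp
next
  case (Suc k)
  have hx: "h x \<in> T" if "x \<in> S" for x
    using hST that by blast
  have dh: "(h has_derivative frechet_derivative h (at x)) (at x)" if "x \<in> S" for x
    using Ck_on_has_derivative[OF h that] .
  have df: "(f has_derivative frechet_derivative f (at y)) (at y)" if "y \<in> T" for y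
    using Ck_on_has_derivative[OF Suc.prems that] .
  have Df: "Ck_on k (\<lambda>y. frechet_derivative f (at y) b) T" for b
    using Suc.prems by simp
  have Dh: "Ck_on k (\<lambda>x. frechet_derivative h (at x) v) S" for v
    using h[of "Suc k"] by simp
  show ?case
  proof (rule Ck_on_SucI[OF S])
    show "((\<lambda>x. f (h x)) has_derivative
        (\<lambda>v. \<Sum>b\<in>Basis. (frechet_derivative h (at x) v \<bullet> b) *\<^sub>R frechet_derivative f (at (h x)) b)) (at x)"
      if x: "x \<in> S" for x
      using has_derivative_compose[OF dh[OF x] df[OF hx[OF x]]]
      unfolding linear_eq_sum_Basis[OF has_derivative_linear[OF df[OF hx[OF x]]], of "frechet_derivative h (at x) v" for v] .
    have p: "Ck_on k (\<lambda>x. frechet_derivative h (at x) v \<bullet> b) S" for v b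
      by (rule Ck_on_bounded_linear[OF S bounded_linear_inner_left Dh])
    show "Ck_on k (\<lambda>x. \<Sum>b\<in>Basis. (frechet_derivative h (at x) v \<bullet> b) *\<^sub>R frechet_derivative f (at (h x)) b) S" for v
      by (rule Ck_on_sum[OF S]) (rule Ck_on_bilinear[OF S bounded_bilinear_scaleR p Suc.IH[OF Df]])
  qed
qed

text \<open>Two charts with a common domain; the general case is reduced to this one by restriction to the overlap.\<close>
locale chart_pair =
  fixes M :: "('a, 'i, 'e::euclidean_space) manifold" and i j
  assumes M: "smooth_manifold M" and same_dom: "chart_dom M i = chart_dom M j"
begin

sublocale ci: chart M i by (rule smooth_manifold_chart[OF M])
sublocale cj: chart M j by (rule smooth_manifold_chart[OF M])

lemma chart_pair_sym: "chart_pair M j i"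
  using M same_dom by unfold_locales auto

lemma transition_smooth: "Ck_on k (coord M j \<circ> chart_inv M i) (coord M i ` chart_dom M i)"
  using M same_dom unfolding smooth_manifold_def smooth_on_def by (metis inf.idem)

lemma sm_coord: "ci.sm (coord M j)"
  by (rule ci.smI) (rule transition_smooth)

lemma sm_change:
  assumes "cj.sm f"
  shows "ci.sm f"
proof (rule ci.smI')
  show "Ck_on k (\<lambda>y. (f \<circ> chart_inv M j) ((coord M j \<circ> chart_inv M i) y)) (coord M i ` chart_dom M i)" for k
    by (rule Ck_on_compose[OF ci.open_image cj.open_image _ transition_smooth cj.smE[OF assms]])
      (use same_dom in auto)
qed (use same_dom in auto)

lemma pd_change:
  assumes f: "cj.sm f" and x: "x \<in> chart_dom M i"
  shows "pd M i f x v = pd M j f x (jac M i j x v)"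
proof -
  have xj: "x \<in> chart_dom M j" using x same_dom by simp
  have "((\<lambda>y. (f \<circ> chart_inv M j) ((coord M j \<circ> chart_inv M i) y)) has_derivative
      (\<lambda>v. pd M j f x (pd M i (coord M j) x v))) (at (coord M i x))"
    by (rule has_derivative_compose[OF ci.pd_has_derivative[OF sm_coord x]])
      (use cj.pd_has_derivative[OF f xj] x in \<open>simp add: comp_def\<close>)
  then have "((\<lambda>y. f (chart_inv M i y)) has_derivative (\<lambda>v. pd M j f x (pd M i (coord M j) x v))) (at (coord M i x))"
    by (rule has_derivative_transform_within_open[OF _ ci.open_image]) (use x same_dom in auto)
  then show ?thesis
    unfolding jac_def by (rule ci.pd_eqI)
qed

lemma linear_jac: "x \<in> chart_dom M i \<Longrightarrow> linear (jac M i j x)"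
  using ci.linear_pd[OF sm_coord] by (simp add: jac_def[abs_def])

lemma sm_jac: "ci.sm (\<lambda>x. jac M i j x v)"
  unfolding jac_def by (rule ci.sm_pd[OF sm_coord])

lemma jac_inverse:
  assumes x: "x \<in> chart_dom M i"
  shows "jac M j i x (jac M i j x v) = v"
proof -
  interpret s: chart_pair M j i by (rule chart_pair_sym)
  have "pd M i (coord M i) x v = v"
  proof (rule ci.pd_eqI)
    show "((\<lambda>y. coord M i (chart_inv M i y)) has_derivative (\<lambda>v. v)) (at (coord M i x))"
      by (rule has_derivative_transform_within_open[OF has_derivative_ident ci.open_image]) (use x in auto)
  qed
  then show ?thesis
    using pd_change[OF s.sm_coord x, of v] by (simp add: jac_def[of M j i])
qed

end

locale metric_chart_pair = chart_pair M i j
  for M :: "('a, 'i, 'e::euclidean_space) manifold" and i j +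
  fixes g :: "('a, 'i, 'e) form2"
  assumes mi: "metric_chart M i g" and mj: "metric_chart M j g"
    and g_change: "\<And>x v w. x \<in> chart_dom M i \<Longrightarrow> g j x (jac M i j x v) (jac M i j x w) = g i x v w"
begin

interpretation s: chart_pair M j i by (rule chart_pair_sym)
interpretation gi: metric_chart M i g by (rule mi)
interpretation gj: metric_chart M j g by (rule mj)

abbreviation second where "second x u v \<equiv> pd M i (\<lambda>y. jac M i j y v) x u"

lemma second_sym: "x \<in> chart_dom M i \<Longrightarrow> second x u v = second x v u"
  unfolding jac_def by (rule ci.pd_commute[OF sm_coord])

text \<open>The Christoffel symbols pick up the second derivatives of the transition map, because the right-hand side
  satisfies the conditions that characterise the Levi-Civita connection.\<close>
lemma levi_civita_change:
  assumes x: "x \<in> chart_dom M i"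
  shows "jac M i j x (levi_civita M g i x u v) =
    levi_civita M g j x (jac M i j x u) (jac M i j x v) + second x u v"
proof -
  have xj: "x \<in> chart_dom M j" using x same_dom by simp
  let ?J = "jac M i j x" and ?J' = "jac M j i x"
  let ?G = "\<lambda>u v. ?J' (levi_civita M g j x (?J u) (?J v) + second x u v)"
  note bj = bilinear_simps[OF gj.levi_civita_bilinear[OF xj]]
  note lJ = linear_add[OF linear_jac[OF x]] linear_scale[OF linear_jac[OF x]]
  note lJ' = linear_add[OF s.linear_jac[OF xj]] linear_scale[OF s.linear_jac[OF xj]]
  have JJ': "?J (?J' v) = v" for v
    by (rule s.jac_inverse[OF xj])
  have sec: "linear (\<lambda>u. second x u v)" "linear (\<lambda>v. second x u v)" for u v
    by (rule ci.linear_pd[OF sm_jac x]) (rule ci.linear_pd_field[OF linear_jac sm_jac x])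
  have "levi_civita M g i x = ?G"
  proof (rule gi.levi_civita_eqI[OF x])
    show "bilinear ?G"
      by (intro bilinearI linearI)
        (simp_all add: bj lJ lJ' linear_add[OF sec(1)] linear_add[OF sec(2)]
          linear_scale[OF sec(1)] linear_scale[OF sec(2)] algebra_simps)
    show "?G v w = ?G w v" for v w
      using gj.levi_civita_sym[OF xj, of "?J v" "?J w"] second_sym[OF x, of v w] by simp
    fix u v w
    have "pd M i (\<lambda>y. g i y v w) x u = pd M i (\<lambda>y. g j y (jac M i j y v) (jac M i j y w)) x u"
      by (rule ci.pd_cong[OF x]) (simp add: g_change)
    also have "\<dots> = pd M i (\<lambda>y. g j y (?J v) (?J w)) x u + g j x (second x u v) (?J w) + g j x (?J v) (second x u w)"
      by (rule ci.pd_apply2[where B = "g j", OF _ _ sm_jac sm_jac x])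
        (simp_all add: same_dom gj.bilinear_g sm_change gj.sm_metric)
    also have "pd M i (\<lambda>y. g j y (?J v) (?J w)) x u = pd M j (\<lambda>y. g j y (?J v) (?J w)) x (?J u)"
      by (rule pd_change[OF gj.sm_metric x])
    also have "\<dots> = g j x (levi_civita M g j x (?J u) (?J v)) (?J w) + g j x (?J v) (levi_civita M g j x (?J u) (?J w))"
      by (rule gj.levi_civita_metric[OF xj])
    finally show "pd M i (\<lambda>y. g i y v w) x u = g i x (?G u v) w + g i x v (?G u w)"
      by (simp add: JJ' bilinear_simps[OF gj.bilinear_g[OF xj]] flip: g_change[OF x])
  qed
  then show ?thesis
    by (simp add: JJ')
qed

lemma nabla_endo_change:
  assumes A: "\<And>k x. x \<in> chart_dom M k \<Longrightarrow> linear (A k x)" "\<And>k v. smooth_in_chart M k (\<lambda>x. A k x v)"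
    and A_change: "\<And>x v. x \<in> chart_dom M i \<Longrightarrow> A j x (jac M i j x v) = jac M i j x (A i x v)"
    and x: "x \<in> chart_dom M i"
  shows "jac M i j x (nabla_endo M g A i x u v) = nabla_endo M g A j x (jac M i j x u) (jac M i j x v)"
proof -
  have xj: "x \<in> chart_dom M j" using x same_dom by simp
  let ?J = "jac M i j x"
  note lJ = linear_add[OF linear_jac[OF x]] linear_diff[OF linear_jac[OF x]]
  note lA = linear_add[OF A(1)[OF xj]]
  have "pd M i (\<lambda>y. A j y (jac M i j y v)) x u = pd M i (\<lambda>y. A j y (?J v)) x u + A j x (second x u v)"
    by (rule ci.pd_apply[where A = "A j", OF _ _ sm_jac x]) (simp_all add: same_dom A sm_change)
  moreover have "pd M i (\<lambda>y. A j y (?J v)) x u = pd M j (\<lambda>y. A j y (?J v)) x (?J u)"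
    by (rule pd_change[OF A(2) x])
  moreover have "pd M i (\<lambda>y. A j y (jac M i j y v)) x u = pd M i (\<lambda>y. jac M i j y (A i y v)) x u"
    by (rule ci.pd_cong[OF x]) (rule A_change)
  moreover have "pd M i (\<lambda>y. jac M i j y (A i y v)) x u =
      second x u (A i x v) + ?J (pd M i (\<lambda>y. A i y v) x u)"
    by (rule ci.pd_apply[where A = "jac M i j", OF linear_jac sm_jac A(2) x])
  ultimately have "?J (pd M i (\<lambda>y. A i y v) x u) =
      pd M j (\<lambda>y. A j y (?J v)) x (?J u) + A j x (second x u v) - second x u (A i x v)"
    by (simp add: algebra_simps)
  then show ?thesis
    by (simp add: nabla_endo_def nabla_def lJ lA levi_civita_change[OF x] A_change[OF x, symmetric])
qed

text \<open>The Lee form is a trace, and the change of coordinates conjugates the operator whose trace is taken.\<close>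
lemma lee_form_change:
  assumes A: "\<And>k x. x \<in> chart_dom M k \<Longrightarrow> linear (A k x)" "\<And>k v. smooth_in_chart M k (\<lambda>x. A k x v)"
    and A_change: "\<And>x v. x \<in> chart_dom M i \<Longrightarrow> A j x (jac M i j x v) = jac M i j x (A i x v)"
    and x: "x \<in> chart_dom M i"
  shows "lee_form M g A j x (jac M i j x v) = lee_form M g A i x v"
proof -
  have xj: "x \<in> chart_dom M j" using x same_dom by simp
  let ?J = "jac M i j x" and ?J' = "jac M j i x"
  have "A j x (nabla_endo M g A j x z (?J v)) = ?J (A i x (nabla_endo M g A i x (?J' z) v))" for z
    using nabla_endo_change[OF A A_change x, of "?J' z" v] s.jac_inverse[OF xj, of z]
      A_change[OF x, of "nabla_endo M g A i x (?J' z) v"] by simp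
  moreover have "linear (\<lambda>z. A i x (nabla_endo M g A i x z v))"
    by (rule linear_compose'[OF A(1)[OF x] gi.linear_nabla_endo[where A = A, OF A x]])
  ultimately have "lin_trace (\<lambda>z. A j x (nabla_endo M g A j x z (?J v))) = lin_trace (\<lambda>z. A i x (nabla_endo M g A i x z v))"
    using lin_trace_conjugate[OF linear_jac[OF x] s.linear_jac[OF xj], of "\<lambda>z. A i x (nabla_endo M g A i x z v)"]
      jac_inverse[OF x] by simp
  then show ?thesis
    by (simp add: lee_form_def)
qed

end

section \<open>Signatures\<close>

context hermitian_space
begin

context
  fixes \<phi> :: "'e \<Rightarrow> real" and \<xi> :: 'e
  assumes lin: "linear \<phi>" and \<xi>: "\<And>w. B \<xi> w = \<phi> w"
begin

abbreviation HS where "HS \<equiv> span {\<xi>, I \<xi>, J \<xi>, K \<xi>}"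

definition comb :: "real \<times> real \<times> real \<times> real \<Rightarrow> 'e" where
  "comb t = fst t *\<^sub>R \<xi> + fst (snd t) *\<^sub>R I \<xi> + fst (snd (snd t)) *\<^sub>R J \<xi> + snd (snd (snd t)) *\<^sub>R K \<xi>"

lemma linear_comb: "linear comb"
  by (rule linearI) (simp_all add: comb_def algebra_simps)

lemma range_comb: "range comb = HS"
proof
  show "range comb \<subseteq> HS"
  proof (rule image_subsetI)
    show "comb t \<in> HS" for t
      unfolding comb_def by (intro span_add span_scale; rule span_base; simp)
  qed
  have "\<xi> = comb (1, 0, 0, 0)" "I \<xi> = comb (0, 1, 0, 0)" "J \<xi> = comb (0, 0, 1, 0)" "K \<xi> = comb (0, 0, 0, 1)"
    by (simp_all add: comb_def)
  then have "{\<xi>, I \<xi>, J \<xi>, K \<xi>} \<subseteq> range comb"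
    by blast
  then show "HS \<subseteq> range comb"
    by (rule span_minimal) (rule linear_subspace_image[OF linear_comb subspace_UNIV])
qed

lemma B_generators: "B (I \<xi>) w = - \<phi> (I w)" "B (J \<xi>) w = - \<phi> (J w)" "B (K \<xi>) w = - \<phi> (K w)"
  using skewI[of \<xi> w] skewJ[of \<xi> w] skewK[of \<xi> w] by (simp_all add: \<xi>)

lemma form_generators:
  "\<phi> (I \<xi>) = 0" "\<phi> (J \<xi>) = 0" "\<phi> (K \<xi>) = 0"
  by (rule form_orthogonal[OF lin \<xi>])+

text \<open>On the quaternionic line spanned by the dual vector the form \<open>Q\<close> is the multiple \<open>\<bar>\<phi>\<bar>\<^sup>2\<close> of the scalar product;
  on the common kernel of \<open>\<phi>, \<phi> \<circ> I, \<phi> \<circ> J, \<phi> \<circ> K\<close> it vanishes.\<close>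
lemma Q_HS:
  assumes "h \<in> HS"
  shows "Q \<phi> h w = \<phi> \<xi> * B h w"
proof -
  obtain t where "h = comb t"
    using assms range_comb by blast
  then show ?thesis
    by (simp add: comb_def Q_def simps lin_simps form_simps[OF lin] quat B_generators \<xi> form_generators algebra_simps)
qed

definition perp :: "'e set" where
  "perp = {v. \<phi> v = 0 \<and> \<phi> (I v) = 0 \<and> \<phi> (J v) = 0 \<and> \<phi> (K v) = 0}"

lemma subspace_perp: "subspace perp"
  by (rule subspaceI) (simp_all add: perp_def lin_simps form_simps[OF lin])

lemma Q_perp: "u \<in> perp \<Longrightarrow> Q \<phi> w u = 0"
  by (simp add: perp_def Q_def)

lemma B_HS_perp:
  assumes "h \<in> HS" "u \<in> perp"
  shows "B h u = 0"
proof -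
  obtain t where "h = comb t"
    using assms range_comb by blast
  then show ?thesis
    using assms(2) by (simp add: comb_def simps perp_def B_generators \<xi>)
qed

lemma HS_perp_decomposition:
  assumes N: "\<phi> \<xi> \<noteq> 0"
  obtains h u where "h \<in> HS" "u \<in> perp" "v = h + u"
proof -
  define h where "h = comb (\<phi> v / \<phi> \<xi>, - \<phi> (I v) / \<phi> \<xi>, - \<phi> (J v) / \<phi> \<xi>, - \<phi> (K v) / \<phi> \<xi>)"
  have "h \<in> HS"
    using range_comb h_def by blast
  moreover have "v - h \<in> perp"
    using N by (simp add: perp_def h_def comb_def lin_simps form_simps[OF lin] quat form_generators)
  ultimately show thesis
    using that[of h "v - h"] by simp
qed

lemma dim_HS:
  assumes N: "\<phi> \<xi> \<noteq> 0"
  shows "dim HS = 4"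
proof -
  have inj: "inj comb"
  proof (rule linear_injective_0[OF linear_comb, THEN iffD2], intro allI impI)
    fix t assume 0: "comb t = 0"
    have "\<phi> (comb t) = fst t * \<phi> \<xi>" "\<phi> (I (comb t)) = - (fst (snd t) * \<phi> \<xi>)"
      "\<phi> (J (comb t)) = - (fst (snd (snd t)) * \<phi> \<xi>)" "\<phi> (K (comb t)) = - (snd (snd (snd t)) * \<phi> \<xi>)"
      by (simp_all add: comb_def lin_simps form_simps[OF lin] quat form_generators)
    then show "t = 0"
      using N unfolding 0 by (simp add: lin_simps form_simps[OF lin] prod_eq_iff)
  qed
  have "dim (comb ` UNIV) = dim (UNIV :: (real \<times> real \<times> real \<times> real) set)"
    by (rule dim_image_eq[OF linear_comb]) (simp add: inj)
  then show ?thesis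
    by (simp add: range_comb)
qed

lemma dim_perp:
  assumes N: "\<phi> \<xi> \<noteq> 0"
  shows "dim perp + 4 = DIM('e)"
proof -
  have "HS \<inter> perp = {0}"
  proof
    show "HS \<inter> perp \<subseteq> {0}"
    proof
      fix v assume v: "v \<in> HS \<inter> perp"
      have "\<phi> \<xi> * B v w = 0" for w
        using Q_HS[of v w] Q_perp[of v w] v Q_sym[of \<phi> v w] by simp
      then show "v \<in> {0}"
        using N nondegenerate[of v] by simp
    qed
  qed (use subspace_0[OF subspace_perp] span_0 in auto)
  moreover have "{x + y |x y. x \<in> HS \<and> y \<in> perp} = UNIV"
  proof -
    have "\<exists>x y. v = x + y \<and> x \<in> HS \<and> y \<in> perp" for v
      by (rule HS_perp_decomposition[OF N, of v]) blast
    then show ?thesis by blast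
  qed
  ultimately show ?thesis
    using dim_sums_Int[OF subspace_span subspace_perp, of "{\<xi>, I \<xi>, J \<xi>, K \<xi>}"] dim_HS[OF N] by simp
qed

text \<open>Decompose \<open>v\<close> into its components in the quaternionic line and in the complement; the second inequality is that of
  Bessel for the orthogonal vectors \<open>\<xi>, I \<xi>, J \<xi>, K \<xi>\<close> of equal length.\<close>
lemma norm_nonneg_bessel:
  assumes pos: "pos_def B"
  shows "\<phi> \<xi> \<ge> 0" "Q \<phi> v v \<ge> 0" "Q \<phi> v v \<le> \<phi> \<xi> * B v v"
proof -
  have nn: "B w w \<ge> 0" for w
    using pos unfolding pos_def_on_def by (cases "w = 0") (auto simp: simps less_imp_le)
  show 0: "\<phi> \<xi> \<ge> 0"
    using nn[of \<xi>] by (simp add: \<xi>)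
  show "Q \<phi> v v \<ge> 0"
    by (simp add: Q_def)
  show "Q \<phi> v v \<le> \<phi> \<xi> * B v v"
  proof (cases "\<phi> \<xi> = 0")
    case True
    then have "\<xi> = 0"
      using pos \<xi>[of \<xi>] unfolding pos_def_on_def by force
    then have "\<phi> w = 0" for w
      using \<xi>[of w] by (simp add: simps)
    then show ?thesis
      by (simp add: Q_def)
  next
    case False
    obtain h u where hu: "h \<in> HS" "u \<in> perp" "v = h + u"
      using HS_perp_decomposition[OF False] .
    have q: "Q \<phi> v v = \<phi> \<xi> * B h h"
      using Q_HS[OF hu(1), of h] Q_perp[OF hu(2), of h] Q_perp[OF hu(2), of u] Q_sym[of \<phi> u h]
      by (simp add: hu(3) bilinear_simps[OF Q_bilinear[OF lin]])
    have b: "B v v = B h h + B u u"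
      using B_HS_perp[OF hu(1,2)] sym[of u h] by (simp add: hu(3) simps)
    show ?thesis
      unfolding q b using nn[of u] 0 by (simp add: mult_left_mono)
  qed
qed

lemma positive_combination:
  assumes pos: "pos_def B" and fac: "f = N + \<nu>" "N = \<phi> \<xi>" "\<nu> * f > 0"
  shows "pos_def (\<lambda>v w. 1 / \<nu>\<^sup>2 * f * (Q \<phi> v w + \<nu> * B v w))"
  unfolding pos_def_on_def
proof (intro ballI impI)
  fix v :: 'e assume "v \<noteq> 0"
  then have Bv: "B v v > 0"
    using pos by (simp add: pos_def_on_def)
  note b = norm_nonneg_bessel(2,3)[OF pos, of v]
  have "f * (Q \<phi> v v + \<nu> * B v v) > 0"
  proof (cases "\<nu> > 0")
    case True
    then have "f > 0" "Q \<phi> v v + \<nu> * B v v > 0"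
      using fac(3) b(1) Bv by (auto simp: zero_less_mult_iff intro: add_nonneg_pos)
    then show ?thesis by simp
  next
    case False
    then have f: "f < 0"
      using fac(3) by (auto simp: zero_less_mult_iff)
    have "Q \<phi> v v + \<nu> * B v v \<le> f * B v v"
      using b(2) by (simp add: fac(1,2) algebra_simps)
    also have "\<dots> < 0"
      using f Bv by (simp add: mult_neg_pos)
    finally show ?thesis
      using f by (simp add: mult_neg_neg)
  qed
  moreover have "1 / \<nu>\<^sup>2 > 0"
    using fac(3) by auto
  ultimately have "1 / \<nu>\<^sup>2 * (f * (Q \<phi> v v + \<nu> * B v v)) > 0"
    by (rule mult_pos_pos[rotated])
  then show "1 / \<nu>\<^sup>2 * f * (Q \<phi> v v + \<nu> * B v v) > 0"
    by (simp only: mult.assoc)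
qed

lemma signature_combination:
  assumes pos: "pos_def B" and fac: "f = N + \<nu>" "N = \<phi> \<xi>" "\<nu> * f < 0" and dim: "DIM('e) = 4 * n"
  defines "G \<equiv> \<lambda>v w. 1 / \<nu>\<^sup>2 * f * (Q \<phi> v w + \<nu> * B v w)"
  shows "has_signature G 4 (4 * (n - 1))" "pos_def_on HS G"
proof -
  have N0: "N \<ge> 0"
    using norm_nonneg_bessel(1)[OF pos] fac by simp
  have \<nu>: "\<nu> < 0"
  proof (rule ccontr)
    assume "\<not> \<nu> < 0"
    then have "\<nu> * f \<ge> 0"
      using N0 by (simp add: fac(1))
    then show False using fac(3) by simp
  qed
  then have f: "f > 0"
    using fac(3) by (simp add: mult_less_0_iff)
  then have N: "\<phi> \<xi> \<noteq> 0"
    using \<nu> fac by auto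
  have Bpos: "B v v > 0" if "v \<noteq> 0" for v
    using pos that by (simp add: pos_def_on_def)
  have c: "1 / \<nu>\<^sup>2 * f > 0"
    using \<nu> f by simp
  have GH: "G h w = (1 / \<nu>\<^sup>2 * f) * (f * B h w)" if "h \<in> HS" for h w
    using Q_HS[OF that, of w] by (simp add: G_def fac(1,2) algebra_simps)
  show P: "pos_def_on HS G"
    unfolding pos_def_on_def
  proof (intro ballI impI)
    fix h assume h: "h \<in> HS" "h \<noteq> 0"
    show "0 < G h h"
      unfolding GH[OF h(1)] by (intro mult_pos_pos[OF c] mult_pos_pos f Bpos h)
  qed
  have Gp: "- G u u > 0" if "u \<in> perp" "u \<noteq> 0" for u
  proof -
    have "- G u u = (1 / \<nu>\<^sup>2 * f) * (- \<nu> * B u u)"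
      using Q_perp[OF that(1), of u] by (simp add: G_def)
    also have "\<dots> > 0"
      using \<nu> Bpos[OF that(2)] by (intro mult_pos_pos[OF c] mult_pos_pos) simp_all
    finally show ?thesis .
  qed
  have "dim perp = 4 * (n - 1)"
    using dim_perp[OF N] dim by simp
  moreover have "4 + 4 * (n - 1) = DIM('e)"
    using dim_perp[OF N] dim by simp
  moreover have "G h u = 0" if "h \<in> HS" "u \<in> perp" for h u
    using GH[OF that(1)] B_HS_perp[OF that] by simp
  ultimately show "has_signature G 4 (4 * (n - 1))"
    unfolding has_signature_def
    using P Gp dim_HS[OF N] subspace_perp
    by (intro exI[of _ HS] exI[of _ perp]) (auto simp: pos_def_on_def)
qed

text \<open>In signature \<open>(4, 4 (n - 1))\<close> a four-dimensional positive subspace has a negative definite complement: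
  otherwise five dimensions without negative vectors would have to avoid a negative subspace of codimension four.\<close>
lemma perp_negative:
  assumes sig: "has_signature B 4 s" and pos: "pos_def_on HS B" and N: "\<phi> \<xi> \<noteq> 0"
    and u: "u \<in> perp" "u \<noteq> 0"
  shows "B u u < 0"
proof (rule ccontr)
  assume "\<not> B u u < 0"
  then have nn: "B u u \<ge> 0" by simp
  obtain Ng where Ng: "subspace Ng" "dim Ng = s" "4 + s = DIM('e)" "pos_def_on Ng (\<lambda>v w. - B v w)"
    using sig unfolding has_signature_def by blast
  have "u \<notin> HS"
  proof
    assume "u \<in> HS"
    then have "B u u > 0" "Q \<phi> u u = \<phi> \<xi> * B u u"
      using pos u Q_HS by (auto simp: pos_def_on_def)
    then show False
      using Q_perp[OF u(1), of u] N by simp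
  qed
  then have d: "dim (insert u HS) = 5"
    using dim_HS[OF N] by (simp add: dim_insert span_span)
  have W: "B w w \<ge> 0" if w: "w \<in> span (insert u HS)" for w
  proof -
    have "span (insert u HS) = {w. \<exists>k. w - k *\<^sub>R u \<in> HS}"
      using span_insert[of u HS] unfolding span_span .
    then obtain k where k: "w - k *\<^sub>R u \<in> HS"
      using w by blast
    let ?h = "w - k *\<^sub>R u"
    have "B w w = B (?h + k *\<^sub>R u) (?h + k *\<^sub>R u)"
      by simp
    also have "\<dots> = B ?h ?h + k * k * B u u"
      using B_HS_perp[OF k u(1)] sym[of u ?h] by (simp only: simps) simp
    also have "\<dots> \<ge> 0"
    proof -
      have "B ?h ?h \<ge> 0"
        using k pos by (cases "?h = 0") (auto simp: simps pos_def_on_def less_imp_le)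
      then show ?thesis using nn by simp
    qed
    finally show ?thesis .
  qed
  have "dim {x + y |x y. x \<in> span (insert u HS) \<and> y \<in> Ng} + dim (span (insert u HS) \<inter> Ng) = 5 + s"
    using dim_sums_Int[OF subspace_span Ng(1)] d Ng(2) by simp
  moreover have "dim {x + y |x y. x \<in> span (insert u HS) \<and> y \<in> Ng} \<le> DIM('e)"
    by (rule dim_subset_UNIV)
  ultimately have "dim (span (insert u HS) \<inter> Ng) \<noteq> 0"
    using Ng(3) by linarith
  then obtain w where "w \<in> span (insert u HS)" "w \<in> Ng" "w \<noteq> 0"
    unfolding dim_eq_0 by blast
  then show False
    using W[of w] Ng(4) by (force simp: pos_def_on_def)
qed

lemma positive_inverse_combination:
  assumes pos: "pos_def B" and fac: "f = p * \<phi> \<xi> + 1" "f > 0"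
  shows "pos_def (\<lambda>v w. - (p / f\<^sup>2) * Q \<phi> v w + 1 / f * B v w)"
  unfolding pos_def_on_def
proof (intro ballI impI)
  fix v :: 'e assume "v \<noteq> 0"
  then have Bv: "B v v > 0"
    using pos by (simp add: pos_def_on_def)
  note b = norm_nonneg_bessel(2,3)[OF pos, of v]
  have "f * B v v - p * Q \<phi> v v > 0"
  proof (cases "p > 0")
    case True
    then have "p * Q \<phi> v v \<le> p * (\<phi> \<xi> * B v v)"
      using b(2) by (intro mult_left_mono) auto
    then show ?thesis
      using Bv by (simp add: fac(1) algebra_simps)
  next
    case False
    then have "p * Q \<phi> v v \<le> 0"
      using b(1) by (simp add: mult_nonpos_nonneg)
    moreover have "f * B v v > 0"
      using fac(2) Bv by simp
    ultimately show ?thesis by linarith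
  qed
  then have "(f * B v v - p * Q \<phi> v v) / f\<^sup>2 > 0"
    using fac(2) by simp
  then show "- (p / f\<^sup>2) * Q \<phi> v v + 1 / f * B v v > 0"
    using fac(2) by (simp add: field_simps power2_eq_square)
qed

lemma signature_inverse_combination:
  assumes sig: "has_signature B 4 s" and pos: "pos_def_on HS B" and fac: "f = p * \<phi> \<xi> + 1" "f < 0"
  shows "pos_def (\<lambda>v w. - (p / f\<^sup>2) * Q \<phi> v w + 1 / f * B v w)"
  unfolding pos_def_on_def
proof (intro ballI impI)
  fix v :: 'e assume v: "v \<noteq> 0"
  have N: "\<phi> \<xi> \<noteq> 0"
    using fac by auto
  obtain h u where hu: "h \<in> HS" "u \<in> perp" "v = h + u"
    using HS_perp_decomposition[OF N] .
  have q: "Q \<phi> v v = \<phi> \<xi> * B h h"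
    using Q_HS[OF hu(1), of h] Q_perp[OF hu(2), of h] Q_perp[OF hu(2), of u] Q_sym[of \<phi> u h]
    by (simp add: hu(3) bilinear_simps[OF Q_bilinear[OF lin]])
  have b: "B v v = B h h + B u u"
    using B_HS_perp[OF hu(1,2)] sym[of u h] by (simp add: hu(3) simps)
  have h: "B h h > 0" if "h \<noteq> 0"
    using pos hu that by (simp add: pos_def_on_def)
  have u: "B u u < 0" if "u \<noteq> 0"
    using perp_negative[OF sig pos N hu(2) that] .
  have "B h h + f * B u u > 0"
  proof (cases "h = 0")
    case True
    then have "u \<noteq> 0" using v hu by simp
    then show ?thesis
      using u fac(2) True by (simp add: simps mult_neg_neg)
  next
    case False
    have "f * B u u \<ge> 0"
      using u fac(2) by (cases "u = 0") (auto simp: simps mult_nonpos_nonpos less_imp_le)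
    then show ?thesis
      using h[OF False] by simp
  qed
  then have "(B h h + f * B u u) / f\<^sup>2 > 0"
    using fac(2) by simp
  moreover have "f * B v v - p * Q \<phi> v v = B h h + f * B u u"
    unfolding q b by (simp add: fac(1) algebra_simps)
  ultimately have "(f * B v v - p * Q \<phi> v v) / f\<^sup>2 > 0"
    by simp
  then show "- (p / f\<^sup>2) * Q \<phi> v v + 1 / f * B v v > 0"
    using fac(2) by (simp add: field_simps power2_eq_square)
qed

end

end

section \<open>Tensor fields on overlaps of charts\<close>

lemma pseudo_riemannian_smooth: "pseudo_riemannian M g \<Longrightarrow> smooth_manifold M"
  by (simp add: pseudo_riemannian_def)

lemma pseudo_riemannian_scalar_product:
  assumes "pseudo_riemannian M g" "x \<in> chart_dom M i"
  shows "scalar_product (g i x)"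
proof
  show "bilinear (g i x)"
    using assms by (simp add: pseudo_riemannian_def bilinear_field_def)
  show "g i x v w = g i x w v" for v w
    using assms unfolding pseudo_riemannian_def by blast
  show "v = 0" if "\<And>w. g i x v w = 0" for v
    using assms that unfolding pseudo_riemannian_def by blast
qed

lemma pseudo_riemannian_change:
  "pseudo_riemannian M g \<Longrightarrow> x \<in> chart_dom M i \<Longrightarrow> x \<in> chart_dom M j \<Longrightarrow>
   g j x (jac M i j x v) (jac M i j x w) = g i x v w"
  by (simp add: pseudo_riemannian_def bilinear_field_def)

lemma pseudo_riemannian_metric_chart:
  assumes "pseudo_riemannian M g"
  shows "metric_chart M i g"
  using assms
  by (intro metric_chart.intro[OF smooth_manifold_chart metric_chart_axioms.intro] pseudo_riemannian_scalar_product)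
    (simp_all add: pseudo_riemannian_def bilinear_field_def)

lemma endo_field_linear: "endo_field M A \<Longrightarrow> x \<in> chart_dom M i \<Longrightarrow> linear (A i x)"
  and endo_field_smooth: "endo_field M A \<Longrightarrow> smooth_in_chart M i (\<lambda>x. A i x v)"
  and endo_field_change: "endo_field M A \<Longrightarrow> x \<in> chart_dom M i \<Longrightarrow> x \<in> chart_dom M j \<Longrightarrow>
    A j x (jac M i j x v) = jac M i j x (A i x v)"
  by (simp_all add: endo_field_def)

lemma almost_hypercomplex_quaternionic:
  assumes "almost_hypercomplex M I J K" "x \<in> chart_dom M i"
  shows "quaternionic_space (I i x) (J i x) (K i x)"
proof (rule quaternionic_space.intro)
  show "linear (I i x)" "linear (J i x)" "linear (K i x)"
    using assms by (auto simp: almost_hypercomplex_def almost_complex_def intro: endo_field_linear)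
qed (use assms in \<open>simp_all add: almost_hypercomplex_def almost_complex_def\<close>)

lemma hyperhermitian_chartI:
  assumes g: "pseudo_riemannian M g" and h: "almost_hypercomplex M I J K"
    and orth: "orthogonal_endo M g I" "orthogonal_endo M g J" "orthogonal_endo M g K"
  shows "hyperhermitian_chart M i g I J K"
proof (rule hyperhermitian_chart.intro[OF pseudo_riemannian_metric_chart[OF g] hyperhermitian_chart_axioms.intro])
  show "hermitian_space (g i x) (I i x) (J i x) (K i x)" if x: "x \<in> chart_dom M i" for x
    by (rule hermitian_space.intro[OF pseudo_riemannian_scalar_product[OF g x]
          almost_hypercomplex_quaternionic[OF h x] hermitian_space_axioms.intro])
      (use orth x in \<open>simp_all add: orthogonal_endo_def\<close>)
qed (use h in \<open>auto simp: almost_hypercomplex_def almost_complex_def intro: endo_field_smooth\<close>)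

locale overlap =
  fixes M :: "('a, 'i, 'e::euclidean_space) manifold" and i j and x :: 'a
  assumes M: "smooth_manifold M" and xi: "x \<in> chart_dom M i" and xj: "x \<in> chart_dom M j"
begin

abbreviation D where "D \<equiv> chart_dom M i \<inter> chart_dom M j"

sublocale part: open_part M D
proof
  show "smooth_manifold M" by (rule M)
  show "openin (points M) D" by (intro openin_Int chart_dom_openin M)
qed

lemma pair: "chart_pair part.N i j"
  using part.smooth_N by unfold_locales auto

lemma jac_inverse: "jac M j i x (jac M i j x v) = v"
  using chart_pair.jac_inverse[OF pair, of x v] xi xj by (simp add: part.jac_N)

lemma diff_change:
  assumes "smooth_function M \<mu>"
  shows "pd M j \<mu> x (jac M i j x v) = pd M i \<mu> x v"
proof -
  have "smooth_in_chart part.N j \<mu>"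
    using assms by (simp add: smooth_function_def part.smooth_in_chart_N)
  from chart_pair.pd_change[OF pair this, of x v] show ?thesis
    using xi xj by (simp add: part.jac_N part.pd_N)
qed

lemma lee_form_change:
  assumes g: "pseudo_riemannian M g" and A: "endo_field M A"
  shows "lee_form M g A j x (jac M i j x v) = lee_form M g A i x v"
proof -
  interpret metric_chart_pair part.N i j g
  proof (rule metric_chart_pair.intro[OF pair metric_chart_pair_axioms.intro])
    show "metric_chart part.N i g" "metric_chart part.N j g"
      by (rule part.metric_chart_N[OF pseudo_riemannian_metric_chart[OF g]])+
    show "g j y (jac part.N i j y v) (jac part.N i j y w) = g i y v w" if "y \<in> chart_dom part.N i" for y v w
      using that pseudo_riemannian_change[OF g] by (simp add: part.jac_N)
  qed
  have lee: "lee_form part.N g A k x v = lee_form M g A k x v" if "x \<in> chart_dom M k" for k v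
    using that xi xj by (simp add: lee_form_def part.nabla_endo_N)
  have "lee_form part.N g A j x (jac part.N i j x v) = lee_form part.N g A i x v"
  proof (rule lee_form_change)
    show "linear (A k y)" if "y \<in> chart_dom part.N k" for k y
      using that endo_field_linear[OF A] by simp
    show "smooth_in_chart part.N k (\<lambda>x. A k x v)" for k v
      by (rule part.smooth_in_chart_N[OF endo_field_smooth[OF A]])
    show "A j y (jac part.N i j y v) = jac part.N i j y (A i y v)" if "y \<in> chart_dom part.N i" for y v
      using that endo_field_change[OF A] by (simp add: part.jac_N)
  qed (use xi xj in simp)
  then show ?thesis
    using xi xj by (simp add: part.jac_N lee)
qed

end

text \<open>The chart that enters the definition is an arbitrary choice; the dual vectors in two charts correspond under the
  Jacobian.\<close>
lemma form_prod_chart: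
  assumes g: "pseudo_riemannian M g"
    and lin: "\<And>k. x \<in> chart_dom M k \<Longrightarrow> linear (\<alpha> k x)"
    and change: "\<And>k v. x \<in> chart_dom M k \<Longrightarrow> \<alpha> k x (jac M i k x v) = \<alpha> i x v"
    and x: "x \<in> chart_dom M i"
  shows "form_prod M g \<alpha> \<alpha> x = g i x (sharp (g i x) (\<alpha> i x)) (sharp (g i x) (\<alpha> i x))"
proof -
  define k where "k = (SOME k. x \<in> chart_dom M k)"
  have xk: "x \<in> chart_dom M k"
    unfolding k_def using x by (rule someI)
  interpret o: overlap M k i x
    using x xk pseudo_riemannian_smooth[OF g] by unfold_locales
  let ?s = "sharp (g i x) (\<alpha> i x)" and ?J = "jac M i k x" and ?J' = "jac M k i x"
  interpret gi: scalar_product "g i x" by (rule pseudo_riemannian_scalar_product[OF g x])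
  interpret gk: scalar_product "g k x" by (rule pseudo_riemannian_scalar_product[OF g xk])
  have "g k x (?J ?s) w = \<alpha> k x w" for w
  proof -
    have "g k x (?J ?s) w = g k x (?J ?s) (?J (?J' w))"
      by (simp add: o.jac_inverse)
    also have "\<dots> = \<alpha> i x (?J' w)"
      using pseudo_riemannian_change[OF g x xk] gi.sharp[OF lin[OF x]] by simp
    also have "\<dots> = \<alpha> k x w"
      using change[OF xk, of "?J' w"] by (simp add: o.jac_inverse)
    finally show ?thesis .
  qed
  then have "sharp (g k x) (\<alpha> k x) = ?J ?s"
    by (rule gk.sharp_eqI)
  then show ?thesis
    unfolding form_prod_def k_def[symmetric] by (simp add: pseudo_riemannian_change[OF g x xk])
qed

section \<open>Quaternionic Kaehler manifolds with closed Lee form\<close>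

lemma in_endo_span:
  assumes "A \<in> {I, J, K}"
  shows "A i x \<in> endo_span I J K i x"
proof -
  have "I i x \<in> endo_span I J K i x"
    unfolding endo_span_def by (rule CollectI, rule exI[of _ 1], rule exI[of _ 0], rule exI[of _ 0]) simp
  moreover have "J i x \<in> endo_span I J K i x"
    unfolding endo_span_def by (rule CollectI, rule exI[of _ 0], rule exI[of _ 1], rule exI[of _ 0]) simp
  moreover have "K i x \<in> endo_span I J K i x"
    unfolding endo_span_def by (rule CollectI, rule exI[of _ 0], rule exI[of _ 0], rule exI[of _ 1]) simp
  ultimately show ?thesis
    using assms by auto
qed

lemma span_H_eq:
  assumes h: "hermitian_space (g i x) (I i x) (J i x) (K i x)" and lin: "linear (\<psi> i x)"
  defines "s \<equiv> sharp (g i x) (\<psi> i x)"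
  shows "span_H g I J K \<psi> i x = span {s, I i x s, J i x s, K i x s}"
proof -
  interpret h: hermitian_space "g i x" "I i x" "J i x" "K i x" by (rule h)
  have s: "g i x s w = \<psi> i x w" for w
    unfolding s_def by (rule h.sharp[OF lin])
  have "sharp (g i x) (act_form I \<psi> i x) = I i x s"
    by (rule h.sharp_eqI) (use h.skewI[of s] in \<open>simp add: act_form_def s\<close>)
  moreover have "sharp (g i x) (act_form J \<psi> i x) = J i x s"
    by (rule h.sharp_eqI) (use h.skewJ[of s] in \<open>simp add: act_form_def s\<close>)
  moreover have "sharp (g i x) (act_form K \<psi> i x) = K i x s"
    by (rule h.sharp_eqI) (use h.skewK[of s] in \<open>simp add: act_form_def s\<close>)
  ultimately show ?thesis
    by (simp add: span_H_def s_def)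
qed

text \<open>An orthogonal complex structure is skew. Skewness passes to linear combinations, and a skew complex structure
  is orthogonal.\<close>
lemma skew_combination_orthogonal:
  assumes "scalar_product B"
    and "\<And>v. A v = a *\<^sub>R I v + b *\<^sub>R J v + c *\<^sub>R K v" "\<And>v. A (A v) = - v"
    and "\<And>v. I (I v) = - v" "\<And>v. J (J v) = - v" "\<And>v. K (K v) = - v"
    and "\<And>v w. B (I v) (I w) = B v w" "\<And>v w. B (J v) (J w) = B v w" "\<And>v w. B (K v) (K w) = B v w"
  shows "B (A v) (A w) = B v w"
proof -
  interpret scalar_product B by fact
  have "B (I v) w = - B v (I w)" "B (J v) w = - B v (J w)" "B (K v) w = - B v (K w)" for v w
    using assms(7)[of v "I w"] assms(8)[of v "J w"] assms(9)[of v "K w"] by (simp_all add: assms(4-6) simps)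
  then have "B (A v) w = - B v (A w)" for v w
    by (simp add: assms(2) simps)
  from this[of v "A w"] show ?thesis
    by (simp add: assms(3) simps)
qed

locale closed_hhqk =
  fixes M :: "('a, 'i, 'e::euclidean_space) manifold" and g I J K \<nu>
  assumes hhqk: "hHqK M g I J K" and reduced: "has_reduced_scalar_curvature M g \<nu>"
    and closed: "closed_form M (lee_form M g I)"
    and nz: "\<And>x. x \<in> topspace (points M) \<Longrightarrow> form_prod M g (lee_form M g I) (lee_form M g I) x + \<nu> \<noteq> 0"
    and dim: "DIM('e) > 4"
begin

abbreviation \<phi> where "\<phi> \<equiv> lee_form M g I"
abbreviation g0 where "g0 \<equiv> hk_metric M g I J K \<nu>"
abbreviation \<mu> where "\<mu> \<equiv> hk_potential M g I \<nu>"

lemma metric: "pseudo_riemannian M g" and pos: "x \<in> chart_dom M i \<Longrightarrow> pos_def (g i x)"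
  using hhqk by (auto simp: hHqK_def riemannian_def)

lemma M: "smooth_manifold M"
  by (rule pseudo_riemannian_smooth[OF metric])

lemma topspace: "x \<in> chart_dom M i \<Longrightarrow> x \<in> topspace (points M)"
  using chart_dom_topspace[OF M] by blast

lemma qk: "pseudo_quaternionic_kaehler M g (endo_span I J K)"
  and hypercomplex: "hypercomplex M I J K"
  using hhqk by (auto simp: hHqK_def pseudo_hHqK_def)

lemma ahc: "almost_hypercomplex M I J K"
  using hypercomplex by (simp add: hypercomplex_def)

lemma endo: "A \<in> {I, J, K} \<Longrightarrow> endo_field M A"
  using ahc by (auto simp: almost_hypercomplex_def almost_complex_def)

text \<open>Orthogonality is given for local trivializations of the bundle, of which \<open>I, J, K\<close> are combinations.\<close>
lemma orthogonal:
  assumes A: "A \<in> {I, J, K}"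
  shows "orthogonal_endo M g A"
  unfolding orthogonal_endo_def
proof (intro allI ballI)
  fix i x v w assume x: "x \<in> chart_dom M i"
  obtain U I' J' K' where U: "openin (points M) U" "x \<in> U" "almost_hypercomplex (submanifold M U) I' J' K'"
    "orthogonal_endo (submanifold M U) g I'" "orthogonal_endo (submanifold M U) g J'"
    "orthogonal_endo (submanifold M U) g K'"
    "\<forall>i. \<forall>y\<in>chart_dom M i \<inter> U. endo_span I J K i y = endo_span I' J' K' i y"
    using qk topspace[OF x] unfolding pseudo_quaternionic_kaehler_def by meson
  have xU: "x \<in> chart_dom (submanifold M U) i"
    using x U(2) by simp
  interpret q': quaternionic_space "I' i x" "J' i x" "K' i x"
    by (rule almost_hypercomplex_quaternionic[OF U(3) xU])
  have "A i x \<in> endo_span I' J' K' i x"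
    using in_endo_span[OF A, of i x] U(7) x U(2) by auto
  then obtain a b c where abc: "A i x = (\<lambda>v. a *\<^sub>R I' i x v + b *\<^sub>R J' i x v + c *\<^sub>R K' i x v)"
    by (auto simp: endo_span_def)
  show "g i x (A i x v) (A i x w) = g i x v w"
  proof (rule skew_combination_orthogonal[OF pseudo_riemannian_scalar_product[OF metric x]])
    show "A i x v = a *\<^sub>R I' i x v + b *\<^sub>R J' i x v + c *\<^sub>R K' i x v" for v
      by (simp add: abc)
    show "A i x (A i x v) = - v" for v
      using A ahc x by (auto simp: almost_hypercomplex_def almost_complex_def)
  qed (use U(4-6) xU in \<open>simp_all add: q'.quat orthogonal_endo_def\<close>)
qed

lemma hyperhermitian: "hyperhermitian_chart M i g I J K"
  by (rule hyperhermitian_chartI[OF metric ahc]) (rule orthogonal; simp)+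

lemma parallel:
  assumes A: "A \<in> {I, J, K}" and x: "x \<in> chart_dom M i"
  shows "nabla_endo M g A i x z \<in> endo_span I J K i x"
proof -
  have p: "parallel_subbundle M g (endo_span I J K)"
    using qk by (simp add: pseudo_quaternionic_kaehler_def)
  have "nabla_endo (submanifold M (topspace (points M))) g A i x z \<in> endo_span I J K i x"
    using p[unfolded parallel_subbundle_def, rule_format, of "topspace (points M)" A x i z]
    using endo[OF A] in_endo_span[OF A] x topspace by (simp add: submanifold_topspace[OF M])
  then show ?thesis
    by (simp add: submanifold_topspace[OF M])
qed

lemma lee: "lee_chart M i g I J K (\<phi> i)"
  by (rule hyperhermitian_chart.lee_chartI[OF hyperhermitian dim parallel])
    (use hypercomplex in \<open>auto simp: hypercomplex_def integrable_acs_def\<close>)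

lemma closed_lee: "closed_lee_chart M i g I J K (\<phi> i) \<nu>"
proof (rule closed_lee_chart.intro[OF lee closed_lee_chart_axioms.intro[OF dim]])
  show "pd M i (\<lambda>y. \<phi> i y v) x u = pd M i (\<lambda>y. \<phi> i y u) x v" if "x \<in> chart_dom M i" for x u v
    using closed that by (simp add: closed_form_def ext_diff_def)
  show "reduced_scalar_curvature M g i x = \<nu>" if "x \<in> chart_dom M i" for x
    using reduced that by (simp add: has_reduced_scalar_curvature_def)
qed

lemma \<phi>_linear: "x \<in> chart_dom M i \<Longrightarrow> linear (\<phi> i x)"
  using lee_chart.lin_\<phi>[OF lee] .

lemma \<phi>_change:
  assumes "x \<in> chart_dom M i" "x \<in> chart_dom M j"
  shows "\<phi> j x (jac M i j x v) = \<phi> i x v"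
proof -
  interpret overlap M i j x
    using assms M by unfold_locales
  show ?thesis
    by (rule lee_form_change[OF metric endo]) simp
qed

lemma form_prod_\<phi>:
  assumes x: "x \<in> chart_dom M i"
  shows "form_prod M g \<phi> \<phi> x = g i x (sharp (g i x) (\<phi> i x)) (sharp (g i x) (\<phi> i x))"
  by (rule form_prod_chart[OF metric _ _ x]) (use \<phi>_linear \<phi>_change x in auto)

lemma to_chart: "to_hyperkaehler_chart M i g I J K (\<phi> i) \<nu> g0"
proof -
  interpret c: closed_lee_chart M i g I J K "\<phi> i" \<nu> by (rule closed_lee)
  show ?thesis
  proof (rule to_hyperkaehler_chart.intro[OF closed_lee to_hyperkaehler_chart_axioms.intro])
    fix x assume x: "x \<in> chart_dom M i"
    have n: "form_prod M g \<phi> \<phi> x = c.norm2 x"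
      by (simp add: form_prod_\<phi>[OF x] c.norm2_def)
    have "scalar_curvature M g i x \<noteq> 0"
      using qk x by (simp add: pseudo_quaternionic_kaehler_def)
    moreover have "reduced_scalar_curvature M g i x = \<nu>"
      by (rule c.\<nu>[OF x])
    ultimately show "\<nu> \<noteq> 0"
      using dim by (auto simp: reduced_scalar_curvature_def Let_def)
    show "c.f x \<noteq> 0"
      using nz[OF topspace[OF x]] by (simp add: n c.f_def)
    show "g0 i x v w = 1 / \<nu>\<^sup>2 * c.f x * (c.Qx x v w + \<nu> * g i x v w)" for v w
      by (simp add: hk_metric_def n c.f_def one_plus_L_def L_op_def tensor_prod_def Let_def
          quaternionic_space.Q_def[OF c.quaternionic[OF x]])
  qed
qed

text \<open>The change of coordinates of \<open>g0\<close> rests on that of the Lee form.\<close>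
lemma pseudo_riemannian0: "pseudo_riemannian M g0"
proof -
  have sp: "scalar_product (g0 i x)" if "x \<in> chart_dom M i" for i x
    using hermitian_space.axioms(1)[OF to_hyperkaehler_chart.hermitian0[OF to_chart that]] .
  have "g0 j x (jac M i j x v) (jac M i j x w) = g0 i x v w"
    if x: "x \<in> chart_dom M i" "x \<in> chart_dom M j" for i j x v w
    by (simp add: hk_metric_def one_plus_L_def L_op_def tensor_prod_def pseudo_riemannian_change[OF metric x]
        \<phi>_change[OF x] endo_field_change[OF endo x])
  then show ?thesis
    using M sp scalar_product.bilinear[OF sp] scalar_product.sym[OF sp] scalar_product.nondegenerate[OF sp]
      to_hyperkaehler_chart.sm_g0[OF to_chart]
    unfolding pseudo_riemannian_def bilinear_field_def by blast
qed

lemma cyclic_charts: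
  "to_hyperkaehler_chart M i g J K I (\<phi> i) \<nu> g0" "to_hyperkaehler_chart M i g K I J (\<phi> i) \<nu> g0"
  by (rule to_hyperkaehler_chart.to_hyperkaehler_cyclic[OF to_chart]
      to_hyperkaehler_chart.to_hyperkaehler_cyclic[OF to_hyperkaehler_chart.to_hyperkaehler_cyclic[OF to_chart]])+

lemma hyperkaehler0: "pseudo_hyperkaehler M g0 I J K"
  unfolding pseudo_hyperkaehler_def
proof (intro conjI ballI pseudo_riemannian0 ahc)
  fix A assume A: "A \<in> {I, J, K}"
  show "orthogonal_endo M g0 A"
    unfolding orthogonal_endo_def
  proof (intro allI ballI)
    fix i x v w assume x: "x \<in> chart_dom M i"
    interpret h: hermitian_space "g0 i x" "I i x" "J i x" "K i x"
      by (rule to_hyperkaehler_chart.hermitian0[OF to_chart x])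
    show "g0 i x (A i x v) (A i x w) = g0 i x v w"
      using A h.orthI h.orthJ h.orthK by auto
  qed
  show "\<forall>i. \<forall>x\<in>chart_dom M i. \<forall>v w. nabla_endo M g0 A i x v w = 0"
    using A to_hyperkaehler_chart.parallel0_I[OF to_chart] to_hyperkaehler_chart.parallel0_I[OF cyclic_charts(1)]
      to_hyperkaehler_chart.parallel0_I[OF cyclic_charts(2)] by auto
qed

lemma potential_value:
  assumes x: "x \<in> chart_dom M i"
  shows "\<mu> x = 2 / \<nu>\<^sup>2 * closed_lee_chart.f i g (\<phi> i) \<nu> x"
proof -
  interpret c: closed_lee_chart M i g I J K "\<phi> i" \<nu> by (rule closed_lee)
  show ?thesis
    by (simp add: hk_potential_def Let_def form_prod_\<phi>[OF x] c.f_def c.norm2_def)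
qed

lemma potential0: "hyperkaehler_potential M g0 I J K \<mu>"
  unfolding hyperkaehler_potential_def
proof (intro conjI ballI allI)
  show "smooth_function M \<mu>"
    unfolding smooth_function_def
  proof
    fix i
    interpret t: to_hyperkaehler_chart M i g I J K "\<phi> i" \<nu> g0 by (rule to_chart)
    show "smooth_in_chart M i \<mu>"
      by (rule t.sm_cong[where f = "\<lambda>x. 2 / \<nu>\<^sup>2 * t.f x"])
        (auto intro!: t.sm_mult t.sm_const t.sm_f simp only: potential_value)
  qed
  fix A i x v w assume A: "A \<in> {I, J, K}" and x: "x \<in> chart_dom M i"
  interpret t: to_hyperkaehler_chart M i g I J K "\<phi> i" \<nu> g0 by (rule to_chart)
  show "1/2 * ext_diff M (act_form A (diff M \<mu>)) i x v w = fund_form g0 A i x v w"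
    using A to_hyperkaehler_chart.potential_I[OF to_chart potential_value x]
      to_hyperkaehler_chart.potential_I[OF cyclic_charts(1) potential_value x]
      to_hyperkaehler_chart.potential_I[OF cyclic_charts(2) potential_value x]
    by (auto simp: fund_form_def)
qed

lemma signatures:
  assumes x: "x \<in> chart_dom M i" and n: "DIM('e) = 4 * n"
  shows "\<nu> * (form_prod M g \<phi> \<phi> x + \<nu>) > 0 \<Longrightarrow> pos_def (g0 i x)"
    "\<nu> > 0 \<Longrightarrow> pos_def (g0 i x)"
    "\<nu> * (form_prod M g \<phi> \<phi> x + \<nu>) < 0 \<Longrightarrow>
      has_signature (g0 i x) 4 (4 * (n - 1)) \<and> pos_def_on (span_H g I J K \<phi> i x) (g0 i x)"
proof -
  interpret t: to_hyperkaehler_chart M i g I J K "\<phi> i" \<nu> g0 by (rule to_chart)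
  interpret h: hermitian_space "g i x" "I i x" "J i x" "K i x" by (rule t.hermitian[OF x])
  have N: "form_prod M g \<phi> \<phi> x = t.norm2 x"
    by (simp add: form_prod_\<phi>[OF x] t.norm2_def)
  have g0: "g0 i x = (\<lambda>v w. 1 / \<nu>\<^sup>2 * t.f x * (h.Q (\<phi> i x) v w + \<nu> * g i x v w))"
    by (intro ext) (rule t.g0[OF x])
  note fac = t.f_def[of x] t.norm2_eq[OF x]
  show 1: "pos_def (g0 i x)" if "\<nu> * (form_prod M g \<phi> \<phi> x + \<nu>) > 0"
    unfolding g0
    by (rule h.positive_combination[OF t.lin_\<phi>[OF x] t.dual[OF x] pos[OF x] fac])
      (use that in \<open>simp add: N t.f_def\<close>)
  show "pos_def (g0 i x)" if "\<nu> > 0"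
  proof (rule 1)
    have "t.norm2 x \<ge> 0"
      unfolding fac(2) by (rule h.norm_nonneg_bessel(1)[OF t.lin_\<phi>[OF x] t.dual[OF x] pos[OF x]])
    then show "\<nu> * (form_prod M g \<phi> \<phi> x + \<nu>) > 0"
      unfolding N using that by simp
  qed
  show "has_signature (g0 i x) 4 (4 * (n - 1)) \<and> pos_def_on (span_H g I J K \<phi> i x) (g0 i x)"
    if "\<nu> * (form_prod M g \<phi> \<phi> x + \<nu>) < 0"
  proof -
    have neg: "\<nu> * t.f x < 0"
      using that by (simp add: N t.f_def)
    show ?thesis
      unfolding g0 span_H_eq[where g = g and I = I and J = J and K = K and \<psi> = \<phi> and i = i and x = x,
          OF t.hermitian[OF x] t.lin_\<phi>[OF x]]
      using h.signature_combination[OF t.lin_\<phi>[OF x] t.dual[OF x] pos[OF x] fac neg n] by blast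
  qed
qed

lemma recovers_metric:
  assumes x: "x \<in> chart_dom M i"
  shows "conf_factor M g0 \<mu> (1/4 * \<nu>) x \<noteq> 0"
    "qk_metric M g0 I J K \<mu> (1/4 * \<nu>) i x v w = g i x v w"
proof -
  interpret t: to_hyperkaehler_chart M i g I J K "\<phi> i" \<nu> g0 by (rule to_chart)
  have smooth: "smooth_function M \<mu>"
    using potential0 by (simp add: hyperkaehler_potential_def)
  have lin: "linear (diff M \<mu> k x)" if "x \<in> chart_dom M k" for k
  proof -
    interpret k: chart M k by (rule smooth_manifold_chart[OF M])
    show ?thesis
      using k.linear_pd[of \<mu> x] smooth that by (simp add: diff_def[abs_def] smooth_function_def)
  qed
  have change: "diff M \<mu> k x (jac M i k x v) = diff M \<mu> i x v" if "x \<in> chart_dom M k" for k v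
  proof -
    interpret overlap M i k x
      using x that M by unfold_locales
    show ?thesis
      by (simp add: diff_def diff_change[OF smooth])
  qed
  have d: "diff M \<mu> i x = (\<lambda>u. - 2 * t.f x / \<nu>\<^sup>2 * \<phi> i x u)"
    by (intro ext) (simp only: diff_def t.diff_potential[OF potential_value x])
  have "form_prod M g0 (diff M \<mu>) (diff M \<mu>) x =
      g0 i x (sharp (g0 i x) (diff M \<mu> i x)) (sharp (g0 i x) (diff M \<mu> i x))"
    by (rule form_prod_chart[OF pseudo_riemannian0 _ _ x]) (rule lin change; assumption)+
  also have "\<dots> = 4 * t.norm2 x / \<nu>\<^sup>2"
    unfolding d by (rule t.norm_potential[OF x])
  finally have "form_prod M g0 (diff M \<mu>) (diff M \<mu>) x = 4 * t.norm2 x / \<nu>\<^sup>2" .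
  then have c: "conf_factor M g0 \<mu> (1/4 * \<nu>) x = 1/4 * \<nu> * (4 * t.norm2 x / \<nu>\<^sup>2) + 1"
    by (simp add: conf_factor_def)
  show "conf_factor M g0 \<mu> (1/4 * \<nu>) x \<noteq> 0"
    by (rule t.recover_metric(1)[OF x c])
  show "qk_metric M g0 I J K \<mu> (1/4 * \<nu>) i x v w = g i x v w"
    using t.recover_metric(2)[OF x c, of v w]
    by (simp only: qk_metric_def one_plus_L_def L_op_def tensor_prod_def d
        quaternionic_space.Q_def[OF t.quaternionic[OF x]] add.assoc)
qed

end

section \<open>Hyper-Kaehler manifolds with potential\<close>

context lee_chart
begin

text \<open>The bundle is parallel as soon as the derivatives of \<open>I, J, K\<close> have values in it; a smooth section has smooth
  coefficients.\<close>
lemma nabla_endo_span: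
  assumes A: "\<And>x. x \<in> dom \<Longrightarrow> linear (A i x)" "\<And>v. sm (\<lambda>x. A i x v)"
    and A_span: "\<And>x. x \<in> dom \<Longrightarrow> A i x \<in> endo_span I J K i x" and x: "x \<in> dom"
  shows "nabla_endo M g A i x z \<in> endo_span I J K i x"
proof -
  interpret j: lee_chart M i g J K I \<phi> by (rule lee_cyclic)
  interpret k: lee_chart M i g K I J \<phi> by (rule j.lee_cyclic)
  \<comment> \<open>The coefficients of \<open>A\<close> are smooth because they are traces.\<close>
  let ?c = "\<lambda>L y. - 1 / DIM('e) * lin_trace (\<lambda>v. L i y (A i y v))"
  have sm_c: "sm (?c I)" "sm (?c J)" "sm (?c K)"
    by (intro sm_mult sm_const sm_lin_trace sm_I' sm_J' sm_K' A(2))+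
  have A_eq: "A i y v = ?c I y *\<^sub>R I i y v + ?c J y *\<^sub>R J i y v + ?c K y *\<^sub>R K i y v"
    if y: "y \<in> dom" for y v
  proof -
    interpret h: hermitian_space "g i y" "I i y" "J i y" "K i y" by (rule hermitian[OF y])
    obtain a b c where abc: "A i y = (\<lambda>v. a *\<^sub>R I i y v + b *\<^sub>R J i y v + c *\<^sub>R K i y v)"
      using A_span[OF y] by (auto simp: endo_span_def)
    have "?c I y = a" "?c J y = b" "?c K y = c"
      by (simp_all add: abc h.lin_simps h.quat lin_trace_add lin_trace_diff lin_trace_minus lin_trace_scaleR
          h.traces lin_trace_id)
    then show ?thesis by (simp add: abc)
  qed
  define a b c where "a = ?c I" and "b = ?c J" and "c = ?c K"
  note sm_c' = sm_c[folded a_def b_def c_def]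
  have A_eq': "A i y v = a y *\<^sub>R I i y v + b y *\<^sub>R J i y v + c y *\<^sub>R K i y v" if "y \<in> dom" for y v
    unfolding a_def b_def c_def by (rule A_eq[OF that])
  have n: "\<nabla> z (\<lambda>y. L i y v) x = L i x (\<Gamma> x z v) + nabla_endo M g L i x z v" for L :: "('a, 'i, 'e) endo" and v
    by (simp add: nabla_endo_def nabla_const)
  have "nabla_endo M g A i x z v =
      (pd M i a x z + b x * \<phi> x (K i x z) - c x * \<phi> x (J i x z)) *\<^sub>R I i x v
    + (pd M i b x z + c x * \<phi> x (I i x z) - a x * \<phi> x (K i x z)) *\<^sub>R J i x v
    + (pd M i c x z + a x * \<phi> x (J i x z) - b x * \<phi> x (I i x z)) *\<^sub>R K i x v" for v
  proof -
    have "\<nabla> z (\<lambda>y. A i y v) x = \<nabla> z (\<lambda>y. a y *\<^sub>R I i y v + b y *\<^sub>R J i y v + c y *\<^sub>R K i y v) x"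
      by (rule nabla_cong[OF x A_eq'])
    also have "\<dots> = a x *\<^sub>R \<nabla> z (\<lambda>y. I i y v) x + pd M i a x z *\<^sub>R I i x v
        + (b x *\<^sub>R \<nabla> z (\<lambda>y. J i y v) x + pd M i b x z *\<^sub>R J i x v)
        + (c x *\<^sub>R \<nabla> z (\<lambda>y. K i y v) x + pd M i c x z *\<^sub>R K i x v)"
      by (simp only: nabla_add nabla_scaleR sm_add sm_scaleR sm_I sm_J sm_K sm_c' x)
    finally show ?thesis
      unfolding n nabla_I[OF x] nabla_J[OF x] nabla_K[OF x] A_eq'[OF x] by (simp add: algebra_simps)
  qed
  then show ?thesis
    unfolding endo_span_def by (intro CollectI exI conjI ext TrueI)
qed

end

locale hk_with_potential =
  fixes M :: "('a, 'i, 'e::euclidean_space) manifold" and g0 I J K \<mu> and p :: real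
  assumes hk: "pseudo_hyperkaehler M g0 I J K" and pot: "hyperkaehler_potential M g0 I J K \<mu>"
    and p: "p \<noteq> 0" and dim: "\<exists>n>1. DIM('e) = 4 * n"
begin

abbreviation f where "f \<equiv> conf_factor M g0 \<mu> p"
abbreviation gp where "gp \<equiv> qk_metric M g0 I J K \<mu> p"
abbreviation V where "V \<equiv> {x \<in> topspace (points M). f x \<noteq> 0}"
abbreviation Mp where "Mp \<equiv> submanifold M V"

lemma dim4: "DIM('e) > 4"
  using dim by auto

lemma metric: "pseudo_riemannian M g0"
  and ahc: "almost_hypercomplex M I J K"
  and orthogonal: "A \<in> {I, J, K} \<Longrightarrow> orthogonal_endo M g0 A"
  and parallel: "A \<in> {I, J, K} \<Longrightarrow> x \<in> chart_dom M i \<Longrightarrow> nabla_endo M g0 A i x v w = 0"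
  using hk unfolding pseudo_hyperkaehler_def by blast+

lemma M: "smooth_manifold M"
  by (rule pseudo_riemannian_smooth[OF metric])

lemma endo: "A \<in> {I, J, K} \<Longrightarrow> endo_field M A"
  using ahc by (auto simp: almost_hypercomplex_def almost_complex_def)

lemma smooth: "smooth_function M \<mu>"
  using pot by (simp add: hyperkaehler_potential_def)

lemma hyperkaehler: "hyperkaehler_chart M i g0 I J K \<mu>"
proof -
  interpret h: hyperhermitian_chart M i g0 I J K
    by (rule hyperhermitian_chartI[OF metric ahc]) (rule orthogonal; simp)+
  have sm_\<mu>: "h.sm \<mu>"
    using smooth by (simp add: smooth_function_def)
  have P: "pd M i (\<lambda>y. pd M i \<mu> y (A i y v)) x w - pd M i (\<lambda>y. pd M i \<mu> y (A i y w)) x v = 2 * g0 i x (A i x v) w"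
    if A: "A \<in> {I, J, K}" and x: "x \<in> h.dom" for A x v w
  proof -
    have s: "h.sm (\<lambda>y. pd M i \<mu> y (A i y v))" for v
      by (rule h.sm_apply[OF h.linear_pd[OF sm_\<mu>] h.sm_pd[OF sm_\<mu>] endo_field_smooth[OF endo[OF A]]])
    have "1/2 * ext_diff M (act_form A (diff M \<mu>)) i x v w = fund_form g0 A i x v w"
      using pot A x unfolding hyperkaehler_potential_def by blast
    then show ?thesis
      by (simp add: ext_diff_def act_form_def diff_def fund_form_def h.pd_minus[OF s x])
  qed
  show ?thesis
    by (rule hyperkaehler_chart.intro[OF h.hyperhermitian_chart_axioms hyperkaehler_chart_axioms.intro])
      (rule parallel P sm_\<mu>; simp)+
qed

lemma diff_linear: "x \<in> chart_dom M i \<Longrightarrow> linear (diff M \<mu> i x)"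
  using hyperkaehler_chart.lin_d\<mu>[OF hyperkaehler] by (simp add: diff_def[abs_def])

lemma diff_change:
  assumes "x \<in> chart_dom M i" "x \<in> chart_dom M j"
  shows "diff M \<mu> j x (jac M i j x v) = diff M \<mu> i x v"
proof -
  interpret overlap M i j x
    using assms M by unfold_locales
  show ?thesis
    by (simp add: diff_def diff_change[OF smooth])
qed

lemma f_chart:
  assumes x: "x \<in> chart_dom M i"
  shows "f x = p * g0 i x (sharp (g0 i x) (diff M \<mu> i x)) (sharp (g0 i x) (diff M \<mu> i x)) + 1"
proof -
  have "form_prod M g0 (diff M \<mu>) (diff M \<mu>) x =
      g0 i x (sharp (g0 i x) (diff M \<mu> i x)) (sharp (g0 i x) (diff M \<mu> i x))"
    by (rule form_prod_chart[OF metric _ _ x]) (use diff_linear diff_change x in auto)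
  then show ?thesis
    by (simp add: conf_factor_def)
qed

lemma open_V: "openin (points M) V"
proof -
  have "openin (points M) (chart_dom M i \<inter> V)" for i
  proof -
    interpret c: hyperkaehler_chart M i g0 I J K \<mu> by (rule hyperkaehler)
    have sm_f: "c.sm f"
    proof (rule c.sm_cong)
      show "c.sm (\<lambda>x. p * c.norm2 x + 1)"
        by (intro c.sm_add c.sm_mult c.sm_const c.sm_norm2)
      show "p * c.norm2 x + 1 = f x" if "x \<in> c.dom" for x
        by (simp add: f_chart[OF that] c.norm2_def diff_def[abs_def])
    qed
    let ?W = "{y \<in> coord M i ` c.dom. (f \<circ> chart_inv M i) y \<in> - {0}}"
    have "continuous_on (coord M i ` c.dom) (f \<circ> chart_inv M i)"
      using c.smE[OF sm_f, of 0] by simp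
    then have "open ?W"
      using continuous_open_preimage[OF _ c.open_image, of "f \<circ> chart_inv M i" "- {0}"]
      by (simp add: vimage_def Int_def open_Compl)
    then have "openin (top_of_set (coord M i ` c.dom)) ?W"
      by (intro open_openin_trans[OF c.open_image]) auto
    then have "openin (subtopology (points M) c.dom)
        {x \<in> topspace (subtopology (points M) c.dom). coord M i x \<in> ?W}"
      by (rule openin_continuous_map_preimage[OF homeomorphic_imp_continuous_map[OF coord_homeomorphic[OF M]]])
    then have "openin (points M) {x \<in> topspace (subtopology (points M) c.dom). coord M i x \<in> ?W}"
      by (rule openin_trans_full[OF _ chart_dom_openin[OF M]])
    moreover have "{x \<in> topspace (subtopology (points M) c.dom). coord M i x \<in> ?W} = c.dom \<inter> V"
      using chart_dom_topspace[OF M, of i] by (auto dest: inj_onD[OF c.inj_coord])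
    ultimately show ?thesis by simp
  qed
  then have "openin (points M) (\<Union>i. chart_dom M i \<inter> V)"
    by blast
  moreover have "(\<Union>i. chart_dom M i \<inter> V) = V"
    using in_some_chart[OF M] by blast
  ultimately show ?thesis by simp
qed

sublocale part: open_part M V
  by (rule open_part.intro[OF M open_V])

lemma dom_f: "x \<in> chart_dom Mp i \<Longrightarrow> x \<in> chart_dom M i" "x \<in> chart_dom Mp i \<Longrightarrow> x \<in> V"
  by simp_all

lemma qk_domain_eq: "qk_domain M g0 \<mu> p = Mp"
  by (simp add: qk_domain_def)

lemma diff_Mp:
  assumes x: "x \<in> chart_dom Mp i"
  shows "diff M \<mu> i x = pd Mp i \<mu> x"
  by (intro ext) (simp only: diff_def part.pd_N[OF dom_f(1)[OF x] dom_f(2)[OF x]])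

lemma from_chart: "from_hyperkaehler_chart Mp i g0 I J K \<mu> p f gp"
proof -
  interpret c: hyperkaehler_chart Mp i g0 I J K \<mu>
    by (rule part.hyperkaehler_chart_N[OF hyperkaehler])
  show ?thesis
  proof (rule from_hyperkaehler_chart.intro[OF c.hyperkaehler_chart_axioms from_hyperkaehler_chart_axioms.intro[OF p]])
    fix x assume x: "x \<in> chart_dom Mp i"
    show "f x = p * c.norm2 x + 1"
      unfolding f_chart[OF dom_f(1)[OF x]] c.norm2_def diff_Mp[OF x] ..
    show "f x \<noteq> 0"
      using x by simp
    show "gp i x v w = - (p / (f x)\<^sup>2) * quaternionic_space.Q (I i x) (J i x) (K i x) (c.d\<mu> x) v w
        + 1 / f x * g0 i x v w" for v w
      unfolding qk_metric_def one_plus_L_def L_op_def tensor_prod_def diff_Mp[OF x]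
        quaternionic_space.Q_def[OF c.quaternionic[OF x]] by (simp only: add.assoc)
  qed
qed

lemma from_chart_cyclic:
  "from_hyperkaehler_chart Mp i g0 J K I \<mu> p f gp" "from_hyperkaehler_chart Mp i g0 K I J \<mu> p f gp"
  by (rule from_hyperkaehler_chart.from_hyperkaehler_cyclic[OF from_chart]
      from_hyperkaehler_chart.from_hyperkaehler_cyclic[OF from_hyperkaehler_chart.from_hyperkaehler_cyclic[OF from_chart]])+

lemma pseudo_riemannian_p: "pseudo_riemannian Mp gp"
proof -
  have sp: "scalar_product (gp i x)" if "x \<in> chart_dom Mp i" for i x
    using hermitian_space.axioms(1)[OF from_hyperkaehler_chart.hermitian_p[OF from_chart that]] .
  have "gp j x (jac Mp i j x v) (jac Mp i j x w) = gp i x v w"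
    if x: "x \<in> chart_dom Mp i" "x \<in> chart_dom Mp j" for i j x v w
  proof -
    note xM = dom_f(1)[OF x(1)] dom_f(1)[OF x(2)]
    show ?thesis
      unfolding part.jac_N[OF dom_f(1)[OF x(1)] dom_f(2)[OF x(1)]]
      by (simp add: qk_metric_def one_plus_L_def L_op_def tensor_prod_def pseudo_riemannian_change[OF metric xM]
          diff_change[OF xM] endo_field_change[OF endo xM])
  qed
  then show ?thesis
    using part.smooth_N sp scalar_product.bilinear[OF sp] scalar_product.sym[OF sp] scalar_product.nondegenerate[OF sp]
      from_hyperkaehler_chart.sm_gp[OF from_chart]
    unfolding pseudo_riemannian_def bilinear_field_def by blast
qed

lemma ahc_p: "almost_hypercomplex Mp I J K"
  using ahc part.endo_field_N by (auto simp: almost_hypercomplex_def almost_complex_def)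

lemma orthogonal_p:
  assumes A: "A \<in> {I, J, K}"
  shows "orthogonal_endo Mp gp A"
  unfolding orthogonal_endo_def
proof (intro allI ballI)
  fix i x v w assume x: "x \<in> chart_dom Mp i"
  interpret h: hermitian_space "gp i x" "I i x" "J i x" "K i x"
    by (rule from_hyperkaehler_chart.hermitian_p[OF from_chart x])
  show "gp i x (A i x v) (A i x w) = gp i x v w"
    using A h.orthI h.orthJ h.orthK by auto
qed

lemma hypercomplex_p: "hypercomplex Mp I J K"
proof -
  have "nijenhuis Mp A i x v w = 0" if A: "A \<in> {I, J, K}" and x: "x \<in> chart_dom Mp i" for A i x v w
  proof -
    interpret c: metric_chart M i g0 by (rule pseudo_riemannian_metric_chart[OF metric])
    note xM = dom_f(1)[OF x]
    have "nijenhuis M A i x v w = 0"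
      using c.nijenhuis_nabla[where A = A, OF endo_field_linear[OF endo[OF A]] endo_field_smooth[OF endo[OF A]] xM, of v w]
      by (simp add: parallel[OF A xM] linear_0[OF endo_field_linear[OF endo[OF A] xM]])
    then show ?thesis
      using part.nijenhuis_N[OF xM dom_f(2)[OF x]] by simp
  qed
  then show ?thesis
    using ahc_p by (simp add: hypercomplex_def integrable_acs_def)
qed

lemma reduced_p: "has_reduced_scalar_curvature Mp gp (4 * p)"
  unfolding has_reduced_scalar_curvature_def
  using from_hyperkaehler_chart.reduced_scalar_curvature_p[OF from_chart _ dim4] by blast

lemma parallel_p: "parallel_subbundle Mp gp (endo_span I J K)"
  unfolding parallel_subbundle_def
proof (intro allI impI ballI)
  fix U A i x z
  assume U: "openin (points Mp) U" and A: "endo_field (submanifold Mp U) A"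
    and span: "\<forall>i. \<forall>x\<in>chart_dom Mp i \<inter> U. A i x \<in> endo_span I J K i x"
    and x: "x \<in> chart_dom Mp i \<inter> U"
  interpret u: open_part Mp U
    using part.smooth_N U by (rule open_part.intro)
  interpret l: lee_chart "submanifold Mp U" i gp I J K "from_hyperkaehler_chart.\<phi> Mp i \<mu> p f"
    by (rule u.lee_chart_N[OF from_hyperkaehler_chart.lee_chart_p[OF from_chart]])
  show "nabla_endo (submanifold Mp U) gp A i x z \<in> endo_span I J K i x"
  proof (rule l.nabla_endo_span)
    show "linear (A i y)" if "y \<in> l.dom" for y
      by (rule endo_field_linear[OF A that])
    show "l.sm (\<lambda>y. A i y v)" for v
      by (rule endo_field_smooth[OF A])
    show "A i y \<in> endo_span I J K i y" if "y \<in> l.dom" for y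
      using span that by simp
    show "x \<in> l.dom"
      using x by simp
  qed
qed

lemma hhqk_p: "pseudo_hHqK Mp gp I J K"
  unfolding pseudo_hHqK_def pseudo_quaternionic_kaehler_def
proof (intro conjI ballI allI dim pseudo_riemannian_p parallel_p hypercomplex_p)
  show "\<exists>U I' J' K'. openin (points Mp) U \<and> x \<in> U \<and> almost_hypercomplex (submanifold Mp U) I' J' K' \<and>
        orthogonal_endo (submanifold Mp U) gp I' \<and> orthogonal_endo (submanifold Mp U) gp J' \<and>
        orthogonal_endo (submanifold Mp U) gp K' \<and>
        (\<forall>i. \<forall>y\<in>chart_dom Mp i \<inter> U. endo_span I J K i y = endo_span I' J' K' i y)"
    if "x \<in> topspace (points Mp)" for x
  proof (rule exI[of _ "topspace (points Mp)"], rule exI[of _ I], rule exI[of _ J], rule exI[of _ K],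
      unfold submanifold_topspace[OF part.smooth_N], intro conjI)
    show "orthogonal_endo Mp gp I" "orthogonal_endo Mp gp J" "orthogonal_endo Mp gp K"
      by (rule orthogonal_p; simp)+
  qed (rule openin_topspace that ahc_p allI ballI refl)+
  show "scalar_curvature Mp gp i x \<noteq> 0" if "x \<in> chart_dom Mp i" for i x
  proof
    assume "scalar_curvature Mp gp i x = 0"
    then have "reduced_scalar_curvature Mp gp i x = 0"
      by (simp add: reduced_scalar_curvature_def Let_def)
    then show False
      using reduced_p that p by (simp add: has_reduced_scalar_curvature_def)
  qed
qed

lemma lee_form_I:
  assumes x: "x \<in> chart_dom Mp i"
  shows "lee_form Mp gp I i x = from_hyperkaehler_chart.\<phi> Mp i \<mu> p f x"
  using lee_chart.lee_form_eq[OF from_hyperkaehler_chart.lee_chart_p[OF from_chart] x] by (intro ext)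

lemma lee_form_p:
  assumes A: "A \<in> {I, J, K}" and x: "x \<in> chart_dom Mp i"
  shows "lee_form Mp gp A i x v = - diff Mp (\<lambda>y. ln \<bar>f y\<bar>) i x v"
proof -
  have "lee_form Mp gp A i x v = from_hyperkaehler_chart.\<phi> Mp i \<mu> p f x v"
    using A lee_chart.lee_form_eq[OF from_hyperkaehler_chart.lee_chart_p[OF from_chart] x]
      lee_chart.lee_form_eq[OF from_hyperkaehler_chart.lee_chart_p[OF from_chart_cyclic(1)] x]
      lee_chart.lee_form_eq[OF from_hyperkaehler_chart.lee_chart_p[OF from_chart_cyclic(2)] x]
    by auto
  then show ?thesis
    by (simp only: from_hyperkaehler_chart.\<phi>_log[OF from_chart x] diff_def)
qed

lemma positive_p:
  assumes x: "x \<in> chart_dom Mp i"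
  shows "f x > 0 \<Longrightarrow> pos_def (g0 i x) \<Longrightarrow> pos_def (gp i x)"
    "f x < 0 \<Longrightarrow> has_signature (g0 i x) 4 s \<Longrightarrow> pos_def_on (span_H g0 I J K (diff M \<mu>) i x) (g0 i x) \<Longrightarrow>
      pos_def (gp i x)"
proof -
  interpret c: from_hyperkaehler_chart Mp i g0 I J K \<mu> p f gp by (rule from_chart)
  interpret h: hermitian_space "g0 i x" "I i x" "J i x" "K i x" by (rule c.hermitian[OF x])
  have gp: "gp i x = (\<lambda>v w. - (p / (f x)\<^sup>2) * h.Q (c.d\<mu> x) v w + 1 / f x * g0 i x v w)"
    by (intro ext) (rule c.gp_eq[OF x])
  have f: "f x = p * c.d\<mu> x (sharp (g0 i x) (c.d\<mu> x)) + 1"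
    using c.f_eq[OF x] c.norm2_eq[OF x] by simp
  show "pos_def (gp i x)" if "f x > 0" "pos_def (g0 i x)"
    unfolding gp by (rule h.positive_inverse_combination[OF c.lin_d\<mu>[OF x] c.dual[OF x] that(2) f that(1)])
  show "pos_def (gp i x)"
    if "f x < 0" "has_signature (g0 i x) 4 s" "pos_def_on (span_H g0 I J K (diff M \<mu>) i x) (g0 i x)"
  proof -
    have lin: "linear (diff M \<mu> i x)"
      by (rule diff_linear[OF dom_f(1)[OF x]])
    note span = span_H_eq[where g = g0 and I = I and J = J and K = K and \<psi> = "diff M \<mu>" and i = i and x = x,
        OF c.hermitian[OF x] lin, unfolded diff_Mp[OF x]]
    show ?thesis
      unfolding gp
      by (rule h.signature_inverse_combination[OF c.lin_d\<mu>[OF x] c.dual[OF x] that(2) that(3)[unfolded span] f that(1)])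
  qed
qed

lemma form_prod_lee:
  assumes x: "x \<in> chart_dom Mp i"
  shows "form_prod Mp gp (lee_form Mp gp I) (lee_form Mp gp I) x =
    4 * p\<^sup>2 * hyperkaehler_chart.norm2 Mp i g0 \<mu> x"
proof -
  have endo_p: "endo_field Mp I"
    by (rule part.endo_field_N[OF endo]) simp
  have lin: "linear (lee_form Mp gp I k x)" if "x \<in> chart_dom Mp k" for k
    unfolding lee_form_I[OF that] by (rule from_hyperkaehler_chart.lin_\<phi>[OF from_chart that])
  have change: "lee_form Mp gp I k x (jac Mp i k x v) = lee_form Mp gp I i x v" if "x \<in> chart_dom Mp k" for k v
  proof -
    interpret o: overlap Mp i k x
      by (rule overlap.intro[OF part.smooth_N x that])
    show ?thesis
      by (rule o.lee_form_change[OF pseudo_riemannian_p endo_p])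
  qed
  have "form_prod Mp gp (lee_form Mp gp I) (lee_form Mp gp I) x =
      gp i x (sharp (gp i x) (lee_form Mp gp I i x)) (sharp (gp i x) (lee_form Mp gp I i x))"
    by (rule form_prod_chart[OF pseudo_riemannian_p _ _ x]) (rule lin change; assumption)+
  then show ?thesis
    unfolding lee_form_I[OF x] from_hyperkaehler_chart.norm_p[OF from_chart x] .
qed

lemma recovers_metric:
  assumes x: "x \<in> chart_dom Mp i"
  shows "hk_metric Mp gp I J K (4 * p) i x v w = g0 i x v w"
proof -
  interpret c: from_hyperkaehler_chart Mp i g0 I J K \<mu> p f gp by (rule from_chart)
  have "hk_metric Mp gp I J K (4 * p) i x v w =
      1 / (4 * p)\<^sup>2 * (4 * p\<^sup>2 * c.norm2 x + 4 * p) * (c.Qx x v w + 4 * p * gp i x v w)"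
    unfolding hk_metric_def Let_def form_prod_lee[OF x] one_plus_L_def L_op_def tensor_prod_def lee_form_I[OF x]
      quaternionic_space.Q_def[OF c.quaternionic[OF x]] by (simp only: add.assoc)
  then show ?thesis
    unfolding c.recover_metric_p[OF x] .
qed

end

theorem theorem5p1:
  fixes n :: nat
  assumes n: "n > 1" and dim: "DIM('e::euclidean_space) = 4 * n"
  shows
    "(\<comment> \<open>(i)\<close>
      \<forall>(M :: ('a, 'i, 'e) manifold) g I J K \<nu>.
        hHqK M g I J K \<and> has_reduced_scalar_curvature M g \<nu> \<and> closed_form M (lee_form M g I) \<and>
        (\<forall>x\<in>topspace (points M). form_prod M g (lee_form M g I) (lee_form M g I) x + \<nu> \<noteq> 0) \<longrightarrow>
        (let \<phi> = lee_form M g I; N = form_prod M g \<phi> \<phi>; g0 = hk_metric M g I J K \<nu> in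
          pseudo_hyperkaehler M g0 I J K \<and>
          hyperkaehler_potential M g0 I J K (hk_potential M g I \<nu>) \<and>
          (\<forall>i. \<forall>x\<in>chart_dom M i. \<nu> * (N x + \<nu>) > 0 \<longrightarrow> pos_def (g0 i x)) \<and>
          (\<nu> > 0 \<longrightarrow> (\<forall>i. \<forall>x\<in>chart_dom M i. pos_def (g0 i x))) \<and>
          (\<forall>i. \<forall>x\<in>chart_dom M i. \<nu> * (N x + \<nu>) < 0 \<longrightarrow>
             has_signature (g0 i x) 4 (4 * (n - 1)) \<and>
             pos_def_on (span_H g I J K \<phi> i x) (g0 i x))))
   \<and> (\<comment> \<open>(ii)\<close>
      \<forall>(M :: ('a, 'i, 'e) manifold) g0 I J K \<mu> p.
        pseudo_hyperkaehler M g0 I J K \<and> hyperkaehler_potential M g0 I J K \<mu> \<and> p \<noteq> 0 \<longrightarrow>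
        (let f = conf_factor M g0 \<mu> p; Mp = qk_domain M g0 \<mu> p; gp = qk_metric M g0 I J K \<mu> p in
          pseudo_hHqK Mp gp I J K \<and>
          (\<forall>A\<in>{I, J, K}. \<forall>i. \<forall>x\<in>chart_dom Mp i. \<forall>v.
             lee_form Mp gp A i x v = - diff Mp (\<lambda>y. ln \<bar>f y\<bar>) i x v) \<and>
          has_reduced_scalar_curvature Mp gp (4 * p) \<and>
          (\<forall>i. \<forall>x\<in>chart_dom Mp i. f x > 0 \<and> pos_def (g0 i x) \<longrightarrow> pos_def (gp i x)) \<and>
          (\<forall>i. \<forall>x\<in>chart_dom Mp i.
             f x < 0 \<and> has_signature (g0 i x) 4 (4 * (n - 1)) \<and>
             pos_def_on (span_H g0 I J K (diff M \<mu>) i x) (g0 i x) \<longrightarrow> pos_def (gp i x))))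
   \<and> (\<comment> \<open>(iii), starting from a hHqK manifold\<close>
      \<forall>(M :: ('a, 'i, 'e) manifold) g I J K \<nu>.
        hHqK M g I J K \<and> has_reduced_scalar_curvature M g \<nu> \<and> closed_form M (lee_form M g I) \<and>
        (\<forall>x\<in>topspace (points M). form_prod M g (lee_form M g I) (lee_form M g I) x + \<nu> \<noteq> 0) \<longrightarrow>
        (let g0 = hk_metric M g I J K \<nu>; \<mu> = hk_potential M g I \<nu> in
          \<forall>i. \<forall>x\<in>chart_dom M i.
            conf_factor M g0 \<mu> (1/4 * \<nu>) x \<noteq> 0 \<and>
            (\<forall>v w. qk_metric M g0 I J K \<mu> (1/4 * \<nu>) i x v w = g i x v w)))
   \<and> (\<comment> \<open>(iii), starting from a pseudo-hyper-Kaehler manifold with potential\<close>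
      \<forall>(M :: ('a, 'i, 'e) manifold) g0 I J K \<mu> p.
        pseudo_hyperkaehler M g0 I J K \<and> hyperkaehler_potential M g0 I J K \<mu> \<and> p \<noteq> 0 \<longrightarrow>
        (let Mp = qk_domain M g0 \<mu> p; gp = qk_metric M g0 I J K \<mu> p in
          \<forall>i. \<forall>x\<in>chart_dom Mp i. \<forall>v w.
            hk_metric Mp gp I J K (4 * p) i x v w = g0 i x v w))"
proof -
  have dim4: "DIM('e) > 4" and dimn: "\<exists>m>1. DIM('e) = 4 * m"
    using n dim by auto
  show ?thesis
  proof (intro conjI allI impI, goal_cases)
    case (1 M g I J K \<nu>)
    interpret c: closed_hhqk M g I J K \<nu>
      using 1 dim4 by (intro closed_hhqk.intro) blast+
    show ?case
      unfolding Let_def using c.hyperkaehler0 c.potential0 c.signatures[OF _ dim] by blast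
  next
    case (2 M g0 I J K \<mu> p)
    interpret h: hk_with_potential M g0 I J K \<mu> p
      using 2 dimn by (intro hk_with_potential.intro) blast+
    show ?case
      unfolding Let_def h.qk_domain_eq
      using h.hhqk_p h.lee_form_p h.reduced_p h.positive_p by blast
  next
    case (3 M g I J K \<nu>)
    interpret c: closed_hhqk M g I J K \<nu>
      using 3 dim4 by (intro closed_hhqk.intro) blast+
    show ?case
      unfolding Let_def using c.recovers_metric by blast
  next
    case (4 M g0 I J K \<mu> p)
    interpret h: hk_with_potential M g0 I J K \<mu> p
      using 4 dimn by (intro hk_with_potential.intro) blast+
    show ?case
      unfolding Let_def h.qk_domain_eq using h.recovers_metric by blast
  qed
qed

end
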